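(* Fix $\alpha>0$ and $\Delta>0$, and let $N=N(p)$ satisfy $N/p\to\alpha$ as $p\to\infty$. Consider the Bayesian linear regression model $\mathbf{y}=\mathbf{x}\boldsymbol{\beta}+\sqrt{\Delta}\,\boldsymbol{\epsilon}$, where $\mathbf{x}\in\mathbb{R}^{N\times p}$ has i.i.d. $\mathcal{N}(0,\tfrac1N)$ entries, $\boldsymbol{\epsilon}\sim\mathcal{N}(0,I_N)$, $\boldsymbol{\beta}\sim\pi$ with $\pi$ the uniform distribution on the sphere $\mathbb{S}^{p-1}(\sqrt p)=\{b\in\mathbb{R}^p:\|b\|=\sqrt p\}$, and $\mathbf{x},\boldsymbol{\beta},\boldsymbol{\epsilon}$ are independent. Then, as $p\to\infty$, the random variables $\max_{\|a\|\le\sqrt p} f_{\mathrm{TAP}}(a)$ and $F_p$ both converge in probability (with respect to the randomness in $\mathbf{x},\boldsymbol{\beta},\boldsymbol{\epsilon}$), to the same deterministic limit: $$\lim_{p\to\infty}\max_{\|a\|\le\sqrt p} f_{\mathrm{TAP}}(a)=\lim_{p\to\infty}F_p .$$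
   Context: $\|\cdot\|$ is the Euclidean norm and $\ln$ the natural logarithm. For $a\in\mathbb{R}^p$ with $\|a\|\le\sqrt p$, write $q=\|a\|^2/p$; the TAP free energy functional is $$f_{\mathrm{TAP}}(a)=-\frac{1}{2\Delta p}\|\mathbf{y}-\mathbf{x}a\|^2-\frac{\alpha}{2}\ln\Big(1+\frac{1-q}{\Delta\alpha}\Big)+\frac12\ln(1-q),$$ with the convention $\ln 0=-\infty$. The partition function is $\mathcal{Z}_p=\int e^{-\frac{1}{2\Delta}\|\mathbf{y}-\mathbf{x}b\|^2}\,d\pi(b)$ and the free energy is $F_p=\frac1p\ln\mathcal{Z}_p$. *)

theory Defs
  imports "HOL-Probability.Probability"
begin

section \<open>Vectors and matrices\<close>

text \<open>
  The dimension \<open>p\<close> tends to infinity, so a vector in \<open>\<real>\<^sup>p\<close> is an element of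
  \<open>{..<p} \<rightarrow>\<^sub>E UNIV\<close>, the space underlying \<open>\<Pi>\<^sub>M i\<in>{..<p}. borel\<close>, and an
  \<open>N \<times> p\<close> matrix is a function on \<open>{..<N} \<times> {..<p}\<close>. The Euclidean norm is
  \<^const>\<open>L2_set\<close>.
\<close>

abbreviation vec_borel :: "nat \<Rightarrow> (nat \<Rightarrow> real) measure" where
  "vec_borel p \<equiv> \<Pi>\<^sub>M i\<in>{..<p}. borel"

abbreviation mat_borel :: "nat \<Rightarrow> nat \<Rightarrow> (nat \<times> nat \<Rightarrow> real) measure" where
  "mat_borel N p \<equiv> \<Pi>\<^sub>M ij\<in>{..<N} \<times> {..<p}. borel"

definition mat_vec :: "nat \<Rightarrow> (nat \<times> nat \<Rightarrow> real) \<Rightarrow> (nat \<Rightarrow> real) \<Rightarrow> nat \<Rightarrow> real" where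
  "mat_vec p A b i = (\<Sum>j<p. A (i, j) * b j)"

definition vec_cball :: "nat \<Rightarrow> (nat \<Rightarrow> real) set" where
  "vec_cball p = {a \<in> {..<p} \<rightarrow>\<^sub>E UNIV. L2_set a {..<p} \<le> sqrt (real p)}"

definition vec_sphere :: "nat \<Rightarrow> (nat \<Rightarrow> real) set" where
  "vec_sphere p = {a \<in> {..<p} \<rightarrow>\<^sub>E UNIV. L2_set a {..<p} = sqrt (real p)}"

section \<open>The uniform distribution on the sphere of radius \<open>\<surd>p\<close>\<close>

text \<open>
  Normalised surface measure, as the cone measure: the measure of a subset of the sphere is
  the relative Lebesgue volume of the cone over it inside the ball of the same radius.
\<close>

definition sphere_uniform :: "nat \<Rightarrow> (nat \<Rightarrow> real) measure" where
  "sphere_uniform p =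
     distr (uniform_measure (\<Pi>\<^sub>M i\<in>{..<p}. lborel) (vec_cball p)) (vec_borel p)
       (\<lambda>b. \<lambda>i\<in>{..<p}. sqrt (real p) * b i / L2_set b {..<p})"

lemma vec_cball_eq:
  "vec_cball p = {f. sqrt (\<Sum>i\<in>{..<p}. (f i)\<^sup>2) \<le> sqrt (real p)} \<inter> space (\<Pi>\<^sub>M i\<in>{..<p}. lborel)"
  by (auto simp: vec_cball_def L2_set_def space_PiM)

lemma vec_cball_sets: "vec_cball p \<in> sets (\<Pi>\<^sub>M i\<in>{..<p}. lborel)"
proof -
  have "{f \<in> space (\<Pi>\<^sub>M i\<in>{..<p}. lborel). sqrt (\<Sum>i\<in>{..<p}. (f i)\<^sup>2) \<le> sqrt (real p)}
          \<in> sets (\<Pi>\<^sub>M i\<in>{..<p}. lborel)"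
    by measurable
  then show ?thesis
    unfolding vec_cball_eq by (simp add: Int_def conj_commute)
qed

lemma sphere_uniform_map_measurable:
  "(\<lambda>b. \<lambda>i\<in>{..<p}. sqrt (real p) * b i / L2_set b {..<p})
     \<in> uniform_measure (\<Pi>\<^sub>M i\<in>{..<p}. lborel) (vec_cball p) \<rightarrow>\<^sub>M vec_borel p"
  unfolding L2_set_def
  by (subst measurable_cong_sets [OF sets_uniform_measure refl]) measurable

lemma emeasure_vec_cball:
  "emeasure (\<Pi>\<^sub>M i\<in>{..<p}. lborel) (vec_cball p) \<noteq> 0"
  "emeasure (\<Pi>\<^sub>M i\<in>{..<p}. lborel) (vec_cball p) \<noteq> \<infinity>"
proof -
  have *: "emeasure (\<Pi>\<^sub>M i\<in>{..<p}. lborel) (vec_cball p) \<noteq> 0 \<and>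
        emeasure (\<Pi>\<^sub>M i\<in>{..<p}. lborel) (vec_cball p) \<noteq> \<infinity>"
  proof (cases "p = 0")
    case True
    then have "vec_cball p = {\<lambda>_. undefined}"
      by (auto simp: vec_cball_def)
    with True show ?thesis
      by (simp add: PiM_empty)
  next
    case False
    have "emeasure (\<Pi>\<^sub>M i\<in>{..<p}. lborel) (vec_cball p)
        = ennreal (unit_ball_vol (real (card {..<p})) * sqrt (real p) ^ card {..<p})"
      unfolding vec_cball_eq by (rule emeasure_cball_aux) (use False in auto)
    moreover have "unit_ball_vol (real (card {..<p})) * sqrt (real p) ^ card {..<p} > 0"
      using False by (intro mult_pos_pos unit_ball_vol_pos zero_less_power) auto
    ultimately show ?thesis
      by auto
  qed
  show "emeasure (\<Pi>\<^sub>M i\<in>{..<p}. lborel) (vec_cball p) \<noteq> 0"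
    "emeasure (\<Pi>\<^sub>M i\<in>{..<p}. lborel) (vec_cball p) \<noteq> \<infinity>"
    using * by auto
qed

lemma prob_space_sphere_uniform: "prob_space (sphere_uniform p)"
  unfolding sphere_uniform_def
  by (intro prob_space.prob_space_distr prob_space_uniform_measure emeasure_vec_cball
        sphere_uniform_map_measurable)

lemma AE_sphere_uniform: "AE b in sphere_uniform p. b \<in> vec_sphere p"
proof -
  let ?L = "\<Pi>\<^sub>M i\<in>{..<p}. (lborel :: real measure)"
  interpret product_sigma_finite "\<lambda>_::nat. lborel :: real measure" ..
  have nz: "AE b in ?L. p = 0 \<or> L2_set b {..<p} \<noteq> 0"
  proof (cases "p = 0")
    case False
    have "emeasure ?L (\<Pi>\<^sub>E i\<in>{..<p}. {0}) = (\<Prod>i<p. emeasure lborel {0::real})"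
      by (rule emeasure_PiM) auto
    also have "\<dots> = 0"
      using False by auto
    finally have "(\<Pi>\<^sub>E i\<in>{..<p}. {0}) \<in> null_sets ?L"
      by (intro null_setsI sets_PiM_I_finite) auto
    then show ?thesis
      by (rule AE_I') (auto simp: L2_set_eq_0_iff space_PiM fun_eq_iff PiE_def extensional_def)
  qed auto
  have "AE b in uniform_measure ?L (vec_cball p). p = 0 \<or> L2_set b {..<p} \<noteq> 0"
    using nz by (intro AE_uniform_measureI vec_cball_sets) auto
  then have "AE b in uniform_measure ?L (vec_cball p).
      (\<lambda>i\<in>{..<p}. sqrt (real p) * b i / L2_set b {..<p}) \<in> vec_sphere p"
  proof (rule AE_mp, intro AE_I2 impI)
    fix b assume b: "p = 0 \<or> L2_set b {..<p} \<noteq> 0"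
    have "L2_set (\<lambda>i\<in>{..<p}. sqrt (real p) * b i / L2_set b {..<p}) {..<p} = 
          L2_set (\<lambda>i. (sqrt (real p) / L2_set b {..<p}) * b i) {..<p}"
      by (rule L2_set_cong) auto
    also have "\<dots> = (sqrt (real p) / L2_set b {..<p}) * L2_set b {..<p}"
      by (rule L2_set_right_distrib [symmetric]) (simp add: L2_set_nonneg)
    also have "\<dots> = sqrt (real p)"
      using b by auto
    finally show "(\<lambda>i\<in>{..<p}. sqrt (real p) * b i / L2_set b {..<p}) \<in> vec_sphere p"
      by (simp add: vec_sphere_def)
  qed
  moreover have "{b \<in> space (vec_borel p). b \<in> vec_sphere p} \<in> sets (vec_borel p)"
  proof -
    have "{b \<in> space (vec_borel p). L2_set b {..<p} = sqrt (real p)} \<in> sets (vec_borel p)"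
      unfolding L2_set_def by measurable
    moreover have "{b \<in> space (vec_borel p). b \<in> vec_sphere p} =
        {b \<in> space (vec_borel p). L2_set b {..<p} = sqrt (real p)}"
      by (auto simp: vec_sphere_def space_PiM)
    ultimately show ?thesis by simp
  qed
  ultimately show ?thesis
    unfolding sphere_uniform_def
    by (subst AE_distr_iff) (simp_all add: sphere_uniform_map_measurable)
qed

section \<open>The Bayesian linear regression model\<close>

text \<open>
  The law of \<open>x\<close> is the product of \<open>N * p\<close> copies of the centred normal law of variance
  \<open>1 / N\<close>; note that \<^const>\<open>normal_density\<close> is parametrised by the standard deviation.
  Independence is stated for the \<open>\<sigma>\<close>-algebras generated by \<open>x\<close>, \<open>\<beta>\<close>, \<open>\<epsilon>\<close>
  because \<^const>\<open>prob_space.indep_vars\<close> requires variables of equal type.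
\<close>

locale linear_regression = prob_space M
  for M :: "'a measure" +
  fixes N p :: nat and \<Delta> :: real
    and x :: "'a \<Rightarrow> nat \<times> nat \<Rightarrow> real"
    and \<beta> \<epsilon> y :: "'a \<Rightarrow> nat \<Rightarrow> real"
  assumes x_measurable: "random_variable (mat_borel N p) x"
    and x_law: "distr M (mat_borel N p) x =
      (\<Pi>\<^sub>M ij\<in>{..<N} \<times> {..<p}. density lborel (normal_density 0 (sqrt (1 / real N))))"
    and \<beta>_measurable: "random_variable (vec_borel p) \<beta>"
    and \<beta>_law: "distr M (vec_borel p) \<beta> = sphere_uniform p"
    and \<epsilon>_measurable: "random_variable (vec_borel N) \<epsilon>"
    and \<epsilon>_law: "distr M (vec_borel N) \<epsilon> = (\<Pi>\<^sub>M i\<in>{..<N}. density lborel std_normal_density)"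
    and independent: "indep_sets
      (\<lambda>k. [sets (vimage_algebra (space M) x (mat_borel N p)),
            sets (vimage_algebra (space M) \<beta> (vec_borel p)),
            sets (vimage_algebra (space M) \<epsilon> (vec_borel N))] ! k) {..<3}"
    and y_eq: "\<And>\<omega> i. \<omega> \<in> space M \<Longrightarrow> i < N \<Longrightarrow>
      y \<omega> i = mat_vec p (x \<omega>) (\<beta> \<omega>) i + sqrt \<Delta> * \<epsilon> \<omega> i"

section \<open>The TAP free energy and the free energy\<close>

definition residual_norm ::
    "nat \<Rightarrow> nat \<Rightarrow> (nat \<times> nat \<Rightarrow> real) \<Rightarrow> (nat \<Rightarrow> real) \<Rightarrow> (nat \<Rightarrow> real) \<Rightarrow> real" where
  "residual_norm N p A v b = L2_set (\<lambda>i. v i - mat_vec p A b i) {..<N}"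

text \<open>In the library \<open>ln 0 = 0\<close>; here \<open>ln 0 = -\<infinity>\<close> is needed.\<close>

definition ext_ln :: "real \<Rightarrow> ereal" where
  "ext_ln t = (if t = 0 then -\<infinity> else ereal (ln t))"

definition overlap :: "nat \<Rightarrow> (nat \<Rightarrow> real) \<Rightarrow> real" where
  "overlap p a = (L2_set a {..<p})\<^sup>2 / real p"

definition f_TAP :: "real \<Rightarrow> real \<Rightarrow> nat \<Rightarrow> nat \<Rightarrow> (nat \<times> nat \<Rightarrow> real) \<Rightarrow> (nat \<Rightarrow> real)
    \<Rightarrow> (nat \<Rightarrow> real) \<Rightarrow> ereal" where
  "f_TAP \<alpha> \<Delta> N p A v a =
     ereal (- (1 / (2 * \<Delta> * real p)) * (residual_norm N p A v a)\<^sup>2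
            - \<alpha> / 2 * ln (1 + (1 - overlap p a) / (\<Delta> * \<alpha>)))
     + ereal (1 / 2) * ext_ln (1 - overlap p a)"

text \<open>The supremum is attained; see \<open>max_f_TAP_attained\<close> below.\<close>

definition max_f_TAP :: "real \<Rightarrow> real \<Rightarrow> nat \<Rightarrow> nat \<Rightarrow> (nat \<times> nat \<Rightarrow> real) \<Rightarrow> (nat \<Rightarrow> real)
    \<Rightarrow> ereal" where
  "max_f_TAP \<alpha> \<Delta> N p A v = (SUP a\<in>vec_cball p. f_TAP \<alpha> \<Delta> N p A v a)"

definition partition_function ::
    "real \<Rightarrow> nat \<Rightarrow> nat \<Rightarrow> (nat \<times> nat \<Rightarrow> real) \<Rightarrow> (nat \<Rightarrow> real) \<Rightarrow> real" where
  "partition_function \<Delta> N p A v =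
     (\<integral>b. exp (- (1 / (2 * \<Delta>)) * (residual_norm N p A v b)\<^sup>2) \<partial>sphere_uniform p)"

definition free_energy ::
    "real \<Rightarrow> nat \<Rightarrow> nat \<Rightarrow> (nat \<times> nat \<Rightarrow> real) \<Rightarrow> (nat \<Rightarrow> real) \<Rightarrow> real" where
  "free_energy \<Delta> N p A v = 1 / real p * ln (partition_function \<Delta> N p A v)"

lemma overlap_le_1: "a \<in> vec_cball p \<Longrightarrow> overlap p a \<le> 1"
proof -
  assume "a \<in> vec_cball p"
  then have "(L2_set a {..<p})\<^sup>2 \<le> (sqrt (real p))\<^sup>2"
    unfolding vec_cball_def by (intro power_mono) (auto simp: L2_set_nonneg)
  then show ?thesis
    unfolding overlap_def by (cases "p = 0") (auto simp: field_simps)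
qed

lemma continuous_on_apply_fun: "continuous_on S (\<lambda>a :: nat \<Rightarrow> real. a i)"
  by (rule continuous_on_subset [OF continuous_on_product_coordinates]) auto

lemma compact_vec_cball: "compact (vec_cball p)"
proof -
  define K where "K = (\<lambda>i. if i < p then {- sqrt (real p)..sqrt (real p)} else {undefined :: real})"
  have "compactin (product_topology (\<lambda>_. euclidean) UNIV) (PiE UNIV K)"
    by (subst compactin_PiE) (auto simp: K_def)
  then have "compact (PiE UNIV K)"
    by (simp add: euclidean_product_topology)
  moreover have "closed {a :: nat \<Rightarrow> real. L2_set a {..<p} \<le> sqrt (real p)}"
    unfolding L2_set_def
    by (intro closed_Collect_le continuous_intros continuous_on_apply_fun)
  ultimately have "compact (PiE UNIV K \<inter> {a. L2_set a {..<p} \<le> sqrt (real p)})"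
    by (rule compact_Int_closed)
  moreover have "vec_cball p = PiE UNIV K \<inter> {a. L2_set a {..<p} \<le> sqrt (real p)}"
  proof (intro set_eqI iffI)
    fix a assume a: "a \<in> vec_cball p"
    have "\<bar>a i\<bar> \<le> sqrt (real p)" if "i < p" for i
    proof -
      have "\<bar>a i\<bar> \<le> L2_set (\<lambda>i. \<bar>a i\<bar>) {..<p}"
        by (rule member_le_L2_set) (use that in auto)
      also have "\<dots> \<le> sqrt (real p)"
        using a by (simp add: vec_cball_def L2_set_def)
      finally show ?thesis .
    qed
    then show "a \<in> PiE UNIV K \<inter> {a. L2_set a {..<p} \<le> sqrt (real p)}"
      using a by (force simp: K_def vec_cball_def abs_le_iff PiE_def extensional_def Pi_def)
  next
    fix a assume "a \<in> PiE UNIV K \<inter> {a. L2_set a {..<p} \<le> sqrt (real p)}"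
    then show "a \<in> vec_cball p"
      by (auto simp: K_def vec_cball_def PiE_def extensional_def Pi_def split: if_splits)
  qed
  ultimately show ?thesis by simp
qed

lemma ext_ln_mono: "0 \<le> s \<Longrightarrow> s \<le> t \<Longrightarrow> ext_ln s \<le> ext_ln t"
  by (auto simp: ext_ln_def)

lemma max_f_TAP_attained:
  assumes "\<alpha> > 0" "\<Delta> > 0"
  shows "\<exists>a\<in>vec_cball p. f_TAP \<alpha> \<Delta> N p A v a = max_f_TAP \<alpha> \<Delta> N p A v"
proof -
  define g where "g a =
    exp (- (1 / (2 * \<Delta> * real p)) * (residual_norm N p A v a)\<^sup>2
            - \<alpha> / 2 * ln (1 + (1 - overlap p a) / (\<Delta> * \<alpha>))) * sqrt (1 - overlap p a)" for a
  have pos: "1 + (1 - overlap p a) / (\<Delta> * \<alpha>) > 0" if "a \<in> vec_cball p" for a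
    using overlap_le_1 [OF that] assms by (intro add_pos_nonneg divide_nonneg_pos) auto
  have nonneg: "0 \<le> g a" if "a \<in> vec_cball p" for a
    using overlap_le_1 [OF that] by (simp add: g_def)
  have f_eq: "f_TAP \<alpha> \<Delta> N p A v a = ext_ln (g a)" if "a \<in> vec_cball p" for a
    using overlap_le_1 [OF that]
    by (auto simp: f_TAP_def g_def ext_ln_def ln_mult ln_sqrt)
  have cont: "continuous_on (vec_cball p) g"
    unfolding g_def residual_norm_def overlap_def mat_vec_def L2_set_def divide_inverse
    using pos unfolding overlap_def L2_set_def divide_inverse
    by (intro continuous_intros continuous_on_apply_fun ballI) (force)+
  have "(\<lambda>i\<in>{..<p}. 0) \<in> vec_cball p"
    by (simp add: vec_cball_def L2_set_def)
  then obtain a where a: "a \<in> vec_cball p" "\<And>b. b \<in> vec_cball p \<Longrightarrow> g b \<le> g a"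
    using continuous_attains_sup [OF compact_vec_cball _ cont] by blast
  have "f_TAP \<alpha> \<Delta> N p A v b \<le> f_TAP \<alpha> \<Delta> N p A v a" if "b \<in> vec_cball p" for b
    using a that by (simp add: f_eq nonneg ext_ln_mono)
  then have "max_f_TAP \<alpha> \<Delta> N p A v = f_TAP \<alpha> \<Delta> N p A v a"
    unfolding max_f_TAP_def using a(1) by (intro antisym SUP_least SUP_upper) auto
  then show ?thesis using a(1) by metis
qed

section \<open>Convergence in probability\<close>

text \<open>
  Convergence in probability to a constant, for (extended-)real random variables that may live
  on a different probability space for each index. Measurability is part of the definition
  because \<^const>\<open>measure\<close> vanishes on non-measurable sets.
\<close>

definition converges_in_prob ::
    "(nat \<Rightarrow> 'a measure) \<Rightarrow> (nat \<Rightarrow> 'a \<Rightarrow> ereal) \<Rightarrow> real \<Rightarrow> bool" where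
  "converges_in_prob M X c \<longleftrightarrow>
     (\<forall>n. X n \<in> borel_measurable (M n)) \<and>
     (\<forall>e>0. (\<lambda>n. measure (M n) {\<omega> \<in> space (M n). \<bar>X n \<omega> - ereal c\<bar> \<ge> ereal e}) \<longlonglongrightarrow> 0)"

end

theory Submission
  imports Defs
begin

text \<open>
  Let \<open>G = (I + x x\<^sup>T / \<Delta>)\<^sup>-\<^sup>1\<close>, obtained by adding the columns \<open>x\<^sub>k\<close> of the design one at a time
  (Sherman--Morrison), and let \<open>v\<^sub>k = x\<^sub>k\<^sup>T G x\<^sub>k\<close> with \<open>G\<close> built from the columns before \<open>x\<^sub>k\<close>.
  For a standard Gaussian prior the partition function is
  \<open>Z\<^sub>g = (\<Prod>k. (1 + v\<^sub>k / \<Delta>)\<^sup>-\<^sup>1\<^sup>/\<^sup>2) exp (- y\<^sup>T G y / (2 \<Delta>))\<close>.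

  Leaving out one column, \<open>N - tr G = \<Sum>k. u\<^sub>k / (\<Delta> + u\<^sub>k)\<close> where each \<open>u\<^sub>k\<close> is a quadratic form in a column
  independent of its matrix, so that \<open>u\<^sub>k\<close> is close to \<open>tr G / N\<close>; hence \<open>tr G / N\<close> is close to the root \<open>g\<close> of
  \<open>1 - g = (p / N) g / (\<Delta> + g)\<close>, and \<open>\<Sum>k. ln (1 + v\<^sub>k / \<Delta>)\<close> becomes a Riemann sum. Since
  \<open>y\<^sup>T G y\<close> and \<open>y\<^sup>T G\<^sup>2 y\<close> concentrate at \<open>\<Delta> N\<close> and \<open>\<Delta> tr G\<close>, this gives the limit of \<open>ln Z\<^sub>g / p\<close>.

  The spherical partition function \<open>Z\<close> satisfies \<open>E (Z\<^sub>g / Z) = 1\<close> because both are densities of the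
  observation, so \<open>Z \<ge> exp (- o(p)) Z\<^sub>g\<close>; the reverse inequality is Jensen's, applied to the radius of a
  Gaussian vector, which is independent of its direction.

  For every \<open>a\<close>, \<open>|y - x a|\<^sup>2 + \<Delta> |a|\<^sup>2 \<ge> y\<^sup>T G y\<close>, which bounds the TAP functional by a function of the overlap
  alone; its maximum is the limit of \<open>ln Z\<^sub>g / p\<close>, and it is attained asymptotically at the ridge estimator
  \<open>a = x\<^sup>T G y / \<Delta>\<close>.
\<close>

section \<open>Resolvents by rank-one updates\<close>

text \<open>The limit can be computed because the model is well specified. Given x, the vector y has
  second moment matrix x x^T + \<Delta> I = \<Delta> G^-1, since the spherical prior has identity
  covariance; this is where the values \<Delta> N and \<Delta> tr G for y^T G y and y^T G^2 y come
  from. The obstacle is the spherical prior: its coordinates are dependent and its partition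
  function has no closed form, while a Gaussian prior lets the coordinates be integrated out one at
  a time. The two priors differ only in the radius, whose normalised square has variance 2 / p, so
  that the change of prior costs a factor exp(o(p)). No spectral theory enters. What is known about
  G follows from the linear system that it solves, which yields G^2 \<le> G \<le> I as quadratic
  forms, and randomness is controlled by second moments of quadratic forms alone. The TAP bound is
  sharp because the stationarity condition in E = 1 - q, namely \<alpha> E / (\<Delta> \<alpha> + E)
  = 1 - E, becomes the equation for g under E = \<Delta> / (\<Delta> + g), and this E is also the
  limit of 1 - q at the ridge estimator.\<close>

definition dot :: "nat \<Rightarrow> (nat \<Rightarrow> real) \<Rightarrow> (nat \<Rightarrow> real) \<Rightarrow> real" where
  "dot n u v = (\<Sum>i<n. u i * v i)"

definition mv :: "nat \<Rightarrow> (nat \<Rightarrow> nat \<Rightarrow> real) \<Rightarrow> (nat \<Rightarrow> real) \<Rightarrow> nat \<Rightarrow> real" where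
  "mv n B u i = (\<Sum>j<n. B i j * u j)"

definition mat_trace :: "nat \<Rightarrow> (nat \<Rightarrow> nat \<Rightarrow> real) \<Rightarrow> real" where
  "mat_trace n B = (\<Sum>i<n. B i i)"

definition col :: "(nat \<times> nat \<Rightarrow> real) \<Rightarrow> nat \<Rightarrow> nat \<Rightarrow> real" where
  "col A k i = A (i, k)"

text \<open>Indexing by a list of columns, rather than by a count, allows a column to be left out or
  moved to the front; \<open>resolvent_perm\<close> later removes the dependence on the
  order.\<close>

primrec resolvent ::
    "nat \<Rightarrow> real \<Rightarrow> (nat \<times> nat \<Rightarrow> real) \<Rightarrow> nat list \<Rightarrow> nat \<Rightarrow> nat \<Rightarrow> real" where
  "resolvent n \<Delta> A [] = (\<lambda>i j. if i = j then 1 else 0)"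
| "resolvent n \<Delta> A (k # ks) = (\<lambda>i j. resolvent n \<Delta> A ks i j
     - mv n (resolvent n \<Delta> A ks) (col A k) i * mv n (resolvent n \<Delta> A ks) (col A k) j
       / (\<Delta> + dot n (col A k) (mv n (resolvent n \<Delta> A ks) (col A k))))"

section \<open>Bilinear algebra and the linear system solved by the resolvent\<close>

lemma dot_commute: "dot n u v = dot n v u"
  by (simp add: dot_def mult.commute)

lemma dot_self_nonneg: "0 \<le> dot n u u"
  by (simp add: dot_def sum_nonneg)

lemma dot_cong: "(\<And>i. i < n \<Longrightarrow> u i = u' i) \<Longrightarrow> (\<And>i. i < n \<Longrightarrow> v i = v' i) \<Longrightarrow> dot n u v = dot n u' v'"
  by (simp add: dot_def)

lemma dot_add_right: "dot n u (\<lambda>i. v i + w i) = dot n u v + dot n u w"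
  by (simp add: dot_def algebra_simps sum.distrib)

lemma dot_diff_right: "dot n u (\<lambda>i. v i - w i) = dot n u v - dot n u w"
  by (simp add: dot_def algebra_simps sum_subtractf)

lemma dot_scale_right: "dot n u (\<lambda>i. c * v i) = c * dot n u v"
  by (simp add: dot_def sum_distrib_left algebra_simps)

lemma dot_add_left: "dot n (\<lambda>i. v i + w i) u = dot n v u + dot n w u"
  by (simp add: dot_def algebra_simps sum.distrib)

lemma dot_diff_left: "dot n (\<lambda>i. v i - w i) u = dot n v u - dot n w u"
  by (simp add: dot_def algebra_simps sum_subtractf)

lemma dot_scale_left: "dot n (\<lambda>i. c * v i) u = c * dot n v u"
  by (simp add: dot_def sum_distrib_left algebra_simps)

lemma dot_sum_left: "dot n (\<lambda>i. \<Sum>k\<in>S. f k i) u = (\<Sum>k\<in>S. dot n (f k) u)"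
  unfolding dot_def sum_distrib_right by (rule sum.swap)

lemma dot_sum_right: "dot n u (\<lambda>i. \<Sum>k\<in>S. f k i) = (\<Sum>k\<in>S. dot n u (f k))"
  by (subst (1 2) dot_commute) (rule dot_sum_left)

lemmas dot_linear = dot_add_right dot_diff_right dot_scale_right
  dot_add_left dot_diff_left dot_scale_left

lemma dot_diff_self:
  "dot n (\<lambda>i. u i - v i) (\<lambda>i. u i - v i) = dot n u u - 2 * dot n u v + dot n v v"
  using dot_commute[of n v u] by (simp add: dot_diff_left dot_diff_right)

lemma dot_self_eq_0: "dot n u u = 0 \<Longrightarrow> i < n \<Longrightarrow> u i = 0"
  unfolding dot_def by (subst (asm) sum_nonneg_eq_0_iff) auto

lemma mv_cong: "(\<And>j. j < n \<Longrightarrow> u j = u' j) \<Longrightarrow> (\<And>j. j < n \<Longrightarrow> B i j = B' i j) \<Longrightarrow> mv n B u i = mv n B' u' i"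
  by (simp add: mv_def)

lemma resolvent_sym: "resolvent n \<Delta> A ks i j = resolvent n \<Delta> A ks j i"
  by (induction ks arbitrary: i j) (auto simp: mult.commute)

lemma dot_mv_sym:
  assumes "\<And>i j. B i j = B j i"
  shows "dot n u (mv n B v) = dot n (mv n B u) v"
proof -
  have "dot n u (mv n B v) = (\<Sum>i<n. \<Sum>j<n. u i * (B i j * v j))"
    by (simp add: dot_def mv_def sum_distrib_left)
  also have "\<dots> = (\<Sum>j<n. \<Sum>i<n. u i * (B i j * v j))"
    by (rule sum.swap)
  also have "\<dots> = dot n (mv n B u) v"
    unfolding dot_def mv_def sum_distrib_right
    by (intro sum.cong refl) (use assms in \<open>simp only: mult_ac\<close>)
  finally show ?thesis .
qed

lemma dot_resolvent_sym:
  "dot n u (mv n (resolvent n \<Delta> A ks) v) = dot n (mv n (resolvent n \<Delta> A ks) u) v"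
  by (rule dot_mv_sym) (rule resolvent_sym)

lemma mv_resolvent_Cons:
  "mv n (resolvent n \<Delta> A (k # ks)) u i = mv n (resolvent n \<Delta> A ks) u i
     - dot n (col A k) (mv n (resolvent n \<Delta> A ks) u)
       / (\<Delta> + dot n (col A k) (mv n (resolvent n \<Delta> A ks) (col A k)))
       * mv n (resolvent n \<Delta> A ks) (col A k) i"
proof -
  let ?G = "resolvent n \<Delta> A ks"
  let ?c = "\<Delta> + dot n (col A k) (mv n ?G (col A k))"
  have "mv n (resolvent n \<Delta> A (k # ks)) u i
      = mv n ?G u i - mv n ?G (col A k) i / ?c * dot n (mv n ?G (col A k)) u"
    by (subst mv_def)
      (simp add: left_diff_distrib sum_subtractf mv_def[of n ?G u] dot_def[of n _ u]
        sum_distrib_left mult.assoc)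
  then show ?thesis
    by (simp add: dot_resolvent_sym)
qed

text \<open>The operator inverted by the resolvent is \<open>w \<mapsto> w + \<Sum>k. x\<^sub>k \<langle>x\<^sub>k, w\<rangle> / \<Delta>\<close>.\<close>

lemma dot_inverse_ge:
  assumes "\<Delta> > 0" "\<And>i. i < n \<Longrightarrow> w i + (\<Sum>k\<in>S. col A k i * dot n (col A k) w) / \<Delta> = u i"
  shows "dot n u w = dot n w w + (\<Sum>k\<in>S. (dot n (col A k) w)\<^sup>2) / \<Delta>"
proof -
  have "dot n u w = dot n (\<lambda>i. w i + (1 / \<Delta>) * (\<Sum>k\<in>S. dot n (col A k) w * col A k i)) w"
    using assms(2) by (intro dot_cong) (auto simp: mult.commute)
  then show ?thesis
    by (simp only: dot_linear dot_sum_left) (simp add: power2_eq_square)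
qed

text \<open>Sherman-Morrison by induction: the hypothesis is used twice, for \<open>u\<close> and
  for the new column, and the two instances are combined with the weight \<open>?c\<close>.\<close>

lemma resolvent_inverse:
  assumes "\<Delta> > 0" "distinct ks" "i < n"
  shows "mv n (resolvent n \<Delta> A ks) u i
      + (\<Sum>k\<in>set ks. col A k i * dot n (col A k) (mv n (resolvent n \<Delta> A ks) u)) / \<Delta> = u i"
  using assms(2,3)
proof (induction ks arbitrary: u i)
  case Nil
  have "mv n (resolvent n \<Delta> A []) u i = (\<Sum>j<n. if i = j then u j else 0)"
    unfolding mv_def by (intro sum.cong) auto
  then show ?case using Nil by simp
next
  case (Cons k ks)
  let ?G = "resolvent n \<Delta> A ks" and ?x = "col A k"
  let ?v = "dot n ?x (mv n ?G ?x)" and ?b = "dot n ?x (mv n ?G u)"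
  let ?c = "?b / (\<Delta> + ?v)"
  have IH: "mv n ?G u i + (\<Sum>k\<in>set ks. col A k i * dot n (col A k) (mv n ?G u)) / \<Delta> = u i"
    if "i < n" for u i using Cons that by auto
  have "?v = dot n (mv n ?G ?x) (mv n ?G ?x) + (\<Sum>k\<in>set ks. (dot n (col A k) (mv n ?G ?x))\<^sup>2) / \<Delta>"
    by (rule dot_inverse_ge) (use assms IH in auto)
  \<comment> \<open>Nonnegativity keeps the denominator \<open>\<Delta> + ?v\<close> away from
    0.\<close>
  then have v: "0 \<le> ?v"
    using assms(1) by (simp add: dot_self_nonneg sum_nonneg)
  have eq: "mv n (resolvent n \<Delta> A (k # ks)) u = (\<lambda>i. mv n ?G u i - ?c * mv n ?G ?x i)"
    by (rule ext) (rule mv_resolvent_Cons)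
  have lin: "dot n z (\<lambda>i. mv n ?G u i - ?c * mv n ?G ?x i) = dot n z (mv n ?G u) - ?c * dot n z (mv n ?G ?x)"
    for z by (simp only: dot_linear)
  have "(\<Sum>l\<in>set ks. col A l i * dot n (col A l) (\<lambda>i. mv n ?G u i - ?c * mv n ?G ?x i)) / \<Delta>
      = (\<Sum>l\<in>set ks. col A l i * dot n (col A l) (mv n ?G u)) / \<Delta>
        - ?c * ((\<Sum>l\<in>set ks. col A l i * dot n (col A l) (mv n ?G ?x)) / \<Delta>)"
    unfolding lin
    by (simp add: right_diff_distrib sum_subtractf diff_divide_distrib
        sum_distrib_left sum_divide_distrib mult.left_commute)
  also have "\<dots> = (u i - mv n ?G u i) - ?c * (?x i - mv n ?G ?x i)"
    using IH[OF Cons(3), of u, THEN eq_diff_eq[THEN iffD2, OF add.commute[THEN trans]]]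
      IH[OF Cons(3), of ?x, THEN eq_diff_eq[THEN iffD2, OF add.commute[THEN trans]]]
    by (simp only:)
  finally have 1: "(\<Sum>l\<in>set ks. col A l i * dot n (col A l) (\<lambda>i. mv n ?G u i - ?c * mv n ?G ?x i)) / \<Delta>
     = (u i - mv n ?G u i) - ?c * (?x i - mv n ?G ?x i)" .
  \<comment> \<open>The reason for the choice of \<open>?c\<close>: the new column contributes
    \<open>?x i * ?c\<close> to the system, which cancels the defect \<open>- ?c * ?x i\<close> left
    in fact \<open>1\<close>.\<close>
  have 2: "dot n ?x (\<lambda>i. mv n ?G u i - ?c * mv n ?G ?x i) = \<Delta> * ?c"
    using v assms(1) unfolding lin by (simp add: field_simps)
  have ks: "k \<notin> set ks" using Cons by simp
  have "(\<Sum>l\<in>set (k # ks). col A l i * dot n (col A l) (\<lambda>i. mv n ?G u i - ?c * mv n ?G ?x i)) / \<Delta>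
      = ?x i * (\<Delta> * ?c) / \<Delta> + ((u i - mv n ?G u i) - ?c * (?x i - mv n ?G ?x i))"
    unfolding 1[symmetric] 2[symmetric] using ks by (simp add: add_divide_distrib)
  also have "\<dots> = ?x i * ?c + ((u i - mv n ?G u i) - ?c * (?x i - mv n ?G ?x i))"
    using assms(1) by simp
  finally show ?case
    unfolding eq by (simp only:) (simp only: algebra_simps)
qed

text \<open>Positive definiteness replaces invertibility: the difference of two solutions solves the
  system with right-hand side 0, and pairing it with itself shows that a sum of squares is
  0.\<close>

lemma inverse_unique:
  assumes "\<Delta> > 0" "i < n"
    and "\<And>i. i < n \<Longrightarrow> w i + (\<Sum>k\<in>S. col A k i * dot n (col A k) w) / \<Delta> = u i"
    and "\<And>i. i < n \<Longrightarrow> w' i + (\<Sum>k\<in>S. col A k i * dot n (col A k) w') / \<Delta> = u i"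
  shows "w i = w' i"
proof -
  let ?d = "\<lambda>i. w i - w' i"
  have "?d i + (\<Sum>k\<in>S. col A k i * dot n (col A k) ?d) / \<Delta> = 0" if "i < n" for i
    using assms(3)[OF that] assms(4)[OF that]
    by (simp add: dot_linear right_diff_distrib sum_subtractf diff_divide_distrib)
  then have "dot n (\<lambda>_. 0) ?d = dot n ?d ?d + (\<Sum>k\<in>S. (dot n (col A k) ?d)\<^sup>2) / \<Delta>"
    by (intro dot_inverse_ge assms) auto
  moreover have "dot n (\<lambda>_. 0) ?d = 0" by (simp add: dot_def)
  moreover have "0 \<le> (\<Sum>k\<in>S. (dot n (col A k) ?d)\<^sup>2) / \<Delta>"
    using assms(1) by (simp add: sum_nonneg)
  ultimately have "dot n ?d ?d = 0"
    using dot_self_nonneg[of n ?d] by linarith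
  then have "?d i = 0" using assms(2) by (rule dot_self_eq_0)
  then show ?thesis by simp
qed

text \<open>Here \<open>T\<close> is the full trace and \<open>W k\<close> the trace with column k
  left out. The function t / (\<Delta> + t) is 1 / \<Delta>-Lipschitz on nonnegative t, so replacing
  every \<open>v k\<close> by \<open>T / n\<close> costs the fluctuation of \<open>v k\<close>
  around \<open>W k / n\<close>, plus 1 / n for the change of trace.\<close>

lemma fixed_point_bound:
  fixes \<Delta> T :: real and n :: nat
  assumes \<Delta>: "\<Delta> > 0" and n: "n > 0" and S: "finite S" and T: "0 \<le> T"
    and eq: "real n - T = (\<Sum>k\<in>S. v k / (\<Delta> + v k))"
    and W: "\<And>k. k \<in> S \<Longrightarrow> \<bar>W k - T\<bar> \<le> 1" and v: "\<And>k. k \<in> S \<Longrightarrow> 0 \<le> v k"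
  shows "\<bar>1 - T / real n - real (card S) / real n * (T / real n / (\<Delta> + T / real n))\<bar>
     \<le> 1 / (real n * \<Delta>) * (\<Sum>k\<in>S. \<bar>v k - W k / real n\<bar> + 1 / real n)"
proof -
  define t where "t = T / real n"
  have t: "0 \<le> t" unfolding t_def using T by simp
  have lip: "\<bar>a / (\<Delta> + a) - b / (\<Delta> + b)\<bar> \<le> \<bar>a - b\<bar> / \<Delta>" if "0 \<le> a" "0 \<le> b" for a b :: real
  proof -
    have "a / (\<Delta> + a) - b / (\<Delta> + b) = \<Delta> * (a - b) / ((\<Delta> + a) * (\<Delta> + b))"
      using that \<Delta> by (simp add: divide_simps) (simp add: algebra_simps)
    then have "\<bar>a / (\<Delta> + a) - b / (\<Delta> + b)\<bar> = \<Delta> * \<bar>a - b\<bar> / ((\<Delta> + a) * (\<Delta> + b))"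
      using that \<Delta> by (simp add: abs_mult)
    also have "\<dots> \<le> \<Delta> * \<bar>a - b\<bar> / (\<Delta> * \<Delta>)"
      using that \<Delta> by (intro divide_left_mono mult_mono mult_pos_pos) auto
    finally show ?thesis using \<Delta> by simp
  qed
  have vt: "\<bar>v k - t\<bar> \<le> \<bar>v k - W k / real n\<bar> + 1 / real n" if "k \<in> S" for k
  proof -
    have "\<bar>W k - T\<bar> / real n \<le> 1 / real n"
      by (rule divide_right_mono[OF W[OF that]]) simp
    then have "\<bar>W k / real n - t\<bar> \<le> 1 / real n"
      unfolding t_def by (simp only: diff_divide_distrib[symmetric] abs_divide abs_of_nat)
    then show ?thesis by linarith
  qed
  have "1 - t = (\<Sum>k\<in>S. v k / (\<Delta> + v k)) / real n"
    unfolding eq[symmetric] t_def using n by (simp add: diff_divide_distrib)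
  then have "1 - t - real (card S) / real n * (t / (\<Delta> + t))
      = (\<Sum>k\<in>S. v k / (\<Delta> + v k) - t / (\<Delta> + t)) / real n"
    by (simp add: sum_subtractf diff_divide_distrib)
  also have "\<bar>\<dots>\<bar> \<le> (\<Sum>k\<in>S. \<bar>v k / (\<Delta> + v k) - t / (\<Delta> + t)\<bar>) / real n"
    unfolding abs_divide abs_of_nat by (intro divide_right_mono sum_abs) simp
  also have "\<dots> \<le> (\<Sum>k\<in>S. (\<bar>v k - W k / real n\<bar> + 1 / real n) / \<Delta>) / real n"
  proof (intro divide_right_mono sum_mono)
    fix k assume k: "k \<in> S"
    have "\<bar>v k - t\<bar> / \<Delta> \<le> (\<bar>v k - W k / real n\<bar> + 1 / real n) / \<Delta>"
      using vt[OF k] \<Delta> by (intro divide_right_mono) auto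
    with lip[OF v[OF k] t]
    show "\<bar>v k / (\<Delta> + v k) - t / (\<Delta> + t)\<bar> \<le> (\<bar>v k - W k / real n\<bar> + 1 / real n) / \<Delta>"
      by linarith
  qed simp
  also have "\<dots> = 1 / (real n * \<Delta>) * (\<Sum>k\<in>S. \<bar>v k - W k / real n\<bar> + 1 / real n)"
    unfolding sum_divide_distrib[where r=\<Delta>, symmetric] by simp
  finally show ?thesis
    unfolding t_def .
qed

section \<open>Resolvent of one fixed matrix: form bounds, traces, leaving out a column\<close>

context
  fixes n :: nat and \<Delta> :: real and A :: "nat \<times> nat \<Rightarrow> real"
  assumes \<Delta>: "\<Delta> > 0"
begin

private abbreviation "G \<equiv> resolvent n \<Delta> A"

text \<open>Both sides solve the same linear system, in which the columns enter only as a set. It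
  serves to bring any chosen column to the head of the list.\<close>

lemma resolvent_perm:
  assumes "distinct ks" "distinct ls" "set ks = set ls" "i < n"
  shows "mv n (G ks) u i = mv n (G ls) u i"
proof (rule inverse_unique[where S="set ks" and A=A, OF \<Delta> assms(4)])
  fix i assume i: "i < n"
  show "mv n (G ks) u i + (\<Sum>k\<in>set ks. col A k i * dot n (col A k) (mv n (G ks) u)) / \<Delta> = u i"
    by (rule resolvent_inverse[OF \<Delta> assms(1) i])
  show "mv n (G ls) u i + (\<Sum>k\<in>set ks. col A k i * dot n (col A k) (mv n (G ls) u)) / \<Delta> = u i"
    unfolding assms(3) by (rule resolvent_inverse[OF \<Delta> assms(2) i])
qed

lemma mv_unit: "j < n \<Longrightarrow> mv n B (\<lambda>i. if i = j then 1 else 0) i = B i j"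
  unfolding mv_def by (simp add: if_distrib cong: if_cong)

lemma resolvent_perm_entry:
  assumes "distinct ks" "distinct ls" "set ks = set ls" "i < n" "j < n"
  shows "G ks i j = G ls i j"
  using resolvent_perm[OF assms(1-4), of "\<lambda>i. if i = j then 1 else 0"] assms(5)
  by (simp add: mv_unit)

lemma dot_resolvent:
  assumes "distinct ks"
  shows "dot n u (mv n (G ks) u) = dot n (mv n (G ks) u) (mv n (G ks) u)
     + (\<Sum>k\<in>set ks. (dot n (col A k) (mv n (G ks) u))\<^sup>2) / \<Delta>"
  by (rule dot_inverse_ge) (use \<Delta> resolvent_inverse assms in auto)

text \<open>As quadratic forms this is G^2 \<le> G; the two sides differ by the sum of squares in
  \<open>dot_resolvent\<close>. With G \<le> I from \<open>dot_resolvent_le\<close> it is the source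
  of most later bounds.\<close>

lemma sq_le_dot_resolvent:
  assumes "distinct ks"
  shows "dot n (mv n (G ks) u) (mv n (G ks) u) \<le> dot n u (mv n (G ks) u)"
  using dot_resolvent[OF assms] \<Delta> by (simp add: sum_nonneg)

lemma dot_resolvent_nonneg:
  assumes "distinct ks"
  shows "0 \<le> dot n u (mv n (G ks) u)"
  using sq_le_dot_resolvent[OF assms] dot_self_nonneg order_trans by blast

lemma sum_dot_sq_le:
  assumes "distinct ks"
  shows "(\<Sum>k\<in>set ks. (dot n (col A k) (mv n (G ks) u))\<^sup>2) \<le> \<Delta> * dot n u (mv n (G ks) u)"
  using dot_resolvent[OF assms, of u] \<Delta> dot_self_nonneg[of n "mv n (G ks) u"]
  by (simp add: field_simps)

lemma dot_resolvent_le: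
  assumes "distinct ks"
  shows "dot n u (mv n (G ks) u) \<le> dot n u u"
proof -
  let ?w = "mv n (G ks) u"
  have "0 \<le> dot n (\<lambda>i. u i - ?w i) (\<lambda>i. u i - ?w i)"
    by (rule dot_self_nonneg)
  also have "\<dots> = dot n u u - 2 * dot n u ?w + dot n ?w ?w"
    by (rule dot_diff_self)
  finally show ?thesis
    using sq_le_dot_resolvent[OF assms, of u] by linarith
qed

text \<open>The trace of (I + x x^T / \<Delta>) G = I, obtained by solving the system for each unit
  vector and reading off the diagonal.\<close>

lemma trace_resolvent:
  assumes "distinct ks"
  shows "real n - mat_trace n (G ks) = (\<Sum>k\<in>set ks. dot n (col A k) (mv n (G ks) (col A k))) / \<Delta>"
proof -
  let ?e = "\<lambda>j i. if i = j then 1 else (0::real)"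
  have "G ks i i + (\<Sum>k\<in>set ks. col A k i * mv n (G ks) (col A k) i) / \<Delta> = 1" if "i < n" for i
  proof -
    have "dot n (col A k) (mv n (G ks) (?e i)) = mv n (G ks) (col A k) i" for k
      unfolding dot_resolvent_sym
      using that by (simp add: dot_def if_distrib[of "\<lambda>x. _ * x"] cong: if_cong)
    then show ?thesis
      using resolvent_inverse[OF \<Delta> assms that, of A "?e i"] that by (simp add: mv_unit)
  qed
  then have "(\<Sum>i<n. G ks i i + (\<Sum>k\<in>set ks. col A k i * mv n (G ks) (col A k) i) / \<Delta>) = (\<Sum>i<n. 1)"
    by (intro sum.cong) auto
  then have "real n - mat_trace n (G ks) = (\<Sum>i<n. \<Sum>k\<in>set ks. col A k i * mv n (G ks) (col A k) i) / \<Delta>"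
    by (simp add: sum.distrib mat_trace_def sum_divide_distrib eq_diff_eq[symmetric])
  moreover have "(\<Sum>i<n. \<Sum>k\<in>set ks. col A k i * mv n (G ks) (col A k) i) =
      (\<Sum>k\<in>set ks. dot n (col A k) (mv n (G ks) (col A k)))"
    by (subst sum.swap) (simp add: dot_def)
  ultimately show ?thesis by (simp only:)
qed

lemma trace_nonneg:
  assumes "distinct ks"
  shows "0 \<le> mat_trace n (G ks)"
  unfolding mat_trace_def
proof (intro sum_nonneg)
  fix i assume i: "i \<in> {..<n}"
  let ?e = "\<lambda>j. if j = i then 1 else (0::real)"
  have "dot n ?e (mv n (G ks) ?e) = mv n (G ks) ?e i"
    using i by (simp add: dot_def if_distrib[of "\<lambda>x. x * _"] cong: if_cong)
  then show "0 \<le> G ks i i"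
    using dot_resolvent_nonneg[OF assms, of ?e] i by (simp add: mv_unit)
qed

lemma sum_dot_col_resolvent_le:
  assumes "distinct ks"
  shows "(\<Sum>k\<in>set ks. dot n (col A k) (mv n (G ks) (col A k))) \<le> \<Delta> * real n"
  using trace_resolvent[OF assms] \<Delta> trace_nonneg[OF assms] by (simp add: field_simps)

lemma trace_le: "distinct ks \<Longrightarrow> mat_trace n (G ks) \<le> real n"
  using trace_resolvent[of ks] dot_resolvent_nonneg[of ks] \<Delta>
  by (smt (verit) divide_nonneg_pos sum_nonneg)

text \<open>Each row sum is the squared norm of G applied to a unit vector, so G^2 \<le> G bounds it
  by a diagonal entry. With \<open>trace_le\<close> the squared Frobenius norm is of order n, not
  n^2, and this makes quadratic forms in G concentrate.\<close>

lemma frobenius_resolvent_le: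
  assumes "distinct ks"
  shows "(\<Sum>i<n. \<Sum>j<n. (G ks i j)\<^sup>2) \<le> mat_trace n (G ks)"
  unfolding mat_trace_def
proof (intro sum_mono)
  fix i assume i: "i \<in> {..<n}"
  let ?e = "\<lambda>j. if j = i then 1 else (0::real)"
  have "dot n ?e (mv n (G ks) ?e) = mv n (G ks) ?e i"
    using i by (simp add: dot_def if_distrib[of "\<lambda>x. x * _"] cong: if_cong)
  moreover have "dot n (mv n (G ks) ?e) (mv n (G ks) ?e) = (\<Sum>j<n. (G ks i j)\<^sup>2)"
    using i unfolding dot_def by (simp add: mv_unit power2_eq_square resolvent_sym)
  ultimately show "(\<Sum>j<n. (G ks i j)\<^sup>2) \<le> G ks i i"
    using sq_le_dot_resolvent[OF assms, of ?e] i by (simp add: mv_unit)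
qed

text \<open>Expresses the form in a column that G contains by the form with that column left out.
  Only in the latter are vector and matrix independent when the design is random.\<close>

lemma dot_col_resolvent_Cons:
  assumes "distinct (k # ks)"
  defines "v \<equiv> dot n (col A k) (mv n (G ks) (col A k))"
  shows "dot n (col A k) (mv n (G (k # ks)) (col A k)) = \<Delta> * (v / (\<Delta> + v))"
proof -
  have v: "0 \<le> v" unfolding v_def by (rule dot_resolvent_nonneg) (use assms in auto)
  have "mv n (G (k # ks)) (col A k) =
      (\<lambda>i. mv n (G ks) (col A k) i - v / (\<Delta> + v) * mv n (G ks) (col A k) i)"
    unfolding v_def by (rule ext) (rule mv_resolvent_Cons)
  then have "dot n (col A k) (mv n (G (k # ks)) (col A k)) = v - v / (\<Delta> + v) * v"
    by (simp only: dot_linear v_def)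
  then show ?thesis using v \<Delta> by (simp add: field_simps)
qed

text \<open>Adding the column x lowers the trace by |G x|^2 / (\<Delta> + v), and |G x|^2 \<le> v
  because G^2 \<le> G. The change is therefore at most 1, whatever the size of the column.\<close>

lemma trace_resolvent_Cons:
  assumes "distinct (k # ks)"
  shows "mat_trace n (G (k # ks)) \<le> mat_trace n (G ks)"
    and "mat_trace n (G ks) \<le> mat_trace n (G (k # ks)) + 1"
proof -
  define v where "v = dot n (col A k) (mv n (G ks) (col A k))"
  let ?w = "mv n (G ks) (col A k)"
  have v: "0 \<le> v" unfolding v_def by (rule dot_resolvent_nonneg) (use assms in auto)
  have w: "dot n ?w ?w \<le> v" unfolding v_def by (rule sq_le_dot_resolvent) (use assms in auto)
  have "mat_trace n (G (k # ks)) = mat_trace n (G ks) - dot n ?w ?w / (\<Delta> + v)"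
    unfolding mat_trace_def resolvent.simps sum_subtractf v_def[symmetric]
    by (simp only: dot_def sum_divide_distrib)
  moreover have "0 \<le> dot n ?w ?w / (\<Delta> + v)"
    using v \<Delta> by (intro divide_nonneg_pos dot_self_nonneg) linarith
  moreover have "dot n ?w ?w / (\<Delta> + v) \<le> 1"
    using v w \<Delta> by (subst divide_le_eq_1_pos) linarith+
  ultimately show "mat_trace n (G (k # ks)) \<le> mat_trace n (G ks)"
    "mat_trace n (G ks) \<le> mat_trace n (G (k # ks)) + 1" by linarith+
qed

text \<open>Entirely deterministic: the normalised trace nearly solves the fixed point equation as
  soon as each column's form is close to the normalised trace of the resolvent without that column.
  Probability is needed only to bound the right-hand side.\<close>

lemma trace_fixed_point:
  assumes n: "n > 0" and ks: "distinct ks"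
  shows "\<bar>1 - mat_trace n (G ks) / real n - real (length ks) / real n *
       (mat_trace n (G ks) / real n / (\<Delta> + mat_trace n (G ks) / real n))\<bar> \<le>
     1 / (real n * \<Delta>) * (\<Sum>k\<in>set ks.
       \<bar>dot n (col A k) (mv n (G (filter (\<lambda>l. l \<noteq> k) ks)) (col A k))
         - mat_trace n (G (filter (\<lambda>l. l \<noteq> k) ks)) / real n\<bar> + 1 / real n)"
proof -
  let ?r = "\<lambda>k. filter (\<lambda>l. l \<noteq> k) ks"
  let ?v = "\<lambda>k. dot n (col A k) (mv n (G (?r k)) (col A k))"
  have d: "distinct (k # ?r k)" "set (k # ?r k) = set ks" if "k \<in> set ks" for k
    using ks that by auto
  have a: "real n - mat_trace n (G ks) = (\<Sum>k\<in>set ks. ?v k / (\<Delta> + ?v k))"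
  proof -
    have "dot n (col A k) (mv n (G ks) (col A k)) = \<Delta> * (?v k / (\<Delta> + ?v k))"
      if "k \<in> set ks" for k
    proof -
      have "dot n (col A k) (mv n (G ks) (col A k)) = dot n (col A k) (mv n (G (k # ?r k)) (col A k))"
        by (rule dot_cong[OF refl resolvent_perm[OF ks d(1)[OF that] d(2)[OF that, symmetric]]])
      also have "\<dots> = \<Delta> * (?v k / (\<Delta> + ?v k))"
        by (rule dot_col_resolvent_Cons[OF d(1)[OF that]])
      finally show ?thesis .
    qed
    then have "(\<Sum>k\<in>set ks. dot n (col A k) (mv n (G ks) (col A k))) = \<Delta> * (\<Sum>k\<in>set ks. ?v k / (\<Delta> + ?v k))"
      unfolding sum_distrib_left by (rule sum.cong[OF refl])
    then show ?thesis
      using trace_resolvent[OF ks] \<Delta> by (simp only: nonzero_mult_div_cancel_left less_irrefl)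
  qed
  have b: "\<bar>mat_trace n (G (?r k)) - mat_trace n (G ks)\<bar> \<le> 1" if "k \<in> set ks" for k
  proof -
    have "mat_trace n (G ks) = mat_trace n (G (k # ?r k))"
      unfolding mat_trace_def
      by (intro sum.cong refl resolvent_perm_entry[OF ks d(1)[OF that] d(2)[OF that, symmetric]])
        (simp_all only: lessThan_iff)
    then show ?thesis
      using trace_resolvent_Cons[OF d(1)[OF that]] by linarith
  qed
  have c: "0 \<le> ?v k" if "k \<in> set ks" for k
    by (rule dot_resolvent_nonneg) (rule d(1)[OF that, unfolded distinct.simps, THEN conjunct2])
  show ?thesis
    using fixed_point_bound[where S="set ks" and v="?v" and W="\<lambda>k. mat_trace n (G (?r k))",
        OF \<Delta> n finite_set trace_nonneg[OF ks] a b c]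
    by (simp only: distinct_card[OF ks])
qed

text \<open>Two completed squares: one for the residual minus G y, one for each
  \<open>\<Delta> * a k\<close> minus the product of column k with G y. Equality holds when all of
  them vanish, which is the ridge estimator.\<close>

lemma resolvent_variational:
  assumes "distinct ks"
  shows "dot n y (mv n (G ks) y) \<le>
     dot n (\<lambda>i. y i - (\<Sum>k\<in>set ks. A (i, k) * a k)) (\<lambda>i. y i - (\<Sum>k\<in>set ks. A (i, k) * a k))
      + \<Delta> * (\<Sum>k\<in>set ks. (a k)\<^sup>2)"
proof -
  let ?w = "mv n (G ks) y" and ?r = "\<lambda>i. y i - (\<Sum>k\<in>set ks. A (i, k) * a k)"
  have "0 \<le> dot n (\<lambda>i. ?r i - ?w i) (\<lambda>i. ?r i - ?w i)"
    by (rule dot_self_nonneg)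
  also have "\<dots> = dot n ?r ?r - 2 * dot n ?r ?w + dot n ?w ?w"
    by (rule dot_diff_self)
  finally have 1: "2 * dot n ?r ?w - dot n ?w ?w \<le> dot n ?r ?r" by simp
  have "dot n ?r ?w = dot n y ?w - dot n (\<lambda>i. \<Sum>k\<in>set ks. a k * col A k i) ?w"
    unfolding col_def by (simp only: dot_diff_left mult.commute)
  then have 2: "dot n ?r ?w = dot n y ?w - (\<Sum>k\<in>set ks. a k * dot n (col A k) ?w)"
    by (simp only: dot_sum_left dot_scale_left)
  have "2 * (a k * dot n (col A k) ?w) - (dot n (col A k) ?w)\<^sup>2 / \<Delta> \<le> \<Delta> * (a k)\<^sup>2" for k
  proof -
    have "0 \<le> (\<Delta> * a k - dot n (col A k) ?w)\<^sup>2 / \<Delta>" using \<Delta> by simp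
    also have "\<dots> = \<Delta> * (a k)\<^sup>2 - 2 * (a k * dot n (col A k) ?w) + (dot n (col A k) ?w)\<^sup>2 / \<Delta>"
      using \<Delta> by (simp add: field_simps power2_eq_square)
    finally show ?thesis by simp
  qed
  then have "(\<Sum>k\<in>set ks. 2 * (a k * dot n (col A k) ?w) - (dot n (col A k) ?w)\<^sup>2 / \<Delta>)
      \<le> (\<Sum>k\<in>set ks. \<Delta> * (a k)\<^sup>2)" by (intro sum_mono)
  then have 3: "2 * (\<Sum>k\<in>set ks. a k * dot n (col A k) ?w)
       - (\<Sum>k\<in>set ks. (dot n (col A k) ?w)\<^sup>2) / \<Delta> \<le> \<Delta> * (\<Sum>k\<in>set ks. (a k)\<^sup>2)"
    by (simp add: sum_subtractf sum_distrib_left sum_divide_distrib)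
  show ?thesis
    using 1 2 3 dot_resolvent[OF assms, of y] by linarith
qed

end

section \<open>Gaussian product measures\<close>

abbreviation gauss :: "real \<Rightarrow> 'i set \<Rightarrow> ('i \<Rightarrow> real) measure" where
  "gauss \<sigma> I \<equiv> \<Pi>\<^sub>M i\<in>I. density lborel (normal_density 0 \<sigma>)"

definition normal_moment :: "real \<Rightarrow> nat \<Rightarrow> real" where
  "normal_moment \<sigma> k = (\<integral>x. x ^ k \<partial>density lborel (normal_density 0 \<sigma>))"

lemma product_sigma_finite_gauss:
  "\<sigma> > 0 \<Longrightarrow> product_sigma_finite (\<lambda>_::'i. density lborel (normal_density 0 \<sigma>))"
  unfolding product_sigma_finite_def
  by (intro allI prob_space_imp_sigma_finite prob_space_normal_density)

lemma prob_space_gauss: "\<sigma> > 0 \<Longrightarrow> prob_space (gauss \<sigma> I)"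
  by (intro prob_space_PiM prob_space_normal_density)

lemma sets_gauss [measurable_cong]: "sets (gauss \<sigma> I) = sets (\<Pi>\<^sub>M i\<in>I. borel)"
  by (intro sets_PiM_cong) auto

lemma integrable_normal_power:
  assumes "\<sigma> > 0"
  shows "integrable (density lborel (normal_density 0 \<sigma>)) (\<lambda>x. x ^ k)"
  using integrable_normal_moment[OF assms, of 0 k]
  by (subst integrable_density) (auto simp: normal_density_nonneg)

lemma normal_moments:
  assumes "\<sigma> > 0"
  shows "normal_moment \<sigma> 0 = 1" "normal_moment \<sigma> (Suc 0) = 0" "normal_moment \<sigma> 2 = \<sigma>\<^sup>2"
    "normal_moment \<sigma> 3 = 0" "normal_moment \<sigma> 4 = 3 * \<sigma> ^ 4"
proof -
  have eq: "normal_moment \<sigma> k = (\<integral>x. normal_density 0 \<sigma> x * (x - 0) ^ k \<partial>lborel)" for k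
    unfolding normal_moment_def by (subst integral_density) (auto simp: normal_density_nonneg)
  show "normal_moment \<sigma> 0 = 1"
    using integral_normal_moment_even[OF assms, of 0 0] by (simp add: eq)
  show "normal_moment \<sigma> (Suc 0) = 0"
    using integral_normal_moment_odd[OF assms, of 0 0] by (simp add: eq)
  show "normal_moment \<sigma> 2 = \<sigma>\<^sup>2"
    using integral_normal_moment_even[OF assms, of 0 1] by (simp add: eq)
  show "normal_moment \<sigma> 3 = 0"
    using integral_normal_moment_odd[OF assms, of 0 1] by (simp add: eq numeral_3_eq_3)
  show "normal_moment \<sigma> 4 = 3 * \<sigma> ^ 4"
    using integral_normal_moment_even[OF assms, of 0 2] assms
    by (simp add: eq fact_numeral power_divide)
qed

section \<open>Moments of Gaussian quadratic forms\<close>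

context
  fixes \<sigma> :: real and I :: "'i set"
  assumes \<sigma>: "\<sigma> > 0" and fin: "finite I"
begin

interpretation product_sigma_finite "\<lambda>_::'i. density lborel (normal_density 0 \<sigma>)"
  by (rule product_sigma_finite_gauss[OF \<sigma>])

lemma gauss_monomial:
  "integrable (gauss \<sigma> I) (\<lambda>z. \<Prod>m\<in>I. z m ^ c m)"
  "(\<integral>z. (\<Prod>m\<in>I. z m ^ c m) \<partial>gauss \<sigma> I) = (\<Prod>m\<in>I. normal_moment \<sigma> (c m))"
  unfolding normal_moment_def
  by (rule product_integrable_prod product_integral_prod; intro fin integrable_normal_power \<sigma>)+

lemma prod_indicator_power:
  fixes z :: "'i \<Rightarrow> real"
  assumes "i \<in> I"
  shows "(\<Prod>m\<in>I. z m ^ of_bool (m = i)) = z i"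
proof -
  have "(\<Prod>m\<in>I. z m ^ of_bool (m = i)) = (\<Prod>m\<in>I. if m = i then z m else 1)"
    by (intro prod.cong) auto
  then show ?thesis using fin assms by simp
qed

lemma gauss_moment2:
  assumes "i \<in> I" "j \<in> I"
  shows "integrable (gauss \<sigma> I) (\<lambda>z. z i * z j)"
    and "(\<integral>z. z i * z j \<partial>gauss \<sigma> I) = \<sigma>\<^sup>2 * of_bool (i = j)"
proof -
  \<comment> \<open>Multiplicity of m among the two indices, so that the product becomes a monomial
    over all of \<open>I\<close> and its moment factorises.\<close>
  define c :: "'i \<Rightarrow> nat" where "c m = of_bool (m = i) + of_bool (m = j)" for m
  have eq: "z i * z j = (\<Prod>m\<in>I. z m ^ c m)" for z :: "'i \<Rightarrow> real"
    using assms by (simp add: c_def power_add prod.distrib prod_indicator_power)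
  show "integrable (gauss \<sigma> I) (\<lambda>z. z i * z j)"
    unfolding eq by (rule gauss_monomial)
  have "(\<Prod>m\<in>I. normal_moment \<sigma> (c m)) = (\<Prod>m\<in>{i,j}. normal_moment \<sigma> (c m))"
    using fin assms by (intro prod.mono_neutral_right) (auto simp: c_def normal_moments[OF \<sigma>])
  also have "\<dots> = \<sigma>\<^sup>2 * of_bool (i = j)"
    by (cases "i = j") (auto simp: c_def normal_moments[OF \<sigma>] numeral_2_eq_2[symmetric])
  finally show "(\<integral>z. z i * z j \<partial>gauss \<sigma> I) = \<sigma>\<^sup>2 * of_bool (i = j)"
    unfolding eq gauss_monomial .
qed

text \<open>Wick's formula with its three pairings. When all four indices coincide every pairing
  counts, which reproduces the fourth moment 3 \<sigma>^4.\<close>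

lemma gauss_moment4:
  assumes "i \<in> I" "j \<in> I" "k \<in> I" "l \<in> I"
  shows "integrable (gauss \<sigma> I) (\<lambda>z. z i * z j * z k * z l)"
    and "(\<integral>z. z i * z j * z k * z l \<partial>gauss \<sigma> I) =
      \<sigma> ^ 4 * (of_bool (i = j \<and> k = l) + of_bool (i = k \<and> j = l) + of_bool (i = l \<and> j = k))"
proof -
  define c :: "'i \<Rightarrow> nat" where "c m = of_bool (m = i) + of_bool (m = j) + of_bool (m = k) + of_bool (m = l)" for m
  have eq: "z i * z j * z k * z l = (\<Prod>m\<in>I. z m ^ c m)" for z :: "'i \<Rightarrow> real"
    using assms by (simp add: c_def power_add prod.distrib prod_indicator_power)
  show "integrable (gauss \<sigma> I) (\<lambda>z. z i * z j * z k * z l)"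
    unfolding eq by (rule gauss_monomial)
  have 3: "normal_moment \<sigma> (Suc (Suc (Suc 0))) = 0" "normal_moment \<sigma> (Suc (Suc 0)) = \<sigma>\<^sup>2"
    "normal_moment \<sigma> (Suc (Suc (Suc (Suc 0)))) = 3 * \<sigma> ^ 4"
    using normal_moments[OF \<sigma>] by (simp_all add: eval_nat_numeral)
  have "(\<Prod>m\<in>I. normal_moment \<sigma> (c m)) = (\<Prod>m\<in>{i,j,k,l}. normal_moment \<sigma> (c m))"
    using fin assms by (intro prod.mono_neutral_right) (auto simp: c_def normal_moments[OF \<sigma>])
  also have "\<dots> = \<sigma> ^ 4 * (of_bool (i = j \<and> k = l) + of_bool (i = k \<and> j = l) + of_bool (i = l \<and> j = k))"
    by (cases "i = j"; cases "i = k"; cases "i = l"; cases "j = k"; cases "j = l"; cases "k = l")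
      (auto simp: c_def normal_moments[OF \<sigma>] 3 power2_eq_square power4_eq_xxxx prod.insert_if)
  finally show "(\<integral>z. z i * z j * z k * z l \<partial>gauss \<sigma> I) =
      \<sigma> ^ 4 * (of_bool (i = j \<and> k = l) + of_bool (i = k \<and> j = l) + of_bool (i = l \<and> j = k))"
    unfolding eq gauss_monomial .
qed

lemma gauss_quad_form:
  fixes B :: "'i \<Rightarrow> 'i \<Rightarrow> real"
  defines "Q \<equiv> \<lambda>z. \<Sum>i\<in>I. \<Sum>j\<in>I. B i j * (z i * z j)"
  shows "integrable (gauss \<sigma> I) Q"
    and "(\<integral>z. Q z \<partial>gauss \<sigma> I) = \<sigma>\<^sup>2 * (\<Sum>i\<in>I. B i i)"
proof -
  show "integrable (gauss \<sigma> I) Q"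
    unfolding Q_def by (intro Bochner_Integration.integrable_sum integrable_mult_right gauss_moment2)
  have "(\<integral>z. Q z \<partial>gauss \<sigma> I) = (\<Sum>i\<in>I. \<Sum>j\<in>I. B i j * (\<sigma>\<^sup>2 * of_bool (i = j)))"
    unfolding Q_def
    by (subst Bochner_Integration.integral_sum,
        intro Bochner_Integration.integrable_sum integrable_mult_right gauss_moment2, assumption+,
        intro sum.cong refl, subst Bochner_Integration.integral_sum,
        intro integrable_mult_right gauss_moment2, assumption+,
        intro sum.cong refl, simp add: gauss_moment2)
  also have "\<dots> = \<sigma>\<^sup>2 * (\<Sum>i\<in>I. B i i)"
    using fin by (simp add: sum_distrib_left of_bool_def if_distrib mult.commute cong: if_cong)
  finally show "(\<integral>z. Q z \<partial>gauss \<sigma> I) = \<sigma>\<^sup>2 * (\<Sum>i\<in>I. B i i)" .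
qed

text \<open>Of the three pairings one gives the squared trace; the other two agree by symmetry of
  \<open>B\<close> and give the doubled Frobenius term.\<close>

lemma gauss_quad_form_sq:
  fixes B :: "'i \<Rightarrow> 'i \<Rightarrow> real"
  assumes sym: "\<And>i j. B i j = B j i"
  defines "Q \<equiv> \<lambda>z. \<Sum>i\<in>I. \<Sum>j\<in>I. B i j * (z i * z j)"
  shows "integrable (gauss \<sigma> I) (\<lambda>z. (Q z)\<^sup>2)"
    and "(\<integral>z. (Q z)\<^sup>2 \<partial>gauss \<sigma> I) = \<sigma> ^ 4 * ((\<Sum>i\<in>I. B i i)\<^sup>2 + 2 * (\<Sum>i\<in>I. \<Sum>j\<in>I. (B i j)\<^sup>2))"
proof -
  have Q2: "(Q z)\<^sup>2 = (\<Sum>(i,j)\<in>I\<times>I. \<Sum>(k,l)\<in>I\<times>I. B i j * B k l * (z i * z j * z k * z l))" for z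
  proof -
    have "Q z = (\<Sum>(i,j)\<in>I\<times>I. B i j * (z i * z j))"
      unfolding Q_def by (rule sum.cartesian_product)
    then show ?thesis
      unfolding power2_eq_square by (simp only: sum_product) (intro sum.cong refl, auto simp: case_prod_unfold sum_distrib_left algebra_simps)
  qed
  have int: "integrable (gauss \<sigma> I) (\<lambda>z. \<Sum>(k,l)\<in>I\<times>I. B i j * B k l * (z i * z j * z k * z l))"
    if "i \<in> I" "j \<in> I" for i j
    using that unfolding case_prod_unfold
    by (intro Bochner_Integration.integrable_sum integrable_mult_right gauss_moment4) auto
  show "integrable (gauss \<sigma> I) (\<lambda>z. (Q z)\<^sup>2)"
    unfolding Q2 using int by (intro Bochner_Integration.integrable_sum) auto
  have "(\<integral>z. (Q z)\<^sup>2 \<partial>gauss \<sigma> I) = (\<Sum>(i,j)\<in>I\<times>I. \<Sum>(k,l)\<in>I\<times>I. B i j * B k l *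
     (\<sigma> ^ 4 * (of_bool (i = j \<and> k = l) + of_bool (i = k \<and> j = l) + of_bool (i = l \<and> j = k))))"
    unfolding Q2
  proof (subst Bochner_Integration.integral_sum, goal_cases)
    case 1 then show ?case using int by auto
  next
    case 2
    show ?case
    proof (intro sum.cong refl, clarify, subst Bochner_Integration.integral_sum, goal_cases)
      case 1 then show ?case by (auto intro!: integrable_mult_right gauss_moment4)
    next
      case (2 i j)
      then show ?case
        by (intro sum.cong refl) (auto simp: gauss_moment4)
    qed
  qed
  also have "\<dots> = \<sigma> ^ 4 * (\<Sum>i\<in>I. \<Sum>j\<in>I. \<Sum>k\<in>I. \<Sum>l\<in>I. 
      (if l = k then if j = i then B i j * B k l else 0 else 0)
      + (if l = j then if k = i then B i j * B k l else 0 else 0)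
      + (if l = i then if k = j then B i j * B k l else 0 else 0))"
    unfolding sum.cartesian_product[symmetric] sum_distrib_left
    by (intro sum.cong refl) (auto simp: algebra_simps)
  also have "\<dots> = \<sigma> ^ 4 * ((\<Sum>i\<in>I. B i i)\<^sup>2 + 2 * (\<Sum>i\<in>I. \<Sum>j\<in>I. (B i j)\<^sup>2))"
  proof -
    have 1: "(\<Sum>i\<in>I. \<Sum>j\<in>I. \<Sum>k\<in>I. \<Sum>l\<in>I. if l = k then if j = i then B i j * B k l else 0 else 0)
       = (\<Sum>i\<in>I. B i i)\<^sup>2"
    proof -
      have "(\<Sum>k\<in>I. \<Sum>l\<in>I. if l = k then if j = i then B i j * B k l else 0 else 0) =
          (if j = i then B i i * (\<Sum>k\<in>I. B k k) else 0)" for i j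
        using fin by (simp add: sum_distrib_left)
      then show ?thesis
        using fin by (simp add: power2_eq_square sum_distrib_right)
    qed
    have 2: "(\<Sum>i\<in>I. \<Sum>j\<in>I. \<Sum>k\<in>I. \<Sum>l\<in>I. if l = j then if k = i then B i j * B k l else 0 else 0)
       = (\<Sum>i\<in>I. \<Sum>j\<in>I. (B i j)\<^sup>2)"
      using fin by (simp add: power2_eq_square)
    have 3: "(\<Sum>i\<in>I. \<Sum>j\<in>I. \<Sum>k\<in>I. \<Sum>l\<in>I. if l = i then if k = j then B i j * B k l else 0 else 0)
       = (\<Sum>i\<in>I. \<Sum>j\<in>I. (B i j)\<^sup>2)"
      using fin by (simp add: power2_eq_square sym[of _ _])
    show ?thesis
      unfolding sum.distrib 1 2 3 by simp
  qed
  finally show "(\<integral>z. (Q z)\<^sup>2 \<partial>gauss \<sigma> I) = \<sigma> ^ 4 * ((\<Sum>i\<in>I. B i i)\<^sup>2 + 2 * (\<Sum>i\<in>I. \<Sum>j\<in>I. (B i j)\<^sup>2))" .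
qed

text \<open>Stated for the nonnegative integral because it is used inside integrals over further
  variables, where no integrability has to be tracked.\<close>

lemma gauss_quad_form_variance:
  fixes B :: "'i \<Rightarrow> 'i \<Rightarrow> real"
  assumes sym: "\<And>i j. B i j = B j i"
  shows "(\<integral>\<^sup>+z. ennreal (((\<Sum>i\<in>I. \<Sum>j\<in>I. B i j * (z i * z j)) - \<sigma>\<^sup>2 * (\<Sum>i\<in>I. B i i))\<^sup>2) \<partial>gauss \<sigma> I)
     = ennreal (2 * \<sigma> ^ 4 * (\<Sum>i\<in>I. \<Sum>j\<in>I. (B i j)\<^sup>2))"
proof -
  interpret G: prob_space "gauss \<sigma> I" by (rule prob_space_gauss[OF \<sigma>])
  define Q where "Q z = (\<Sum>i\<in>I. \<Sum>j\<in>I. B i j * (z i * z j))" for z :: "'i \<Rightarrow> real"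
  define T where "T = \<sigma>\<^sup>2 * (\<Sum>i\<in>I. B i i)"
  have Q: "integrable (gauss \<sigma> I) Q" "(\<integral>z. Q z \<partial>gauss \<sigma> I) = T"
    unfolding Q_def T_def by (rule gauss_quad_form)+
  have Q2: "integrable (gauss \<sigma> I) (\<lambda>z. (Q z)\<^sup>2)"
    "(\<integral>z. (Q z)\<^sup>2 \<partial>gauss \<sigma> I) = T\<^sup>2 + 2 * \<sigma> ^ 4 * (\<Sum>i\<in>I. \<Sum>j\<in>I. (B i j)\<^sup>2)"
    unfolding Q_def T_def
    by (rule gauss_quad_form_sq[OF sym], subst gauss_quad_form_sq[OF sym], 
        simp add: algebra_simps power_mult_distrib flip: power_mult)
  have "(\<integral>\<^sup>+z. ennreal ((Q z - T)\<^sup>2) \<partial>gauss \<sigma> I) = ennreal (\<integral>z. (Q z - T)\<^sup>2 \<partial>gauss \<sigma> I)"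
  proof (rule nn_integral_eq_integral)
    show "integrable (gauss \<sigma> I) (\<lambda>z. (Q z - T)\<^sup>2)"
      using Q(1) Q2(1) by (auto simp: power2_diff)
  qed simp
  also have "(\<integral>z. (Q z - T)\<^sup>2 \<partial>gauss \<sigma> I) = 2 * \<sigma> ^ 4 * (\<Sum>i\<in>I. \<Sum>j\<in>I. (B i j)\<^sup>2)"
  proof -
    have "(\<lambda>z. (Q z - T)\<^sup>2) = (\<lambda>z. (Q z)\<^sup>2 - 2 * T * Q z + T\<^sup>2)"
      by (auto simp: power2_diff)
    moreover have "(\<integral>z. (Q z)\<^sup>2 - 2 * T * Q z + T\<^sup>2 \<partial>gauss \<sigma> I)
        = (\<integral>z. (Q z)\<^sup>2 \<partial>gauss \<sigma> I) - 2 * T * (\<integral>z. Q z \<partial>gauss \<sigma> I) + T\<^sup>2"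
      using Q(1) Q2(1) by (simp add: G.prob_space)
    ultimately show ?thesis
      unfolding Q(2) Q2(2) by (simp add: power2_eq_square)
  qed
  finally show ?thesis unfolding Q_def T_def .
qed

end

section \<open>Densities and affine substitution on finite products\<close>

lemma nn_integral_PiM_density:
  fixes h :: "'i \<Rightarrow> real \<Rightarrow> real" and f :: "('i \<Rightarrow> real) \<Rightarrow> ennreal"
  assumes fin: "finite I" and h: "\<And>i. i \<in> I \<Longrightarrow> h i \<in> borel_measurable borel"
    and h0: "\<And>i x. 0 \<le> h i x"
    and ps: "\<And>i. prob_space (density lborel (h i))"
    and f: "f \<in> borel_measurable (\<Pi>\<^sub>M i\<in>I. borel)"
  shows "(\<integral>\<^sup>+y. f y \<partial>(\<Pi>\<^sub>M i\<in>I. density lborel (h i))) =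
    (\<integral>\<^sup>+y. ennreal (\<Prod>i\<in>I. h i (y i)) * f y \<partial>(\<Pi>\<^sub>M i\<in>I. lborel))"
proof -
  interpret L: product_sigma_finite "\<lambda>_::'i. lborel :: real measure" ..
  interpret D: product_sigma_finite "\<lambda>i::'i. density lborel (h i)"
    unfolding product_sigma_finite_def using ps by (intro allI prob_space_imp_sigma_finite)
  have meas: "(\<lambda>y. ennreal (\<Prod>i\<in>I. h i (y i))) \<in> borel_measurable (\<Pi>\<^sub>M i\<in>I. lborel)"
    using fin h by measurable
  have "density (\<Pi>\<^sub>M i\<in>I. lborel) (\<lambda>y. ennreal (\<Prod>i\<in>I. h i (y i))) = (\<Pi>\<^sub>M i\<in>I. density lborel (h i))"
  proof (rule D.PiM_eqI[OF fin])
    show "sets (density (\<Pi>\<^sub>M i\<in>I. lborel) (\<lambda>y. ennreal (\<Prod>i\<in>I. h i (y i)))) = sets (\<Pi>\<^sub>M i\<in>I. density lborel (h i))"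
      by (auto intro!: sets_PiM_cong)
    fix A assume A: "\<And>i. i \<in> I \<Longrightarrow> A i \<in> sets (density lborel (h i))"
    then have A': "Pi\<^sub>E I A \<in> sets (\<Pi>\<^sub>M i\<in>I. lborel)"
      using fin by (intro sets_PiM_I_finite) auto
    have "emeasure (density (\<Pi>\<^sub>M i\<in>I. lborel) (\<lambda>y. ennreal (\<Prod>i\<in>I. h i (y i)))) (Pi\<^sub>E I A)
        = (\<integral>\<^sup>+y. ennreal (\<Prod>i\<in>I. h i (y i)) * indicator (Pi\<^sub>E I A) y \<partial>(\<Pi>\<^sub>M i\<in>I. lborel))"
      by (rule emeasure_density[OF meas A'])
    also have "\<dots> = (\<integral>\<^sup>+y. (\<Prod>i\<in>I. ennreal (h i (y i)) * indicator (A i) (y i)) \<partial>(\<Pi>\<^sub>M i\<in>I. lborel))"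
    proof (rule nn_integral_cong)
      fix y assume "y \<in> space (\<Pi>\<^sub>M i\<in>I. (lborel::real measure))"
      then have "y \<in> extensional I" by (auto simp: space_PiM PiE_def)
      then have "(indicator (Pi\<^sub>E I A) y :: ennreal) = (\<Prod>i\<in>I. indicator (A i) (y i))"
        using fin by (auto simp: indicator_def PiE_def Pi_def)
      then show "ennreal (\<Prod>i\<in>I. h i (y i)) * indicator (Pi\<^sub>E I A) y =
          (\<Prod>i\<in>I. ennreal (h i (y i)) * indicator (A i) (y i))"
        by (simp add: prod.distrib prod_ennreal h0)
    qed
    also have "\<dots> = (\<Prod>i\<in>I. \<integral>\<^sup>+y. ennreal (h i y) * indicator (A i) y \<partial>lborel)"
      using A h by (intro L.product_nn_integral_prod fin) auto
    also have "\<dots> = (\<Prod>i\<in>I. emeasure (density lborel (h i)) (A i))"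
      using A h by (intro prod.cong refl emeasure_density[symmetric]) auto
    finally show "emeasure (density (\<Pi>\<^sub>M i\<in>I. lborel) (\<lambda>y. ennreal (\<Prod>i\<in>I. h i (y i)))) (Pi\<^sub>E I A)
       = (\<Prod>i\<in>I. emeasure (density lborel (h i)) (A i))" .
  qed
  then have "(\<integral>\<^sup>+y. f y \<partial>(\<Pi>\<^sub>M i\<in>I. density lborel (h i))) =
     (\<integral>\<^sup>+y. f y \<partial>density (\<Pi>\<^sub>M i\<in>I. lborel) (\<lambda>y. ennreal (\<Prod>i\<in>I. h i (y i))))"
    by simp
  also have "\<dots> = (\<integral>\<^sup>+y. ennreal (\<Prod>i\<in>I. h i (y i)) * f y \<partial>(\<Pi>\<^sub>M i\<in>I. lborel))"
    using f by (intro nn_integral_density[OF meas]) (simp cong: measurable_cong_sets sets_PiM_cong)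
  finally show ?thesis .
qed

lemma nn_integral_PiM_lborel_affine:
  fixes f :: "('i \<Rightarrow> real) \<Rightarrow> ennreal" and m :: "'i \<Rightarrow> real"
  assumes fin: "finite I" and c: "c > 0" and f: "f \<in> borel_measurable (\<Pi>\<^sub>M i\<in>I. borel)"
  shows "(\<integral>\<^sup>+y. f y \<partial>(\<Pi>\<^sub>M i\<in>I. lborel)) =
    ennreal (c ^ card I) * (\<integral>\<^sup>+y. f (\<lambda>i\<in>I. m i + c * y i) \<partial>(\<Pi>\<^sub>M i\<in>I. lborel))"
proof -
  interpret L: product_sigma_finite "\<lambda>_::'i. lborel :: real measure" ..
  let ?T = "\<lambda>y. \<lambda>i\<in>I. m i + c * y i"
  have T[measurable]: "?T \<in> (\<Pi>\<^sub>M i\<in>I. lborel) \<rightarrow>\<^sub>M (\<Pi>\<^sub>M i\<in>I. lborel)"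
    by measurable
  let ?D = "distr (\<Pi>\<^sub>M i\<in>I. lborel) (\<Pi>\<^sub>M i\<in>I. lborel) ?T"
  have "density ?D (\<lambda>_. ennreal (c ^ card I)) = (\<Pi>\<^sub>M i\<in>I. lborel)"
  proof (rule L.PiM_eqI[OF fin])
    show "sets (density ?D (\<lambda>_. ennreal (c ^ card I))) = sets (\<Pi>\<^sub>M i\<in>I. lborel)" by simp
    fix A :: "'i \<Rightarrow> real set" assume A: "\<And>i. i \<in> I \<Longrightarrow> A i \<in> sets lborel"
    have A': "Pi\<^sub>E I A \<in> sets (\<Pi>\<^sub>M i\<in>I. lborel)"
      using A fin by (intro sets_PiM_I_finite) auto
    have A1: "(\<lambda>x. m i + c * x) -` A i \<in> sets lborel" if "i \<in> I" for i
      using measurable_sets[of "\<lambda>x. m i + c * x" borel borel "A i"] A[OF that] by simp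
    have "?T -` Pi\<^sub>E I A \<inter> space (\<Pi>\<^sub>M i\<in>I. (lborel::real measure)) = Pi\<^sub>E I (\<lambda>i. (\<lambda>x. m i + c * x) -` A i)"
      by (auto simp: space_PiM PiE_def Pi_def)
    then have "emeasure (density ?D (\<lambda>_. ennreal (c ^ card I))) (Pi\<^sub>E I A) =
       ennreal (c ^ card I) * emeasure (\<Pi>\<^sub>M i\<in>I. lborel) (Pi\<^sub>E I (\<lambda>i. (\<lambda>x. m i + c * x) -` A i))"
      using A' by (simp add: emeasure_density_const emeasure_distr[OF T])
    also have "\<dots> = ennreal (c ^ card I) * (\<Prod>i\<in>I. emeasure lborel ((\<lambda>x. m i + c * x) -` A i))"
      using A1 fin by (subst L.emeasure_PiM) auto
    also have "\<dots> = (\<Prod>i\<in>I. ennreal c * emeasure lborel ((\<lambda>x. m i + c * x) -` A i))"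
      using c by (simp add: prod.distrib ennreal_power)
    also have "\<dots> = (\<Prod>i\<in>I. emeasure lborel (A i))"
    proof (intro prod.cong refl)
      fix i assume i: "i \<in> I"
      have "emeasure lborel (A i) = emeasure (density (distr lborel borel (\<lambda>x. m i + c * x)) (\<lambda>_. ennreal c)) (A i)"
        using lborel_real_affine[of c "m i"] c by simp
      also have "\<dots> = ennreal c * emeasure lborel ((\<lambda>x. m i + c * x) -` A i)"
        using A[OF i] by (simp add: emeasure_density_const emeasure_distr)
      finally show "ennreal c * emeasure lborel ((\<lambda>x. m i + c * x) -` A i) = emeasure lborel (A i)" ..
    qed
    finally show "emeasure (density ?D (\<lambda>_. ennreal (c ^ card I))) (Pi\<^sub>E I A) = (\<Prod>i\<in>I. emeasure lborel (A i))" .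
  qed
  then have "(\<integral>\<^sup>+y. f y \<partial>(\<Pi>\<^sub>M i\<in>I. lborel)) = (\<integral>\<^sup>+y. f y \<partial>density ?D (\<lambda>_. ennreal (c ^ card I)))"
    by simp
  also have "\<dots> = ennreal (c ^ card I) * (\<integral>\<^sup>+y. f y \<partial>?D)"
    using f by (subst nn_integral_density) (auto simp: nn_integral_cmult cong: measurable_cong_sets sets_PiM_cong)
  also have "(\<integral>\<^sup>+y. f y \<partial>?D) = (\<integral>\<^sup>+y. f (?T y) \<partial>(\<Pi>\<^sub>M i\<in>I. lborel))"
    using f by (intro nn_integral_distr T) (simp cong: measurable_cong_sets sets_PiM_cong)
  finally show ?thesis .
qed

section \<open>Polar decomposition of the Gaussian measure\<close>

abbreviation lebesgue_vec :: "nat \<Rightarrow> (nat \<Rightarrow> real) measure" where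
  "lebesgue_vec p \<equiv> \<Pi>\<^sub>M i\<in>{..<p}. lborel"

text \<open>Scaled so that its square has Gaussian mean 1 and the complementary factor
  \<open>direction\<close> has norm \<open>sqrt p\<close>, as the prior requires.\<close>

definition radius :: "nat \<Rightarrow> (nat \<Rightarrow> real) \<Rightarrow> real" where
  "radius p z = L2_set z {..<p} / sqrt (real p)"

definition direction :: "nat \<Rightarrow> (nat \<Rightarrow> real) \<Rightarrow> nat \<Rightarrow> real" where
  "direction p b = (\<lambda>i\<in>{..<p}. sqrt (real p) * b i / L2_set b {..<p})"

definition scale_vec :: "nat \<Rightarrow> real \<Rightarrow> (nat \<Rightarrow> real) \<Rightarrow> nat \<Rightarrow> real" where
  "scale_vec p r b = (\<lambda>i\<in>{..<p}. r * b i)"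

lemma sets_lebesgue_vec: "sets (lebesgue_vec p) = sets (vec_borel p)"
  by (intro sets_PiM_cong) auto

lemma measurable_L2_set [measurable]: "(\<lambda>z. L2_set z {..<p}) \<in> borel_measurable (vec_borel p)"
  unfolding L2_set_def by measurable

lemma measurable_radius [measurable]: "radius p \<in> borel_measurable (vec_borel p)"
  unfolding radius_def by measurable

lemma measurable_direction [measurable]: "direction p \<in> vec_borel p \<rightarrow>\<^sub>M vec_borel p"
  unfolding direction_def by measurable

lemma measurable_scale_vec [measurable]:
  "(\<lambda>(r, b). scale_vec p r b) \<in> borel \<Otimes>\<^sub>M vec_borel p \<rightarrow>\<^sub>M vec_borel p"
  unfolding scale_vec_def case_prod_unfold by measurable

lemma L2_set_scale_vec: "0 \<le> r \<Longrightarrow> L2_set (scale_vec p r b) {..<p} = r * L2_set b {..<p}"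
  unfolding scale_vec_def
  by (subst L2_set_right_distrib) (auto intro: L2_set_cong)

text \<open>At the zero vector \<open>direction\<close> is not a point of the sphere, but there the
  radius is 0 and the product is still correct.\<close>

lemma scale_vec_polar:
  assumes "p > 0" "z \<in> space (vec_borel p)"
  shows "scale_vec p (radius p z) (direction p z) = z"
proof
  fix i
  show "scale_vec p (radius p z) (direction p z) i = z i"
  proof (cases "i < p")
    case True
    show ?thesis
    proof (cases "L2_set z {..<p} = 0")
      case True
      then have "z i = 0" using \<open>i < p\<close> by (simp add: L2_set_eq_0_iff)
      then show ?thesis using True \<open>i < p\<close> by (simp add: scale_vec_def direction_def)
    next
      case False
      then show ?thesis using \<open>i < p\<close> assms(1) by (simp add: scale_vec_def direction_def radius_def)
    qed
  next
    case False
    then show ?thesis using assms(2) by (auto simp: scale_vec_def space_PiM PiE_def extensional_def)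
  qed
qed

lemma direction_scale_vec:
  assumes "r > 0"
  shows "direction p (scale_vec p r b) = direction p b"
  unfolding direction_def
  using assms by (intro restrict_ext) (simp add: L2_set_scale_vec, simp add: scale_vec_def)

lemma emeasure_lebesgue_vec_scale:
  assumes c: "c > 0" and S: "S \<in> sets (vec_borel p)"
  shows "emeasure (lebesgue_vec p) S
    = ennreal (c ^ p) * emeasure (lebesgue_vec p) (scale_vec p c -` S \<inter> space (vec_borel p))"
proof -
  have "emeasure (lebesgue_vec p) S = (\<integral>\<^sup>+y. indicator S y \<partial>lebesgue_vec p)"
    using S by (simp add: sets_lebesgue_vec)
  also have "\<dots> = ennreal (c ^ p) * (\<integral>\<^sup>+y. indicator S (\<lambda>i\<in>{..<p}. 0 + c * y i) \<partial>lebesgue_vec p)"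
    using S c by (subst nn_integral_PiM_lborel_affine[of _ c _ "\<lambda>_. 0"]) auto
  also have "(\<integral>\<^sup>+y. indicator S (\<lambda>i\<in>{..<p}. 0 + c * y i) \<partial>lebesgue_vec p)
     = (\<integral>\<^sup>+y. indicator (scale_vec p c -` S \<inter> space (vec_borel p)) y \<partial>lebesgue_vec p)"
    by (intro nn_integral_cong) (auto simp: scale_vec_def indicator_def space_PiM)
  also have "\<dots> = emeasure (lebesgue_vec p) (scale_vec p c -` S \<inter> space (vec_borel p))"
    using S by (intro nn_integral_indicator) (simp add: sets_lebesgue_vec)
  finally show ?thesis .
qed

lemma emeasure_sphere_uniform:
  assumes "B \<in> sets (vec_borel p)"
  shows "emeasure (sphere_uniform p) B =
    emeasure (lebesgue_vec p) (vec_cball p \<inter> (direction p -` B \<inter> space (vec_borel p)))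
      / emeasure (lebesgue_vec p) (vec_cball p)"
  unfolding sphere_uniform_def
  using assms sphere_uniform_map_measurable[of p]
  by (simp add: emeasure_distr direction_def[abs_def, symmetric] space_PiM)
    (subst emeasure_uniform_measure,
      auto simp: vec_cball_sets vec_cball_sets[unfolded sets_lebesgue_vec] sets_lebesgue_vec space_PiM direction_def[abs_def]
        intro!: measurable_sets_Collect arg_cong2[where f=divide])

text \<open>Norm and direction are independent already for Lebesgue measure on balls. Cones are
  invariant under scaling, so passing from radius t to radius \<open>sqrt p\<close> multiplies both
  sides by the same power, and at radius \<open>sqrt p\<close> the identity is the definition of
  \<open>sphere_uniform\<close>.\<close>

lemma emeasure_cone_cball:
  assumes p: "p > 0" and B: "B \<in> sets (vec_borel p)"
  defines "D \<equiv> direction p -` B \<inter> space (vec_borel p)"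
  shows "emeasure (lebesgue_vec p) (D \<inter> {z. L2_set z {..<p} \<le> t}) =
     emeasure (sphere_uniform p) B *
       emeasure (lebesgue_vec p) (space (vec_borel p) \<inter> {z. L2_set z {..<p} \<le> t})"
proof -
  have D[measurable]: "D \<in> sets (vec_borel p)"
    unfolding D_def using B by measurable
  have S: "X \<inter> {z. L2_set z {..<p} \<le> t} \<in> sets (vec_borel p)"
    if "X \<in> sets (vec_borel p)" for X t
  proof -
    have "X \<inter> {z. L2_set z {..<p} \<le> t} = X \<inter> {z \<in> space (vec_borel p). L2_set z {..<p} \<le> t}"
      using sets.sets_into_space[OF that] by auto
    also have "\<dots> \<in> sets (vec_borel p)"
      using that by measurable
    finally show ?thesis .
  qed
  consider "t < 0" | "t = 0" | "t > 0" by linarith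
  then show ?thesis
  proof cases
    case 1
    then have "{z. L2_set z {..<p} \<le> t} = {}"
      using L2_set_nonneg[of _ "{..<p}"] by (auto simp: not_le intro: less_le_trans)
    then show ?thesis by simp
  next
    \<comment> \<open>Scaling fails at radius 0, but both sides vanish: the ball is a single point,
      which is null since p > 0.\<close>
    case 2
    interpret product_sigma_finite "\<lambda>_::nat. lborel :: real measure" ..
    have "emeasure (lebesgue_vec p) (\<Pi>\<^sub>E i\<in>{..<p}. {0}) = (\<Prod>i<p. emeasure lborel {0::real})"
      by (rule emeasure_PiM) auto
    also have "\<dots> = 0" using p by auto
    finally have "(\<Pi>\<^sub>E i\<in>{..<p}. {0}) \<in> null_sets (lebesgue_vec p)"
      by (intro null_setsI sets_PiM_I_finite) auto
    moreover have "space (vec_borel p) \<inter> {z. L2_set z {..<p} \<le> 0} \<subseteq> (\<Pi>\<^sub>E i\<in>{..<p}. {0})"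
    proof
      fix z assume z: "z \<in> space (vec_borel p) \<inter> {z. L2_set z {..<p} \<le> 0}"
      then have "L2_set z {..<p} = 0"
        using L2_set_nonneg[of z "{..<p}"] by simp
      then have "\<forall>i<p. z i = 0" by (simp add: L2_set_eq_0_iff)
      then show "z \<in> (\<Pi>\<^sub>E i\<in>{..<p}. {0})"
        using z by (auto simp: space_PiM PiE_iff fun_eq_iff extensional_def)
    qed
    ultimately have *: "space (vec_borel p) \<inter> {z. L2_set z {..<p} \<le> 0} \<in> null_sets (lebesgue_vec p)"
      by (rule null_sets_subset[OF _ S[OF sets.top, folded sets_lebesgue_vec]])
    moreover have "D \<inter> {z. L2_set z {..<p} \<le> 0} \<in> null_sets (lebesgue_vec p)"
      by (rule null_sets_subset[OF * S[OF D, folded sets_lebesgue_vec]]) (use D_def in blast)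
    ultimately show ?thesis using 2 by (simp add: null_setsD1)
  next
    case 3
    define c where "c = t / sqrt (real p)"
    have c: "c > 0" using 3 p by (simp add: c_def)
    have ball: "vec_cball p = space (vec_borel p) \<inter> {z. L2_set z {..<p} \<le> sqrt (real p)}"
      by (auto simp: vec_cball_def space_PiM)
    have eq: "c * L2_set z {..<p} \<le> t \<longleftrightarrow> L2_set z {..<p} \<le> sqrt (real p)" for z
      using 3 p by (simp add: c_def field_simps)
    have sp: "scale_vec p c z \<in> space (vec_borel p)" for z
      by (auto simp: scale_vec_def space_PiM)
    have 1: "emeasure (lebesgue_vec p) (D \<inter> {z. L2_set z {..<p} \<le> t}) =
      ennreal (c ^ p) * emeasure (lebesgue_vec p) (vec_cball p \<inter> D)"
      unfolding emeasure_lebesgue_vec_scale[OF c S[OF D, of t]] ball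
      by (intro arg_cong2[where f="(*)"] arg_cong2[where f=emeasure] refl)
        (use c sp in \<open>auto simp: D_def L2_set_scale_vec eq direction_scale_vec\<close>)
    have 2: "emeasure (lebesgue_vec p) (space (vec_borel p) \<inter> {z. L2_set z {..<p} \<le> t}) =
      ennreal (c ^ p) * emeasure (lebesgue_vec p) (vec_cball p)"
      unfolding emeasure_lebesgue_vec_scale[OF c S[OF sets.top, of t]] ball
      by (intro arg_cong2[where f="(*)"] arg_cong2[where f=emeasure] refl)
        (use c sp in \<open>auto simp: L2_set_scale_vec eq\<close>)
    have "emeasure (lebesgue_vec p) (vec_cball p \<inter> D) =
      emeasure (sphere_uniform p) B * emeasure (lebesgue_vec p) (vec_cball p)"
      unfolding emeasure_sphere_uniform[OF B] D_def[symmetric]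
      using emeasure_vec_cball[of p] by (simp add: ennreal_divide_times ennreal_mult_divide_eq less_top)
    then show ?thesis
      unfolding 1 2 by (simp add: mult_ac)
  qed
qed

text \<open>By \<open>emeasure_cone_cball\<close> the law of the norm restricted to a cone and a
  multiple of the full law of the norm agree on all half-lines. These generate the Borel sets and
  are closed under intersection, so the two measures are equal.\<close>

lemma nn_integral_cone:
  assumes p: "p > 0" and B: "B \<in> sets (vec_borel p)" and f[measurable]: "f \<in> borel_measurable borel"
  shows "(\<integral>\<^sup>+z. indicator (direction p -` B \<inter> space (vec_borel p)) z * f (L2_set z {..<p}) \<partial>lebesgue_vec p)
    = emeasure (sphere_uniform p) B * (\<integral>\<^sup>+z. f (L2_set z {..<p}) \<partial>lebesgue_vec p)"
proof -
  define D where "D = direction p -` B \<inter> space (vec_borel p)"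
  let ?n = "\<lambda>z. L2_set z {..<p}" and ?V = "lebesgue_vec p"
  have D[measurable]: "D \<in> sets (vec_borel p)"
    unfolding D_def using B by measurable
  have n[measurable]: "?n \<in> borel_measurable ?V"
    by (subst measurable_cong_sets[OF sets_lebesgue_vec refl]) measurable
  have iD[measurable]: "(indicator D :: _ \<Rightarrow> ennreal) \<in> borel_measurable ?V"
    by (subst measurable_cong_sets[OF sets_lebesgue_vec refl]) measurable
  let ?RD = "distr (density ?V (indicator D)) borel ?n" and ?R = "distr ?V borel ?n"
  have nd: "?n \<in> borel_measurable (density ?V (indicator D))" by simp
  have e1: "emeasure ?RD {..t} = emeasure ?V (D \<inter> {z. ?n z \<le> t})" for t
  proof -
    have s: "?n -` {..t} \<inter> space ?V \<in> sets ?V" by (rule measurable_sets[OF n]) simp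
    have "emeasure ?RD {..t} = emeasure (density ?V (indicator D)) (?n -` {..t} \<inter> space ?V)"
      by (subst emeasure_distr[OF nd]) auto
    also have "\<dots> = (\<integral>\<^sup>+z. indicator (D \<inter> {z. ?n z \<le> t}) z \<partial>?V)"
      unfolding emeasure_density[OF iD s]
      by (intro nn_integral_cong) (auto simp: indicator_def)
    also have "\<dots> = emeasure ?V (D \<inter> {z. ?n z \<le> t})"
    proof (rule nn_integral_indicator)
      have "D \<inter> {z. ?n z \<le> t} = D \<inter> (?n -` {..t} \<inter> space ?V)"
        by (auto simp: D_def space_PiM)
      then show "D \<inter> {z. ?n z \<le> t} \<in> sets ?V"
        using s D by (simp add: sets_lebesgue_vec)
    qed
    finally show ?thesis .
  qed
  have e2: "emeasure ?R {..t} = emeasure ?V (space (vec_borel p) \<inter> {z. ?n z \<le> t})" for t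
    by (subst emeasure_distr[OF n]) (auto intro!: arg_cong2[where f=emeasure] simp: space_PiM)
  have "?RD = scale_measure (emeasure (sphere_uniform p) B) ?R"
  proof (rule measure_eqI_generator_eq[where E="range atMost" and \<Omega>=UNIV and A="\<lambda>n. {..real n}"])
    show "Int_stable (range (atMost :: real \<Rightarrow> _))"
      by (auto simp: Int_stable_def)
    fix X assume "X \<in> range (atMost :: real \<Rightarrow> _)"
    then obtain t where "X = {..t}" by auto
    then show "emeasure ?RD X = emeasure (scale_measure (emeasure (sphere_uniform p) B) ?R) X"
      by (simp add: e1 e2 emeasure_cone_cball[OF p B, folded D_def])
  next
    fix k
    have "emeasure ?RD {..real k} \<le> emeasure ?V (space (vec_borel p) \<inter> {z. ?n z \<le> real k})"
      unfolding e1 e2[symmetric] by (subst emeasure_distr[OF n])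
        (auto intro!: emeasure_mono measurable_sets[OF n] simp: D_def space_PiM)
    \<comment> \<open>The extra 1 keeps the radius positive at \<open>k = 0\<close>.\<close>
    also have "\<dots> \<le> emeasure ?V ({f. sqrt (\<Sum>i\<in>{..<p}. (f i)\<^sup>2) \<le> real k + 1} \<inter> space ?V)"
      by (rule emeasure_mono) (auto simp: L2_set_def space_PiM intro: order_trans)
    also have "\<dots> < \<infinity>"
      by (subst emeasure_cball_aux) (auto simp: less_top[symmetric])
    finally show "emeasure ?RD {..real k} \<noteq> \<infinity>" by simp
  next
    show "(\<Union>i. {..real i}) = (UNIV :: real set)"
      using real_arch_simple by auto
  qed (auto simp: borel_eq_atMost)
  then have "(\<integral>\<^sup>+x. f x \<partial>?RD) = (\<integral>\<^sup>+x. f x \<partial>scale_measure (emeasure (sphere_uniform p) B) ?R)"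
    by simp
  then show ?thesis
    by (simp add: nn_integral_distr nn_integral_density nn_integral_scale_measure D_def[symmetric])
qed

lemma nn_integral_gauss:
  assumes "f \<in> borel_measurable (vec_borel p)"
  shows "(\<integral>\<^sup>+z. f z \<partial>gauss 1 {..<p}) =
    (\<integral>\<^sup>+z. ennreal ((1 / sqrt (2 * pi)) ^ p * exp (- (L2_set z {..<p})\<^sup>2 / 2)) * f z \<partial>lebesgue_vec p)"
proof -
  have "(\<Prod>i<p. normal_density 0 1 (z i)) = (1 / sqrt (2 * pi)) ^ p * exp (- (L2_set z {..<p})\<^sup>2 / 2)"
    for z :: "nat \<Rightarrow> real"
  proof -
    have "(\<Prod>i<p. normal_density 0 1 (z i)) = (1 / sqrt (2 * pi)) ^ p * exp (\<Sum>i<p. - (z i)\<^sup>2 / 2)"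
      by (simp add: normal_density_def prod_dividef exp_sum power_divide)
    also have "(\<Sum>i<p. - (z i)\<^sup>2 / 2) = - (L2_set z {..<p})\<^sup>2 / 2"
      by (simp add: L2_set_def sum_nonneg sum_negf sum_divide_distrib)
    finally show ?thesis .
  qed
  then show ?thesis
    using assms prob_space_normal_density[of 1 0]
    by (subst nn_integral_PiM_density) (auto simp: normal_density_nonneg)
qed

text \<open>The Gaussian density depends on the norm alone, so the independence of norm and
  direction passes from Lebesgue measure to the Gaussian one.\<close>

lemma gauss_polar_pair:
  assumes p: "p > 0"
  shows "distr (gauss 1 {..<p}) borel (radius p) \<Otimes>\<^sub>M sphere_uniform p =
    distr (gauss 1 {..<p}) (borel \<Otimes>\<^sub>M vec_borel p) (\<lambda>z. (radius p z, direction p z))"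
proof (rule pair_measure_eqI)
  interpret G: prob_space "gauss 1 {..<p}" by (rule prob_space_gauss) simp
  have r: "radius p \<in> borel_measurable (gauss 1 {..<p})" by measurable
  have d: "direction p \<in> gauss 1 {..<p} \<rightarrow>\<^sub>M vec_borel p" by measurable
  show "sigma_finite_measure (distr (gauss 1 {..<p}) borel (radius p))"
    by (intro prob_space_imp_sigma_finite G.prob_space_distr r)
  show "sigma_finite_measure (sphere_uniform p)"
    by (intro prob_space_imp_sigma_finite prob_space_sphere_uniform)
  show "sets (distr (gauss 1 {..<p}) borel (radius p) \<Otimes>\<^sub>M sphere_uniform p) =
    sets (distr (gauss 1 {..<p}) (borel \<Otimes>\<^sub>M vec_borel p) (\<lambda>z. (radius p z, direction p z)))"
    unfolding sets_distr by (intro sets_pair_measure_cong) (auto simp: sphere_uniform_def)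
  fix A B assume "A \<in> sets (distr (gauss 1 {..<p}) borel (radius p))" and "B \<in> sets (sphere_uniform p)"
  then have A[measurable]: "A \<in> sets borel" and B[measurable]: "B \<in> sets (vec_borel p)"
    by (auto simp: sphere_uniform_def)
  define k where "k r = ennreal ((1 / sqrt (2 * pi)) ^ p * exp (- r\<^sup>2 / 2)) *
      indicator A (r / sqrt (real p))" for r :: real
  have k[measurable]: "k \<in> borel_measurable borel" unfolding k_def by measurable
  let ?D = "direction p -` B \<inter> space (vec_borel p)"
  have "emeasure (distr (gauss 1 {..<p}) borel (radius p)) A
      = (\<integral>\<^sup>+z. indicator A (radius p z) \<partial>gauss 1 {..<p})"
    by (subst nn_integral_distr[OF r, symmetric]) auto
  also have "\<dots> = (\<integral>\<^sup>+z. k (L2_set z {..<p}) \<partial>lebesgue_vec p)"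
    by (subst nn_integral_gauss) (auto simp: k_def radius_def)
  finally have 1: "emeasure (distr (gauss 1 {..<p}) borel (radius p)) A = (\<integral>\<^sup>+z. k (L2_set z {..<p}) \<partial>lebesgue_vec p)" .
  have rd: "(\<lambda>z. (radius p z, direction p z)) \<in> gauss 1 {..<p} \<rightarrow>\<^sub>M borel \<Otimes>\<^sub>M vec_borel p" by measurable
  have "emeasure (distr (gauss 1 {..<p}) (borel \<Otimes>\<^sub>M vec_borel p) (\<lambda>z. (radius p z, direction p z))) (A \<times> B)
     = (\<integral>\<^sup>+z. indicator A (radius p z) * indicator ?D z \<partial>gauss 1 {..<p})"
  proof -
    have "emeasure (distr (gauss 1 {..<p}) (borel \<Otimes>\<^sub>M vec_borel p) (\<lambda>z. (radius p z, direction p z))) (A \<times> B)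
      = (\<integral>\<^sup>+z. indicator (A \<times> B) (radius p z, direction p z) \<partial>gauss 1 {..<p})"
      by (subst nn_integral_distr[OF rd, symmetric]) auto
    also have "\<dots> = (\<integral>\<^sup>+z. indicator A (radius p z) * indicator ?D z \<partial>gauss 1 {..<p})"
      by (intro nn_integral_cong) (auto simp: indicator_def space_PiM)
    finally show ?thesis .
  qed
  also have "\<dots> = (\<integral>\<^sup>+z. indicator ?D z * k (L2_set z {..<p}) \<partial>lebesgue_vec p)"
    by (subst nn_integral_gauss) (auto simp: k_def radius_def mult_ac)
  also have "\<dots> = emeasure (sphere_uniform p) B * (\<integral>\<^sup>+z. k (L2_set z {..<p}) \<partial>lebesgue_vec p)"
    by (rule nn_integral_cone[OF p B k])
  finally show "emeasure (distr (gauss 1 {..<p}) borel (radius p)) A * emeasure (sphere_uniform p) B =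
    emeasure (distr (gauss 1 {..<p}) (borel \<Otimes>\<^sub>M vec_borel p) (\<lambda>z. (radius p z, direction p z))) (A \<times> B)"
    unfolding 1 by (simp add: mult.commute)
qed

lemma sets_sphere_uniform [measurable_cong, simp]: "sets (sphere_uniform p) = sets (vec_borel p)"
  by (simp add: sphere_uniform_def)

lemma space_sphere_uniform [simp]: "space (sphere_uniform p) = space (vec_borel p)"
  by (simp add: sphere_uniform_def)

text \<open>By independence the radius may be taken from a fresh Gaussian vector while the direction
  is uniform. In this form radial moments factor out, and convexity can be used in the radius for a
  fixed direction.\<close>

lemma nn_integral_gauss_polar:
  assumes p: "p > 0" and f[measurable]: "f \<in> borel_measurable (vec_borel p)"
  shows "(\<integral>\<^sup>+z. f z \<partial>gauss 1 {..<p}) =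
    (\<integral>\<^sup>+b. (\<integral>\<^sup>+z. f (scale_vec p (radius p z) b) \<partial>gauss 1 {..<p}) \<partial>sphere_uniform p)"
proof -
  interpret G: prob_space "gauss 1 {..<p}" by (rule prob_space_gauss) simp
  interpret S: prob_space "sphere_uniform p" by (rule prob_space_sphere_uniform)
  have r[measurable]: "radius p \<in> borel_measurable (gauss 1 {..<p})" by measurable
  interpret R: prob_space "distr (gauss 1 {..<p}) borel (radius p)" by (rule G.prob_space_distr[OF r])
  interpret P: pair_prob_space "distr (gauss 1 {..<p}) borel (radius p)" "sphere_uniform p" ..
  have rd: "(\<lambda>z. (radius p z, direction p z)) \<in> gauss 1 {..<p} \<rightarrow>\<^sub>M borel \<Otimes>\<^sub>M vec_borel p" by measurable
  let ?F = "\<lambda>(r, b). f (scale_vec p r b)"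
  have F: "?F \<in> borel_measurable (borel \<Otimes>\<^sub>M vec_borel p)"
    using measurable_compose[OF measurable_scale_vec f] by (simp add: case_prod_unfold)
  have "(\<integral>\<^sup>+z. f z \<partial>gauss 1 {..<p}) = (\<integral>\<^sup>+z. ?F (radius p z, direction p z) \<partial>gauss 1 {..<p})"
    by (intro nn_integral_cong) (simp add: scale_vec_polar[OF p] space_PiM)
  also have "\<dots> = (\<integral>\<^sup>+x. ?F x \<partial>(distr (gauss 1 {..<p}) borel (radius p) \<Otimes>\<^sub>M sphere_uniform p))"
    unfolding gauss_polar_pair[OF p] by (subst nn_integral_distr[OF rd]) (use F in simp_all)
  also have "\<dots> = (\<integral>\<^sup>+b. (\<integral>\<^sup>+r. ?F (r, b) \<partial>distr (gauss 1 {..<p}) borel (radius p)) \<partial>sphere_uniform p)"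
    using F by (intro P.nn_integral_snd[symmetric]) (simp cong: measurable_cong_sets add: sets_pair_measure_cong[OF sets_distr sets_sphere_uniform])
  also have "\<dots> = (\<integral>\<^sup>+b. (\<integral>\<^sup>+z. f (scale_vec p (radius p z) b) \<partial>gauss 1 {..<p}) \<partial>sphere_uniform p)"
  proof (intro nn_integral_cong)
    fix b assume "b \<in> space (sphere_uniform p)"
    then have "(\<lambda>r. ?F (r, b)) \<in> borel_measurable borel"
      using F by (intro measurable_compose[OF measurable_Pair2' F]) auto
    then show "(\<integral>\<^sup>+r. ?F (r, b) \<partial>distr (gauss 1 {..<p}) borel (radius p)) =
       (\<integral>\<^sup>+z. f (scale_vec p (radius p z) b) \<partial>gauss 1 {..<p})"
      by (subst nn_integral_distr[OF r]) auto
  qed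
  finally show ?thesis .
qed

section \<open>Moments of the uniform distribution on the sphere\<close>

lemma radius_sq: "(radius p z)\<^sup>2 = (\<Sum>i<p. (z i)\<^sup>2) / real p"
  by (simp add: radius_def L2_set_def power_divide sum_nonneg)

lemma radius_nonneg: "0 \<le> radius p z"
  by (simp add: radius_def L2_set_nonneg)

context
  fixes p :: nat
  assumes p: "p > 0"
begin

lemma nn_integral_quad_form:
  assumes "\<And>z. 0 \<le> (\<Sum>i<p. \<Sum>j<p. B i j * (z i * z j :: real))"
  shows "(\<integral>\<^sup>+z. ennreal (\<Sum>i<p. \<Sum>j<p. B i j * (z i * z j)) \<partial>gauss 1 {..<p}) = ennreal (\<Sum>i<p. B i i)"
  by (subst nn_integral_eq_integral) (use assms in \<open>auto simp: gauss_quad_form\<close>)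

lemma nn_integral_quad_form_sq:
  assumes "\<And>i j. B i j = (B j i :: real)"
  shows "(\<integral>\<^sup>+z. ennreal ((\<Sum>i<p. \<Sum>j<p. B i j * (z i * z j))\<^sup>2) \<partial>gauss 1 {..<p}) =
    ennreal ((\<Sum>i<p. B i i)\<^sup>2 + 2 * (\<Sum>i<p. \<Sum>j<p. (B i j)\<^sup>2))"
  by (subst nn_integral_eq_integral) (use assms in \<open>auto simp: gauss_quad_form_sq\<close>)

lemma radius_sq_quad_form:
  "(radius p z)\<^sup>2 = (\<Sum>i<p. \<Sum>j<p. (if i = j then 1 / real p else 0) * (z i * z j))"
proof -
  have "(\<Sum>i<p. \<Sum>j<p. (if i = j then 1 / real p else 0) * (z i * z j))
      = (\<Sum>i<p. \<Sum>j<p. if i = j then z i * z j / real p else 0)"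
    by (intro sum.cong) auto
  then show ?thesis
    unfolding radius_sq by (simp add: sum_divide_distrib power2_eq_square)
qed

lemma sum_diag: "(\<Sum>i<p. (if i = i then 1 / real p else 0)) = 1"
  "(\<Sum>i<p. \<Sum>j<p. (if i = j then 1 / real p else 0)\<^sup>2) = 1 / real p"
proof -
  have "(\<Sum>i<p. \<Sum>j<p. (if i = j then 1 / real p else 0)\<^sup>2) = (\<Sum>i<p. \<Sum>j<p. (if i = j then (1 / real p)\<^sup>2 else 0))"
    by (intro sum.cong) auto
  then show "(\<Sum>i<p. \<Sum>j<p. (if i = j then 1 / real p else 0)\<^sup>2) = 1 / real p"
    using p by (simp add: power2_eq_square)
qed (use p in simp)

lemma nn_integral_radius_sq: "(\<integral>\<^sup>+z. ennreal ((radius p z)\<^sup>2) \<partial>gauss 1 {..<p}) = 1"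
  unfolding radius_sq_quad_form
  by (subst nn_integral_quad_form) (simp_all only: radius_sq_quad_form[symmetric] sum_diag zero_le_power2 ennreal_1)

lemma nn_integral_radius_pow4:
  "(\<integral>\<^sup>+z. ennreal (((radius p z)\<^sup>2)\<^sup>2) \<partial>gauss 1 {..<p}) = ennreal (1 + 2 / real p)"
  unfolding radius_sq_quad_form
  by (subst nn_integral_quad_form_sq) (simp_all only: sum_diag, auto)

lemma nn_integral_radius_variance:
  "(\<integral>\<^sup>+z. ennreal (((radius p z)\<^sup>2 - 1)\<^sup>2) \<partial>gauss 1 {..<p}) = ennreal (2 / real p)"
  using gauss_quad_form_variance[of 1 "{..<p}" "\<lambda>i j. if i = j then 1 / real p else 0"]
  unfolding radius_sq_quad_form by (simp only: sum_diag) auto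

lemma quad_form_scale:
  "(\<Sum>i<p. \<Sum>j<p. B i j * (scale_vec p r b i * scale_vec p r b j)) =
    r\<^sup>2 * (\<Sum>i<p. \<Sum>j<p. B i j * (b i * b j :: real))"
  unfolding sum_distrib_left
  by (intro sum.cong refl) (simp add: scale_vec_def power2_eq_square mult_ac)

text \<open>A quadratic form is homogeneous of degree 2 and the squared radius has mean 1, so the
  Gaussian and the spherical means coincide.\<close>

lemma sphere_quad_form:
  assumes nn: "\<And>z. 0 \<le> (\<Sum>i<p. \<Sum>j<p. B i j * (z i * z j :: real))"
  shows "(\<integral>\<^sup>+b. ennreal (\<Sum>i<p. \<Sum>j<p. B i j * (b i * b j)) \<partial>sphere_uniform p) = ennreal (\<Sum>i<p. B i i)"
proof -
  let ?Q = "\<lambda>z. \<Sum>i<p. \<Sum>j<p. B i j * (z i * z j)"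
  have "ennreal (\<Sum>i<p. B i i) = (\<integral>\<^sup>+z. ennreal (?Q z) \<partial>gauss 1 {..<p})"
    by (rule nn_integral_quad_form[OF nn, symmetric])
  also have "\<dots> = (\<integral>\<^sup>+b. (\<integral>\<^sup>+z. ennreal ((radius p z)\<^sup>2) * ennreal (?Q b) \<partial>gauss 1 {..<p}) \<partial>sphere_uniform p)"
    by (subst nn_integral_gauss_polar[OF p]) (auto simp: quad_form_scale ennreal_mult nn)
  also have "\<dots> = (\<integral>\<^sup>+b. ennreal (?Q b) \<partial>sphere_uniform p)"
    by (subst nn_integral_multc) (auto simp: nn_integral_radius_sq)
  finally show ?thesis ..
qed

text \<open>The means agree, and the Gaussian second moment is the spherical one times 1 + 2 / p,
  which is at least 1. Hence the spherical variance is at most the Gaussian one.\<close>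

lemma sphere_quad_form_variance:
  assumes nn: "\<And>z. 0 \<le> (\<Sum>i<p. \<Sum>j<p. B i j * (z i * z j :: real))"
    and sym: "\<And>i j. B i j = B j i"
  shows "(\<integral>\<^sup>+b. ennreal (((\<Sum>i<p. \<Sum>j<p. B i j * (b i * b j)) - (\<Sum>i<p. B i i))\<^sup>2) \<partial>sphere_uniform p)
     \<le> ennreal (2 * (\<Sum>i<p. \<Sum>j<p. (B i j)\<^sup>2))"
proof -
  let ?Q = "\<lambda>z. \<Sum>i<p. \<Sum>j<p. B i j * (z i * z j)"
  interpret S: prob_space "sphere_uniform p" by (rule prob_space_sphere_uniform)
  define T where "T = (\<Sum>i<p. B i i)"
  define F where "F = (\<Sum>i<p. \<Sum>j<p. (B i j)\<^sup>2)"
  define V where "V = (\<integral>\<^sup>+b. ennreal ((?Q b - T)\<^sup>2) \<partial>sphere_uniform p)"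
  define S where "S = (\<integral>\<^sup>+b. ennreal ((?Q b)\<^sup>2) \<partial>sphere_uniform p)"
  have F: "0 \<le> F" by (simp add: F_def sum_nonneg)
  have "0 \<le> ?Q (\<lambda>j. if j = i then 1 else 0)" for i by (rule nn)
  then have "0 \<le> B i i" if "i < p" for i
  proof -
    have "?Q (\<lambda>j. if j = i then 1 else 0) = (\<Sum>k<p. \<Sum>j<p. if j = i then (if k = i then B k j else 0) else 0)"
      by (intro sum.cong refl) auto
    also have "\<dots> = B i i" using that by simp
    finally show ?thesis using nn[of "\<lambda>j. if j = i then 1 else 0"] by simp
  qed
  then have T: "0 \<le> T" unfolding T_def by (intro sum_nonneg) auto
  have "ennreal (T\<^sup>2 + 2 * F) = (\<integral>\<^sup>+z. ennreal ((?Q z)\<^sup>2) \<partial>gauss 1 {..<p})"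
    unfolding T_def F_def by (rule nn_integral_quad_form_sq[OF sym, symmetric])
  also have "\<dots> = (\<integral>\<^sup>+b. (\<integral>\<^sup>+z. ennreal (((radius p z)\<^sup>2)\<^sup>2) * ennreal ((?Q b)\<^sup>2) \<partial>gauss 1 {..<p}) \<partial>sphere_uniform p)"
    by (subst nn_integral_gauss_polar[OF p]) (auto simp: quad_form_scale power_mult_distrib ennreal_mult)
  also have "\<dots> = ennreal (1 + 2 / real p) * S"
    unfolding S_def nn_integral_radius_pow4[symmetric]
    by (subst nn_integral_multc) (auto simp: nn_integral_cmult)
  also have "\<dots> \<ge> 1 * S"
    by (intro mult_right_mono) (auto simp: ennreal_1[symmetric] simp del: ennreal_1)
  finally have S_le: "S \<le> ennreal (T\<^sup>2 + 2 * F)" by simp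
  \<comment> \<open>The square is expanded with nonnegative terms on both sides, since
    \<open>ennreal\<close> admits no genuine subtraction. The finite term
    \<open>2 * T\<^sup>2\<close> is cancelled only at the end.\<close>
  have "V + 2 * ennreal T * ennreal T = (\<integral>\<^sup>+b. ennreal ((?Q b - T)\<^sup>2) + 2 * ennreal T * ennreal (?Q b) \<partial>sphere_uniform p)"
    unfolding V_def by (subst nn_integral_add) (auto simp: nn_integral_cmult sphere_quad_form[OF nn] T_def)
  also have "\<dots> = (\<integral>\<^sup>+b. ennreal ((?Q b)\<^sup>2) + ennreal (T\<^sup>2) \<partial>sphere_uniform p)"
  proof (intro nn_integral_cong)
    fix b
    have "ennreal ((?Q b - T)\<^sup>2) + 2 * ennreal T * ennreal (?Q b) = ennreal ((?Q b - T)\<^sup>2 + 2 * T * ?Q b)"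
      using T nn[of b] by (simp add: ennreal_mult)
    also have "(?Q b - T)\<^sup>2 + 2 * T * ?Q b = (?Q b)\<^sup>2 + T\<^sup>2"
      by (simp add: power2_eq_square algebra_simps)
    finally show "ennreal ((?Q b - T)\<^sup>2) + 2 * ennreal T * ennreal (?Q b) = ennreal ((?Q b)\<^sup>2) + ennreal (T\<^sup>2)"
      by simp
  qed
  also have "\<dots> = S + ennreal (T\<^sup>2)"
    unfolding S_def by (subst nn_integral_add) (auto simp: S.emeasure_space_1[simplified])
  also have "\<dots> \<le> ennreal (T\<^sup>2 + 2 * F) + ennreal (T\<^sup>2)"
    by (intro add_right_mono S_le)
  also have "\<dots> = ennreal (T\<^sup>2 + 2 * F + T\<^sup>2)"
    using F by (intro ennreal_plus[symmetric]) auto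
  also have "T\<^sup>2 + 2 * F + T\<^sup>2 = 2 * F + 2 * T\<^sup>2"
    by simp
  also have "ennreal (2 * F + 2 * T\<^sup>2) = ennreal (2 * F) + ennreal (2 * T\<^sup>2)"
    using F by (intro ennreal_plus) auto
  finally have "V + ennreal (2 * T\<^sup>2) \<le> ennreal (2 * F) + ennreal (2 * T\<^sup>2)"
    using T by (simp add: ennreal_mult power2_eq_square mult.assoc)
  then have "V \<le> ennreal (2 * F)"
    by (simp add: ennreal_add_left_cancel_le add.commute)
  then show ?thesis unfolding V_def T_def F_def .
qed

end

section \<open>The Gaussian partition function\<close>

text \<open>The list is reversed because \<open>resolvent\<close> adds the head of its list last;
  going from k to k + 1 columns is then a single cons.\<close>

definition pivot :: "nat \<Rightarrow> real \<Rightarrow> (nat \<times> nat \<Rightarrow> real) \<Rightarrow> nat \<Rightarrow> real" where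
  "pivot N \<Delta> A k = dot N (col A k) (mv N (resolvent N \<Delta> A (rev [0..<k])) (col A k))"

definition resolvent_form :: "nat \<Rightarrow> real \<Rightarrow> nat \<Rightarrow> (nat \<times> nat \<Rightarrow> real) \<Rightarrow> (nat \<Rightarrow> real) \<Rightarrow> real" where
  "resolvent_form N \<Delta> p A v = dot N v (mv N (resolvent N \<Delta> A (rev [0..<p])) v)"

text \<open>By the matrix determinant lemma, applied column by column, the sum over pivots is ln det
  (I + x x^T / \<Delta>).\<close>

definition log_gauss_partition ::
    "nat \<Rightarrow> real \<Rightarrow> nat \<Rightarrow> (nat \<times> nat \<Rightarrow> real) \<Rightarrow> (nat \<Rightarrow> real) \<Rightarrow> real" where
  "log_gauss_partition N \<Delta> p A v =
     - (1 / 2) * (\<Sum>k<p. ln (1 + pivot N \<Delta> A k / \<Delta>)) - resolvent_form N \<Delta> p A v / (2 * \<Delta>)"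

lemma rev_upt_Suc: "rev [0..<Suc k] = k # rev [0..<k]"
  by simp

lemma residual_norm_sq:
  "(residual_norm N p A v b)\<^sup>2 =
    dot N (\<lambda>i. v i - (\<Sum>k<p. A (i, k) * b k)) (\<lambda>i. v i - (\<Sum>k<p. A (i, k) * b k))"
  by (simp add: residual_norm_def L2_set_def sum_nonneg mat_vec_def dot_def power2_eq_square)

lemma pivot_nonneg: "\<Delta> > 0 \<Longrightarrow> 0 \<le> pivot N \<Delta> A k"
  unfolding pivot_def by (rule dot_resolvent_nonneg) auto

lemma gauss_integral_1d:
  fixes P Q R \<Delta> :: real
  assumes \<Delta>: "\<Delta> > 0" and R: "R \<ge> 0"
  shows "(\<integral>\<^sup>+b. ennreal (exp (- (P - 2 * b * Q + b\<^sup>2 * R) / (2 * \<Delta>))) \<partial>density lborel (normal_density 0 1))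
    = ennreal (exp (- (1 / 2) * ln (1 + R / \<Delta>) - (P - Q\<^sup>2 / (\<Delta> + R)) / (2 * \<Delta>)))"
proof -
  \<comment> \<open>Completing the square: \<open>m\<close> and \<open>s\<close> are the posterior
    mean and standard deviation of the single coordinate b.\<close>
  define m where "m = Q / (\<Delta> + R)"
  define s where "s = sqrt (\<Delta> / (\<Delta> + R))"
  define K where "K = exp (- (1 / 2) * ln (1 + R / \<Delta>) - (P - Q\<^sup>2 / (\<Delta> + R)) / (2 * \<Delta>))"
  have s: "s > 0" "s\<^sup>2 = \<Delta> / (\<Delta> + R)" using \<Delta> R by (auto simp: s_def)
  have sl: "s = exp (- (1 / 2) * ln (1 + R / \<Delta>))"
  proof -
    have "1 + R / \<Delta> = (\<Delta> + R) / \<Delta>" using \<Delta> by (simp add: field_simps)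
    then have "- (1 / 2) * ln (1 + R / \<Delta>) = (1 / 2) * ln (\<Delta> / (\<Delta> + R))"
      using \<Delta> R by (simp add: ln_div) (simp add: field_simps)
    also have "\<dots> = ln s" unfolding s_def using \<Delta> R by (simp add: ln_sqrt)
    finally show ?thesis using s by simp
  qed
  have eq: "normal_density 0 1 b * exp (- (P - 2 * b * Q + b\<^sup>2 * R) / (2 * \<Delta>)) = K * normal_density m s b" for b
  proof -
    have "- b\<^sup>2 / 2 + - (P - 2 * b * Q + b\<^sup>2 * R) / (2 * \<Delta>) =
        - (P - Q\<^sup>2 / (\<Delta> + R)) / (2 * \<Delta>) + - (b - m)\<^sup>2 / (2 * s\<^sup>2)"
    proof -
      have "\<Delta> + R \<noteq> 0" using \<Delta> R by linarith
      then show ?thesis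
        unfolding s(2) m_def using \<Delta>
        by (simp add: divide_simps power2_eq_square) (simp add: algebra_simps)
    qed
    then have "exp (- b\<^sup>2 / 2) * exp (- (P - 2 * b * Q + b\<^sup>2 * R) / (2 * \<Delta>)) =
      exp (- (P - Q\<^sup>2 / (\<Delta> + R)) / (2 * \<Delta>)) * exp (- (b - m)\<^sup>2 / (2 * s\<^sup>2))"
      unfolding exp_add[symmetric] by simp
    moreover have "K = s * exp (- (P - Q\<^sup>2 / (\<Delta> + R)) / (2 * \<Delta>))"
      unfolding K_def sl by (subst exp_add[symmetric]) (simp add: diff_divide_distrib)
    ultimately show ?thesis
      using s(1) by (simp add: normal_density_def real_sqrt_mult field_simps)
  qed
  have "(\<integral>\<^sup>+b. ennreal (exp (- (P - 2 * b * Q + b\<^sup>2 * R) / (2 * \<Delta>))) \<partial>density lborel (normal_density 0 1))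
    = (\<integral>\<^sup>+b. ennreal K * ennreal (normal_density m s b) \<partial>lborel)"
  proof (subst nn_integral_density)
    have "K \<ge> 0" by (simp add: K_def)
    then show "(\<integral>\<^sup>+b. ennreal (normal_density 0 1 b) * ennreal (exp (- (P - 2 * b * Q + b\<^sup>2 * R) / (2 * \<Delta>))) \<partial>lborel)
      = (\<integral>\<^sup>+b. ennreal K * ennreal (normal_density m s b) \<partial>lborel)"
      by (simp only: ennreal_mult[symmetric] normal_density_nonneg exp_ge_zero eq)
  qed measurable
  also have "\<dots> = ennreal K"
    using prob_space.emeasure_space_1[OF prob_space_normal_density[OF s(1), of m]]
    by (simp add: nn_integral_cmult emeasure_density)
  finally show ?thesis unfolding K_def .
qed

lemma residual_measurable [measurable]:
  "(\<lambda>b. residual_norm N p A v b) \<in> borel_measurable (vec_borel p)"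
  unfolding residual_norm_def mat_vec_def L2_set_def by measurable

text \<open>Fixing the newest coordinate at b only shifts the observation by -b times the newest
  column, hence the induction over arbitrary \<open>v\<close>. What remains is a one-dimensional
  Gaussian integral, and its value is the next pivot together with the Sherman-Morrison update of
  the form.\<close>

lemma gauss_partition:
  assumes \<Delta>: "\<Delta> > 0"
  shows "(\<integral>\<^sup>+z. ennreal (exp (- (1 / (2 * \<Delta>)) * (residual_norm N p A v z)\<^sup>2)) \<partial>gauss 1 {..<p})
    = ennreal (exp (log_gauss_partition N \<Delta> p A v))"
proof (induction p arbitrary: v)
  case 0
  interpret G: prob_space "gauss 1 ({} :: nat set)" by (rule prob_space_gauss) simp
  have "resolvent_form N \<Delta> 0 A v = dot N v v"
    unfolding resolvent_form_def
    by (intro dot_cong) (auto simp: mv_def if_distrib[of "\<lambda>x. x * _"] cong: if_cong)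
  then show ?case
    using G.emeasure_space_1 by (simp add: residual_norm_sq log_gauss_partition_def)
next
  case (Suc p)
  interpret product_sigma_finite "\<lambda>_::nat. density lborel (normal_density 0 1)"
    by (rule product_sigma_finite_gauss) simp
  let ?x = "col A p" and ?G = "resolvent N \<Delta> A (rev [0..<p])"
  let ?S = "\<Sum>k<p. ln (1 + pivot N \<Delta> A k / \<Delta>)"
  let ?f = "\<lambda>n v z. ennreal (exp (- (1 / (2 * \<Delta>)) * (residual_norm N n A v z)\<^sup>2))"
  have ins: "{..<Suc p} = insert p {..<p}" by auto
  have res: "residual_norm N (Suc p) A v (z(p := b)) = residual_norm N p A (\<lambda>i. v i - b * ?x i) z" for z b
    unfolding residual_norm_def mat_vec_def
    by (intro L2_set_cong refl) (auto simp: col_def algebra_simps intro!: sum.cong)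
  have "(\<integral>\<^sup>+z. ?f (Suc p) v z \<partial>gauss 1 {..<Suc p}) =
    (\<integral>\<^sup>+b. (\<integral>\<^sup>+z. ?f (Suc p) v (z(p := b)) \<partial>gauss 1 {..<p}) \<partial>density lborel (normal_density 0 1))"
    unfolding ins by (rule product_nn_integral_insert_rev) (auto simp: ins[symmetric])
  also have "\<dots> = (\<integral>\<^sup>+b. ennreal (exp (log_gauss_partition N \<Delta> p A (\<lambda>i. v i - b * ?x i))) \<partial>density lborel (normal_density 0 1))"
    unfolding res Suc.IH ..
  also have "\<dots> = (\<integral>\<^sup>+b. ennreal (exp (- (1 / 2) * ?S)) * ennreal (exp (- (resolvent_form N \<Delta> p A v
       - 2 * b * dot N ?x (mv N ?G v) + b\<^sup>2 * pivot N \<Delta> A p) / (2 * \<Delta>))) \<partial>density lborel (normal_density 0 1))"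
  proof (intro nn_integral_cong)
    fix b
    have mvl: "mv N ?G (\<lambda>i. v i - b * ?x i) = (\<lambda>i. mv N ?G v i - b * mv N ?G ?x i)"
      by (rule ext) (simp add: mv_def algebra_simps sum_subtractf sum_distrib_left)
    have "resolvent_form N \<Delta> p A (\<lambda>i. v i - b * ?x i) =
      resolvent_form N \<Delta> p A v - b * dot N v (mv N ?G ?x) - b * dot N ?x (mv N ?G v) + b\<^sup>2 * pivot N \<Delta> A p"
      unfolding resolvent_form_def pivot_def mvl
      by (simp only: dot_diff_left dot_diff_right dot_scale_left dot_scale_right)
        (simp add: algebra_simps power2_eq_square)
    moreover have "dot N v (mv N ?G ?x) = dot N ?x (mv N ?G v)"
      by (subst dot_resolvent_sym) (rule dot_commute)
    ultimately have eq: "resolvent_form N \<Delta> p A (\<lambda>i. v i - b * ?x i) =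
      resolvent_form N \<Delta> p A v - 2 * b * dot N ?x (mv N ?G v) + b\<^sup>2 * pivot N \<Delta> A p"
      by simp
    have "log_gauss_partition N \<Delta> p A (\<lambda>i. v i - b * ?x i) = - (1 / 2) * ?S +
      - (resolvent_form N \<Delta> p A v - 2 * b * dot N ?x (mv N ?G v) + b\<^sup>2 * pivot N \<Delta> A p) / (2 * \<Delta>)"
      unfolding log_gauss_partition_def eq by (simp only: diff_conv_add_uminus minus_divide_left)
    then show "ennreal (exp (log_gauss_partition N \<Delta> p A (\<lambda>i. v i - b * ?x i))) =
      ennreal (exp (- (1 / 2) * ?S)) * ennreal (exp (- (resolvent_form N \<Delta> p A v
       - 2 * b * dot N ?x (mv N ?G v) + b\<^sup>2 * pivot N \<Delta> A p) / (2 * \<Delta>)))"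
      by (simp only: exp_add ennreal_mult exp_ge_zero)
  qed
  also have "\<dots> = ennreal (exp (- (1 / 2) * ?S)) * ennreal (exp (- (1 / 2) * ln (1 + pivot N \<Delta> A p / \<Delta>) -
       (resolvent_form N \<Delta> p A v - (dot N ?x (mv N ?G v))\<^sup>2 / (\<Delta> + pivot N \<Delta> A p)) / (2 * \<Delta>)))"
    by (subst nn_integral_cmult) (auto simp only: gauss_integral_1d[OF \<Delta> pivot_nonneg[OF \<Delta>]], measurable)
  also have "\<dots> = ennreal (exp (log_gauss_partition N \<Delta> (Suc p) A v))"
  proof -
    have "mv N (resolvent N \<Delta> A (p # rev [0..<p])) v = (\<lambda>i. mv N ?G v i -
       dot N ?x (mv N ?G v) / (\<Delta> + pivot N \<Delta> A p) * mv N ?G ?x i)"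
      unfolding pivot_def by (rule ext) (rule mv_resolvent_Cons)
    moreover have "dot N v (mv N ?G ?x) = dot N ?x (mv N ?G v)"
      by (subst dot_resolvent_sym) (rule dot_commute)
    ultimately have "resolvent_form N \<Delta> (Suc p) A v =
      resolvent_form N \<Delta> p A v - (dot N ?x (mv N ?G v))\<^sup>2 / (\<Delta> + pivot N \<Delta> A p)"
      unfolding resolvent_form_def rev_upt_Suc power2_eq_square
      by (simp only: dot_diff_right dot_scale_right) simp
    then have "log_gauss_partition N \<Delta> (Suc p) A v = - (1 / 2) * ?S + (- (1 / 2) * ln (1 + pivot N \<Delta> A p / \<Delta>) -
       (resolvent_form N \<Delta> p A v - (dot N ?x (mv N ?G v))\<^sup>2 / (\<Delta> + pivot N \<Delta> A p)) / (2 * \<Delta>))"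
      unfolding log_gauss_partition_def by (simp add: add_divide_distrib)
    then show ?thesis
      by (simp only: exp_add ennreal_mult exp_ge_zero)
  qed
  finally show ?case .
qed

section \<open>Measurability\<close>

lemma measurable_residual_norm [measurable (raw)]:
  assumes [measurable]: "f \<in> M \<rightarrow>\<^sub>M mat_borel N p" "g \<in> M \<rightarrow>\<^sub>M vec_borel N" "h \<in> M \<rightarrow>\<^sub>M vec_borel p"
  shows "(\<lambda>x. residual_norm N p (f x) (g x) (h x)) \<in> borel_measurable M"
proof -
  have "(\<lambda>x. g x i - (\<Sum>j<p. f x (i, j) * h x j)) \<in> borel_measurable M" if "i < N" for i
  proof -
    have [measurable]: "(\<lambda>x. f x (i, j)) \<in> borel_measurable M" if "j < p" for j
      by (rule measurable_compose[OF assms(1) measurable_component_singleton]) (use that \<open>i < N\<close> in auto)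
    have [measurable]: "(\<lambda>x. g x i) \<in> borel_measurable M"
      by (rule measurable_compose[OF assms(2) measurable_component_singleton]) (use \<open>i < N\<close> in auto)
    have [measurable]: "(\<lambda>x. h x j) \<in> borel_measurable M" if "j < p" for j
      by (rule measurable_compose[OF assms(3) measurable_component_singleton]) (use that in auto)
    show ?thesis by (intro borel_measurable_diff borel_measurable_sum borel_measurable_times) auto
  qed
  then show ?thesis
    unfolding residual_norm_def L2_set_def mat_vec_def
    by (intro measurable_compose[OF _ borel_measurable_sqrt] borel_measurable_sum borel_measurable_power) auto
qed

lemma measurable_partition_function [measurable (raw)]:
  assumes [measurable]: "f \<in> M \<rightarrow>\<^sub>M mat_borel N p" "g \<in> M \<rightarrow>\<^sub>M vec_borel N"
  shows "(\<lambda>x. partition_function \<Delta> N p (f x) (g x)) \<in> borel_measurable M"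
proof -
  interpret S: prob_space "sphere_uniform p" by (rule prob_space_sphere_uniform)
  have [measurable]: "snd \<in> M \<Otimes>\<^sub>M sphere_uniform p \<rightarrow>\<^sub>M vec_borel p"
    using measurable_snd[of M "sphere_uniform p"]
    unfolding measurable_cong_sets[OF refl sets_sphere_uniform] .
  show ?thesis
    unfolding partition_function_def
    by (rule S.borel_measurable_lebesgue_integral) (simp add: case_prod_unfold)
qed

lemma measurable_resolvent:
  assumes f: "f \<in> M \<rightarrow>\<^sub>M mat_borel N p"
  shows "set ks \<subseteq> {..<p} \<Longrightarrow> i < N \<Longrightarrow> j < N \<Longrightarrow> (\<lambda>x. resolvent N \<Delta> (f x) ks i j) \<in> borel_measurable M"
proof (induction ks arbitrary: i j)
  case (Cons k ks)
  have [measurable]: "(\<lambda>x. f x (i, k)) \<in> borel_measurable M" if "i < N" for i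
    by (rule measurable_compose[OF f measurable_component_singleton]) (use that Cons in auto)
  have mv[measurable]: "(\<lambda>x. mv N (resolvent N \<Delta> (f x) ks) (col (f x) k) i) \<in> borel_measurable M"
    if "i < N" for i
    unfolding mv_def col_def
    by (intro borel_measurable_sum borel_measurable_times Cons) (use Cons that in auto)
  have "(\<lambda>x. dot N (col (f x) k) (mv N (resolvent N \<Delta> (f x) ks) (col (f x) k))) \<in> borel_measurable M"
    unfolding dot_def by (intro borel_measurable_sum borel_measurable_times) (auto simp: col_def)
  then show ?case
    using Cons by (auto intro!: borel_measurable_diff borel_measurable_divide borel_measurable_times borel_measurable_add)
qed simp

lemma measurable_dot:
  assumes "\<And>i. i < N \<Longrightarrow> (\<lambda>x. u x i) \<in> borel_measurable M" "\<And>i. i < N \<Longrightarrow> (\<lambda>x. v x i) \<in> borel_measurable M"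
  shows "(\<lambda>x. dot N (u x) (v x)) \<in> borel_measurable M"
  unfolding dot_def by (intro borel_measurable_sum borel_measurable_times assms) auto

lemma measurable_mv_resolvent:
  assumes f: "f \<in> M \<rightarrow>\<^sub>M mat_borel N p" and "set ks \<subseteq> {..<p}" "i < N"
    and u: "\<And>i. i < N \<Longrightarrow> (\<lambda>x. u x i) \<in> borel_measurable M"
  shows "(\<lambda>x. mv N (resolvent N \<Delta> (f x) ks) (u x) i) \<in> borel_measurable M"
  unfolding mv_def
  by (intro borel_measurable_sum borel_measurable_times measurable_resolvent[OF f] u) (use assms in auto)

lemma measurable_col:
  assumes f: "f \<in> M \<rightarrow>\<^sub>M mat_borel N p" and "k < p" "i < N"
  shows "(\<lambda>x. col (f x) k i) \<in> borel_measurable M"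
  unfolding col_def
  by (rule measurable_compose[OF f measurable_component_singleton]) (use assms in auto)

lemma measurable_vec_component:
  assumes f: "f \<in> M \<rightarrow>\<^sub>M vec_borel N" and "i < N"
  shows "(\<lambda>x. f x i) \<in> borel_measurable M"
  by (rule measurable_compose[OF f measurable_component_singleton]) (use assms in auto)

lemma measurable_resolvent_form [measurable (raw)]:
  assumes f: "f \<in> M \<rightarrow>\<^sub>M mat_borel N p" and g: "g \<in> M \<rightarrow>\<^sub>M vec_borel N"
  shows "(\<lambda>x. resolvent_form N \<Delta> p (f x) (g x)) \<in> borel_measurable M"
  unfolding resolvent_form_def
  by (intro measurable_dot measurable_mv_resolvent[OF f] measurable_vec_component[OF g]) auto

lemma measurable_pivot:
  assumes f: "f \<in> M \<rightarrow>\<^sub>M mat_borel N p" and "k < p"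
  shows "(\<lambda>x. pivot N \<Delta> (f x) k) \<in> borel_measurable M"
  unfolding pivot_def
  by (intro measurable_dot measurable_mv_resolvent[OF f] measurable_col[OF f]) (use assms in auto)

lemma measurable_log_gauss_partition [measurable (raw)]:
  assumes f[measurable]: "f \<in> M \<rightarrow>\<^sub>M mat_borel N p" and g[measurable]: "g \<in> M \<rightarrow>\<^sub>M vec_borel N"
  shows "(\<lambda>x. log_gauss_partition N \<Delta> p (f x) (g x)) \<in> borel_measurable M"
proof -
  have [measurable]: "(\<lambda>x. \<Sum>k<p. ln (1 + pivot N \<Delta> (f x) k / \<Delta>)) \<in> borel_measurable M"
    by (intro borel_measurable_sum borel_measurable_ln borel_measurable_add borel_measurable_divide
        measurable_pivot[OF f]) auto
  show ?thesis
    unfolding log_gauss_partition_def by measurable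
qed

section \<open>Comparison of the partition functions\<close>

text \<open>The model prescribes \<open>y\<close> only at indices below N. Restricting to these
  indices gives an element of \<open>vec_borel N\<close> that is a measurable function of design,
  signal and noise.\<close>

definition observation ::
    "nat \<Rightarrow> nat \<Rightarrow> real \<Rightarrow> (nat \<times> nat \<Rightarrow> real) \<Rightarrow> (nat \<Rightarrow> real) \<Rightarrow> (nat \<Rightarrow> real) \<Rightarrow> nat \<Rightarrow> real" where
  "observation N p \<Delta> A b e = (\<lambda>i\<in>{..<N}. mat_vec p A b i + sqrt \<Delta> * e i)"

lemma measurable_observation [measurable (raw)]:
  assumes f: "f \<in> M \<rightarrow>\<^sub>M mat_borel N p" and g: "g \<in> M \<rightarrow>\<^sub>M vec_borel p" and h: "h \<in> M \<rightarrow>\<^sub>M vec_borel N"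
  shows "(\<lambda>x. observation N p \<Delta> (f x) (g x) (h x)) \<in> M \<rightarrow>\<^sub>M vec_borel N"
  unfolding observation_def
proof (rule measurable_restrict)
  fix i assume i: "i \<in> {..<N}"
  show "(\<lambda>x. mat_vec p (f x) (g x) i + sqrt \<Delta> * h x i) \<in> borel_measurable M"
    unfolding mat_vec_def
    using i measurable_col[OF f] measurable_vec_component[OF g] measurable_vec_component[OF h]
    by (intro borel_measurable_add borel_measurable_sum borel_measurable_times) (auto simp: col_def)
qed

text \<open>Passing from the noise to the observation as integration variable: the integrand is now
  weighted by the likelihood of w, and the Jacobian \<open>sqrt \<Delta> ^ N\<close> goes into the
  normalising constant.\<close>

lemma nn_integral_gauss_shift:
  assumes \<Delta>: "\<Delta> > 0" and f: "f \<in> borel_measurable (vec_borel N)"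
  shows "(\<integral>\<^sup>+e. f (\<lambda>i\<in>{..<N}. m i + sqrt \<Delta> * e i) \<partial>gauss 1 {..<N}) =
    (\<integral>\<^sup>+w. ennreal ((1 / sqrt (2 * pi * \<Delta>)) ^ N * exp (- (1 / (2 * \<Delta>)) * (\<Sum>i<N. (w i - m i)\<^sup>2))) * f w
      \<partial>lebesgue_vec N)"
proof -
  let ?T = "\<lambda>e. \<lambda>i\<in>{..<N}. m i + sqrt \<Delta> * e i"
  let ?k = "\<lambda>w. (1 / sqrt (2 * pi * \<Delta>)) ^ N * exp (- (1 / (2 * \<Delta>)) * (\<Sum>i<N. (w i - m i)\<^sup>2))"
  have [measurable]: "?T \<in> vec_borel N \<rightarrow>\<^sub>M vec_borel N" by measurable
  have [measurable]: "f \<in> borel_measurable (vec_borel N)" by fact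
  have "(\<integral>\<^sup>+w. ennreal (?k w) * f w \<partial>lebesgue_vec N) =
    ennreal (sqrt \<Delta> ^ N) * (\<integral>\<^sup>+e. ennreal (?k (?T e)) * f (?T e) \<partial>lebesgue_vec N)"
    using \<Delta> by (subst nn_integral_PiM_lborel_affine[where c="sqrt \<Delta>" and m=m]) auto
  also have "\<dots> = (\<integral>\<^sup>+e. ennreal (sqrt \<Delta> ^ N) * (ennreal (?k (?T e)) * f (?T e)) \<partial>lebesgue_vec N)"
    by (intro nn_integral_cmult[symmetric]) (simp cong: measurable_cong_sets add: sets_lebesgue_vec)
  also have "\<dots> = (\<integral>\<^sup>+e. ennreal ((1 / sqrt (2 * pi)) ^ N * exp (- (L2_set e {..<N})\<^sup>2 / 2)) * f (?T e) \<partial>lebesgue_vec N)"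
  proof (intro nn_integral_cong)
    fix e
    have "(\<Sum>i<N. (?T e i - m i)\<^sup>2) = \<Delta> * (L2_set e {..<N})\<^sup>2"
      using \<Delta> by (simp add: L2_set_def sum_nonneg sum_distrib_left power_mult_distrib)
    then have "sqrt \<Delta> ^ N * ?k (?T e) = (1 / sqrt (2 * pi)) ^ N * exp (- (L2_set e {..<N})\<^sup>2 / 2)"
      using \<Delta> by (simp add: real_sqrt_mult power_divide power_mult_distrib)
    then show "ennreal (sqrt \<Delta> ^ N) * (ennreal (?k (?T e)) * f (?T e)) =
      ennreal ((1 / sqrt (2 * pi)) ^ N * exp (- (L2_set e {..<N})\<^sup>2 / 2)) * f (?T e)"
      using \<Delta> by (simp only: mult.assoc[symmetric] ennreal_mult'[symmetric] zero_le_power real_sqrt_ge_zero less_imp_le)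
  qed
  also have "\<dots> = (\<integral>\<^sup>+e. f (?T e) \<partial>gauss 1 {..<N})"
    by (rule nn_integral_gauss[symmetric]) measurable
  finally show ?thesis ..
qed

lemma partition_function_nn_integral:
  assumes \<Delta>: "\<Delta> > 0"
  shows "ennreal (partition_function \<Delta> N p A v) =
      (\<integral>\<^sup>+b. ennreal (exp (- (1 / (2 * \<Delta>)) * (residual_norm N p A v b)\<^sup>2)) \<partial>sphere_uniform p)"
    and "0 < partition_function \<Delta> N p A v" "partition_function \<Delta> N p A v \<le> 1"
    and "integrable (sphere_uniform p) (\<lambda>b. exp (- (1 / (2 * \<Delta>)) * (residual_norm N p A v b)\<^sup>2))"
proof -
  interpret S: prob_space "sphere_uniform p" by (rule prob_space_sphere_uniform)
  let ?E = "\<lambda>b. exp (- (1 / (2 * \<Delta>)) * (residual_norm N p A v b)\<^sup>2)"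
  have le: "?E b \<le> 1" for b using \<Delta> by simp
  show int: "integrable (sphere_uniform p) ?E"
    by (rule S.integrable_const_bound[where B=1]) (use le in auto)
  show "ennreal (partition_function \<Delta> N p A v) = (\<integral>\<^sup>+b. ennreal (?E b) \<partial>sphere_uniform p)"
    unfolding partition_function_def by (rule nn_integral_eq_integral[OF int, symmetric]) simp
  show "0 < partition_function \<Delta> N p A v"
    unfolding partition_function_def
    using S.integral_less_AE_space[of "\<lambda>_. 0" ?E] int S.emeasure_space_1 by simp
  show "partition_function \<Delta> N p A v \<le> 1"
    unfolding partition_function_def
    using integral_mono[OF int, of "\<lambda>_. 1"] le S.prob_space by simp
qed

text \<open>Up to a common constant, the two partition functions are the densities of the observation under
  the spherical and the Gaussian prior; hence the expectation of their ratio is 1.\<close>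

lemma nn_integral_partition_ratio:
  assumes \<Delta>: "\<Delta> > 0" and A: "A \<in> space (mat_borel N p)"
  shows "(\<integral>\<^sup>+b. (\<integral>\<^sup>+e. ennreal (exp (log_gauss_partition N \<Delta> p A (observation N p \<Delta> A b e))
      / partition_function \<Delta> N p A (observation N p \<Delta> A b e)) \<partial>gauss 1 {..<N}) \<partial>sphere_uniform p) = 1"
proof -
  interpret S: prob_space "sphere_uniform p" by (rule prob_space_sphere_uniform)
  interpret GN: prob_space "gauss 1 {..<N}" by (rule prob_space_gauss) simp
  interpret Gp: prob_space "gauss 1 {..<p}" by (rule prob_space_gauss) simp
  interpret LL: product_sigma_finite "\<lambda>_::nat. lborel :: real measure" ..
  interpret L: sigma_finite_measure "lebesgue_vec N" by (rule LL.sigma_finite) simp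
  interpret P1: pair_sigma_finite "lebesgue_vec N" "sphere_uniform p" ..
  interpret P2: pair_sigma_finite "lebesgue_vec N" "gauss 1 {..<p}" ..
  let ?Z = "partition_function \<Delta> N p A" and ?LG = "log_gauss_partition N \<Delta> p A"
  let ?C = "(1 / sqrt (2 * pi * \<Delta>)) ^ N"
  let ?E = "\<lambda>w b. exp (- (1 / (2 * \<Delta>)) * (residual_norm N p A w b)\<^sup>2)"
  let ?f = "\<lambda>w. ennreal (exp (?LG w) / ?Z w)"
  have C: "?C \<ge> 0" using \<Delta> by simp
  have cA[measurable]: "(\<lambda>_. A) \<in> M \<rightarrow>\<^sub>M mat_borel N p" for M :: "'b measure"
    using A by simp
  have idN[measurable]: "(\<lambda>w. w) \<in> vec_borel N \<rightarrow>\<^sub>M vec_borel N" by simp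
  have f[measurable]: "?f \<in> borel_measurable (vec_borel N)" by measurable
  have f'[measurable]: "?f \<in> borel_measurable (lebesgue_vec N)"
    using f by (simp cong: measurable_cong_sets add: sets_lebesgue_vec)
  have [measurable]: "snd \<in> lebesgue_vec N \<Otimes>\<^sub>M sphere_uniform p \<rightarrow>\<^sub>M vec_borel p"
    "fst \<in> lebesgue_vec N \<Otimes>\<^sub>M sphere_uniform p \<rightarrow>\<^sub>M vec_borel N"
    "snd \<in> lebesgue_vec N \<Otimes>\<^sub>M gauss 1 {..<p} \<rightarrow>\<^sub>M vec_borel p"
    "fst \<in> lebesgue_vec N \<Otimes>\<^sub>M gauss 1 {..<p} \<rightarrow>\<^sub>M vec_borel N"
    using measurable_snd[of "lebesgue_vec N" "sphere_uniform p"] measurable_fst[of "lebesgue_vec N" "sphere_uniform p"]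
      measurable_snd[of "lebesgue_vec N" "gauss 1 {..<p}"] measurable_fst[of "lebesgue_vec N" "gauss 1 {..<p}"]
    unfolding measurable_cong_sets[OF refl sets_sphere_uniform] measurable_cong_sets[OF refl sets_gauss]
      measurable_cong_sets[OF refl sets_lebesgue_vec] .
  have E1[measurable]: "(\<lambda>x. ?E (fst x) (snd x)) \<in> borel_measurable (lebesgue_vec N \<Otimes>\<^sub>M sphere_uniform p)"
    by measurable
  have E2[measurable]: "(\<lambda>x. ?E (fst x) (snd x)) \<in> borel_measurable (lebesgue_vec N \<Otimes>\<^sub>M gauss 1 {..<p})"
    by measurable
  have res: "(\<Sum>i<N. (w i - mat_vec p A b i)\<^sup>2) = (residual_norm N p A w b)\<^sup>2" for w b
    by (simp add: residual_norm_def L2_set_def sum_nonneg)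
  have shift: "(\<integral>\<^sup>+e. h (observation N p \<Delta> A b e) \<partial>gauss 1 {..<N}) =
     (\<integral>\<^sup>+w. ennreal (?C * ?E w b) * h w \<partial>lebesgue_vec N)"
    if "h \<in> borel_measurable (vec_borel N)" for h b
    unfolding observation_def nn_integral_gauss_shift[OF \<Delta> that] res ..
  have "(\<integral>\<^sup>+b. (\<integral>\<^sup>+e. ?f (observation N p \<Delta> A b e) \<partial>gauss 1 {..<N}) \<partial>sphere_uniform p) =
    (\<integral>\<^sup>+b. (\<integral>\<^sup>+w. ennreal (?C * ?E w b) * ?f w \<partial>lebesgue_vec N) \<partial>sphere_uniform p)"
    by (subst shift[OF f]) (rule refl)
  also have "\<dots> = (\<integral>\<^sup>+w. (\<integral>\<^sup>+b. ennreal (?C * ?E w b) * ?f w \<partial>sphere_uniform p) \<partial>lebesgue_vec N)"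
    by (rule P1.Fubini') (simp add: case_prod_unfold)
  \<comment> \<open>For a fixed observation w, integrating the likelihood over the sphere produces
    the spherical partition function. It cancels the denominator, and the numerator that is left is
    the integral over the Gaussian prior.\<close>
  also have "\<dots> = (\<integral>\<^sup>+w. (\<integral>\<^sup>+z. ennreal (?C * ?E w z) * 1 \<partial>gauss 1 {..<p}) \<partial>lebesgue_vec N)"
  proof (intro nn_integral_cong)
    fix w assume w: "w \<in> space (lebesgue_vec N)"
    have [measurable]: "(\<lambda>_. w) \<in> M \<rightarrow>\<^sub>M vec_borel N" for M :: "'b measure"
      using w by (simp add: space_PiM)
    have [measurable]: "(\<lambda>b. b) \<in> sphere_uniform p \<rightarrow>\<^sub>M vec_borel p"
      by (simp cong: measurable_cong_sets)
    have "(\<integral>\<^sup>+b. ennreal (?C * ?E w b) * ?f w \<partial>sphere_uniform p)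
        = (\<integral>\<^sup>+b. (ennreal ?C * ?f w) * ennreal (?E w b) \<partial>sphere_uniform p)"
      using C by (intro nn_integral_cong) (simp only: ennreal_mult exp_ge_zero mult_ac)
    also have "\<dots> = ennreal ?C * ?f w * ennreal (?Z w)"
      unfolding partition_function_nn_integral(1)[OF \<Delta>] by (rule nn_integral_cmult) measurable
    also have "\<dots> = ennreal ?C * ennreal (exp (?LG w))"
      using partition_function_nn_integral(2)[OF \<Delta>, of N p A w]
      by (simp add: mult.assoc ennreal_mult''[symmetric])
    also have "\<dots> = (\<integral>\<^sup>+z. ennreal ?C * ennreal (?E w z) \<partial>gauss 1 {..<p})"
      unfolding gauss_partition[OF \<Delta>, symmetric] by (rule nn_integral_cmult[symmetric]) measurable
    also have "\<dots> = (\<integral>\<^sup>+z. ennreal (?C * ?E w z) * 1 \<partial>gauss 1 {..<p})"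
      using C by (intro nn_integral_cong) (simp only: ennreal_mult exp_ge_zero mult_1_right)
    finally show "(\<integral>\<^sup>+b. ennreal (?C * ?E w b) * ?f w \<partial>sphere_uniform p) =
       (\<integral>\<^sup>+z. ennreal (?C * ?E w z) * 1 \<partial>gauss 1 {..<p})" .
  qed
  \<comment> \<open>Exchanged back, the integral is the total mass of the observation under the
    Gaussian prior.\<close>
  also have "\<dots> = (\<integral>\<^sup>+z. (\<integral>\<^sup>+w. ennreal (?C * ?E w z) * 1 \<partial>lebesgue_vec N) \<partial>gauss 1 {..<p})"
    by (rule P2.Fubini'[symmetric]) (simp add: case_prod_unfold)
  also have "\<dots> = (\<integral>\<^sup>+z. (\<integral>\<^sup>+e. 1 \<partial>gauss 1 {..<N}) \<partial>gauss 1 {..<p})"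
    by (subst shift[of "\<lambda>_. 1", symmetric]) auto
  also have "\<dots> = 1"
    by (simp add: GN.emeasure_space_1 Gp.emeasure_space_1)
  finally show ?thesis .
qed

text \<open>Jensen's inequality from the tangent of exp(-y) at m. It suffices that m bounds the mean
  from above.\<close>

lemma (in prob_space) nn_integral_exp_ge:
  assumes Y[measurable]: "Y \<in> borel_measurable M" and nn: "\<And>x. 0 \<le> Y x"
    and m: "0 \<le> m" "(\<integral>\<^sup>+x. ennreal (Y x) \<partial>M) \<le> ennreal m"
  shows "ennreal (exp (- m)) \<le> (\<integral>\<^sup>+x. ennreal (exp (- Y x)) \<partial>M)"
proof -
  have int: "integrable M Y"
    using m(2) nn by (intro integrableI_nonneg) (auto intro: le_less_trans)
  have Ym: "expectation Y \<le> m"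
    using m nn_integral_eq_integral[OF int] nn by (simp add: ennreal_le_iff)
  have intE: "integrable M (\<lambda>x. exp (- Y x))"
    by (rule integrable_const_bound[where B=1]) (use nn in auto)
  have "exp (- m) \<le> exp (- m) * (1 + m - expectation Y)"
    using Ym by simp
  also have "\<dots> = expectation (\<lambda>x. exp (- m) * (1 + m - Y x))"
    using int by (simp add: prob_space)
  also have "\<dots> \<le> expectation (\<lambda>x. exp (- Y x))"
  proof (rule integral_mono[OF _ intE])
    show "integrable M (\<lambda>x. exp (- m) * (1 + m - Y x))" using int by simp
    fix x
    have "exp (- m) * (1 + (m - Y x)) \<le> exp (- m) * exp (m - Y x)"
      by (intro mult_left_mono exp_ge_add_one_self) simp
    then show "exp (- m) * (1 + m - Y x) \<le> exp (- Y x)"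
      by (simp add: exp_add[symmetric] add_diff_eq)
  qed
  finally show ?thesis
    using intE by (subst nn_integral_eq_integral) (auto intro: ennreal_leI)
qed

text \<open>The tangent at t = 1 of the convex power function; integrated against a variable of mean
  1 it gives Jensen's inequality for powers.\<close>

lemma bernoulli_powr:
  fixes t \<eta> :: real
  assumes "t > 0" "\<eta> \<ge> 0"
  shows "1 + (1 + \<eta>) * (t - 1) \<le> t powr (1 + \<eta>)"
proof -
  have "ln (1 / t) \<le> 1 / t - 1" using assms by (intro ln_le_minus_one) simp
  then have "t - 1 \<le> t * ln t"
    using assms by (simp add: ln_div field_simps)
  then have "\<eta> * (t - 1) \<le> \<eta> * (t * ln t)"
    using assms(2) by (rule mult_left_mono)
  then have "1 + (1 + \<eta>) * (t - 1) \<le> t * (1 + \<eta> * ln t)"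
    by (simp add: algebra_simps)
  also have "\<dots> \<le> t * exp (\<eta> * ln t)"
    using assms by (intro mult_left_mono exp_ge_add_one_self) simp
  also have "\<dots> = t powr (1 + \<eta>)"
    using assms by (simp add: powr_add powr_def[of t \<eta>])
  finally show ?thesis .
qed

text \<open>The residual at r b is r times the residual at b plus (1 - r) v. Young's inequality with
  weight \<eta> keeps the factor of the main term close to 1 and puts the large factor on the term
  that is small for r near 1.\<close>

lemma residual_norm_scale_le:
  assumes "\<eta> > 0"
  shows "(residual_norm N p A v (scale_vec p r b))\<^sup>2 \<le>
    (1 + \<eta>) * r\<^sup>2 * (residual_norm N p A v b)\<^sup>2 + (1 + 1 / \<eta>) * (1 - r)\<^sup>2 * dot N v v"
proof -
  have *: "(x + y)\<^sup>2 \<le> (1 + \<eta>) * x\<^sup>2 + (1 + 1 / \<eta>) * y\<^sup>2" for x y :: real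
  proof -
    have "0 \<le> (\<eta> * x - y)\<^sup>2 / \<eta>" using assms by simp
    also have "\<dots> = \<eta> * x\<^sup>2 - 2 * x * y + y\<^sup>2 / \<eta>"
      using assms by (simp add: field_simps power2_eq_square)
    finally show ?thesis by (simp add: algebra_simps power2_sum)
  qed
  have "mat_vec p A (scale_vec p r b) i = r * mat_vec p A b i" for i
    by (simp add: mat_vec_def scale_vec_def sum_distrib_left mult_ac)
  then have "(residual_norm N p A v (scale_vec p r b))\<^sup>2 =
      (\<Sum>i<N. (r * (v i - mat_vec p A b i) + (1 - r) * v i)\<^sup>2)"
    by (simp add: residual_norm_def L2_set_def sum_nonneg algebra_simps)
  also have "\<dots> \<le> (\<Sum>i<N. (1 + \<eta>) * (r * (v i - mat_vec p A b i))\<^sup>2 + (1 + 1 / \<eta>) * ((1 - r) * v i)\<^sup>2)"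
    by (intro sum_mono *)
  also have "\<dots> = (1 + \<eta>) * r\<^sup>2 * (residual_norm N p A v b)\<^sup>2 + (1 + 1 / \<eta>) * (1 - r)\<^sup>2 * dot N v v"
    by (simp add: residual_norm_def L2_set_def sum_nonneg dot_def power_mult_distrib
        sum.distrib sum_distrib_left power2_eq_square[of "v _"] mult_ac)
  finally show ?thesis .
qed

text \<open>Jensen twice. For fixed direction it is applied in the radius, where the squared radius
  has mean 1 and variance 2 / p, the origin of the error term. It is then applied over the sphere to
  the power 1 + \<eta> of the likelihood, a power forced by Young's inequality in
  \<open>residual_norm_scale_le\<close>.\<close>

lemma log_gauss_partition_ge:
  assumes \<Delta>: "\<Delta> > 0" and p: "p > 0" and \<eta>: "\<eta> > 0"
  shows "(1 + \<eta>) * ln (partition_function \<Delta> N p A v) - (1 + 1 / \<eta>) * dot N v v / (\<Delta> * real p)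
    \<le> log_gauss_partition N \<Delta> p A v"
proof -
  interpret S: prob_space "sphere_uniform p" by (rule prob_space_sphere_uniform)
  interpret G: prob_space "gauss 1 {..<p}" by (rule prob_space_gauss) simp
  let ?r = "\<lambda>b. residual_norm N p A v b"
  define c where "c = (1 + 1 / \<eta>) * dot N v v / (\<Delta> * real p)"
  define Z where "Z = partition_function \<Delta> N p A v"
  define t where "t b = exp (- (1 / (2 * \<Delta>)) * (?r b)\<^sup>2) / Z" for b
  have Z: "Z > 0" unfolding Z_def by (rule partition_function_nn_integral[OF \<Delta>])
  have [measurable]: "(\<lambda>b. ?r b) \<in> borel_measurable (sphere_uniform p)"
    using residual_measurable by (simp cong: measurable_cong_sets)
  have inner: "ennreal (exp (- ((1 + \<eta>) * (?r b)\<^sup>2 / (2 * \<Delta>) + c))) \<le>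
      (\<integral>\<^sup>+z. ennreal (exp (- (1 / (2 * \<Delta>)) * (?r (scale_vec p (radius p z) b))\<^sup>2)) \<partial>gauss 1 {..<p})" for b
  proof -
    define h where "h = (1 + \<eta>) * (?r b)\<^sup>2 / (2 * \<Delta>)"
    define k where "k = (1 + 1 / \<eta>) * dot N v v / (2 * \<Delta>)"
    define Y where "Y z = h * (radius p z)\<^sup>2 + k * ((radius p z)\<^sup>2 - 1)\<^sup>2" for z
    have h: "h \<ge> 0" using \<eta> \<Delta> by (simp add: h_def)
    have k: "k \<ge> 0" using \<eta> \<Delta> dot_self_nonneg[of N v] by (simp add: k_def)
    have ck: "c = k * (2 / real p)" by (simp add: c_def k_def)
    have "ennreal (exp (- (h + c))) \<le> (\<integral>\<^sup>+z. ennreal (exp (- Y z)) \<partial>gauss 1 {..<p})"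
    proof (rule G.nn_integral_exp_ge)
      show "Y \<in> borel_measurable (gauss 1 {..<p})" unfolding Y_def by measurable
      show "0 \<le> Y z" for z using h k by (simp add: Y_def)
      show "0 \<le> h + c" using h k by (simp add: ck)
      have "(\<integral>\<^sup>+z. ennreal (Y z) \<partial>gauss 1 {..<p}) =
        (\<integral>\<^sup>+z. ennreal h * ennreal ((radius p z)\<^sup>2) + ennreal k * ennreal (((radius p z)\<^sup>2 - 1)\<^sup>2) \<partial>gauss 1 {..<p})"
        using h k by (simp add: Y_def ennreal_mult)
      also have "\<dots> = ennreal h * 1 + ennreal k * ennreal (2 / real p)"
        by (subst nn_integral_add)
          (simp_all add: nn_integral_cmult nn_integral_radius_sq[OF p] nn_integral_radius_variance[OF p])
      also have "\<dots> = ennreal (h + c)"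
        unfolding ck using h k by (subst ennreal_plus) (auto simp: ennreal_mult[symmetric])
      finally show "(\<integral>\<^sup>+z. ennreal (Y z) \<partial>gauss 1 {..<p}) \<le> ennreal (h + c)" by simp
    qed
    also have "\<dots> \<le> (\<integral>\<^sup>+z. ennreal (exp (- (1 / (2 * \<Delta>)) * (?r (scale_vec p (radius p z) b))\<^sup>2)) \<partial>gauss 1 {..<p})"
    proof (intro nn_integral_mono ennreal_leI)
      fix z
      let ?\<rho> = "radius p z"
      \<comment> \<open>Trades the deviation of the radius for that of its square, whose Gaussian
        second moment is known exactly.\<close>
      have \<rho>: "(1 - ?\<rho>)\<^sup>2 \<le> (?\<rho>\<^sup>2 - 1)\<^sup>2"
      proof -
        have "?\<rho>\<^sup>2 - 1 = (1 - ?\<rho>) * (- (1 + ?\<rho>))" by (simp add: algebra_simps power2_eq_square)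
        then have "(?\<rho>\<^sup>2 - 1)\<^sup>2 = (1 - ?\<rho>)\<^sup>2 * (1 + ?\<rho>)\<^sup>2" by (simp add: power_mult_distrib power2_minus del: minus_add_distrib)
        moreover have "1 \<le> (1 + ?\<rho>)\<^sup>2" using radius_nonneg[of p z] by (intro one_le_power) simp
        ultimately show ?thesis by (simp add: mult_le_cancel_left1)
      qed
      have "(?r (scale_vec p ?\<rho> b))\<^sup>2 \<le> (1 + \<eta>) * ?\<rho>\<^sup>2 * (?r b)\<^sup>2 + (1 + 1 / \<eta>) * (1 - ?\<rho>)\<^sup>2 * dot N v v"
        by (rule residual_norm_scale_le[OF \<eta>])
      also have "\<dots> \<le> (1 + \<eta>) * ?\<rho>\<^sup>2 * (?r b)\<^sup>2 + (1 + 1 / \<eta>) * (?\<rho>\<^sup>2 - 1)\<^sup>2 * dot N v v"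
        using \<rho> \<eta> by (intro add_left_mono mult_right_mono mult_left_mono dot_self_nonneg) auto
      also have "\<dots> = 2 * \<Delta> * Y z"
        using \<Delta> by (simp add: Y_def h_def k_def field_simps)
      finally have "(?r (scale_vec p ?\<rho> b))\<^sup>2 / (2 * \<Delta>) \<le> Y z"
        using \<Delta> by (simp add: divide_le_eq mult.commute)
      then show "exp (- Y z) \<le> exp (- (1 / (2 * \<Delta>)) * (?r (scale_vec p ?\<rho> b))\<^sup>2)"
        by simp
    qed
    finally show ?thesis unfolding h_def .
  qed
  have "exp (- c) * Z powr (1 + \<eta>) \<le> exp (log_gauss_partition N \<Delta> p A v)"
  proof -
    have tint: "integrable (sphere_uniform p) t" "S.expectation t = 1"
      unfolding t_def using partition_function_nn_integral(4)[OF \<Delta>, of p N A v] Z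
      by (simp_all add: Z_def partition_function_def)
    have tpos: "t b > 0" for b using Z by (simp add: t_def)
    have tZ: "exp (- (1 + \<eta>) * (?r b)\<^sup>2 / (2 * \<Delta>)) = Z powr (1 + \<eta>) * t b powr (1 + \<eta>)" for b
    proof -
      have "Z powr (1 + \<eta>) * t b powr (1 + \<eta>) = (Z * t b) powr (1 + \<eta>)"
        using Z tpos[of b] by (simp add: powr_mult)
      also have "Z * t b = exp (- (1 / (2 * \<Delta>)) * (?r b)\<^sup>2)"
        using Z by (simp add: t_def)
      also have "\<dots> powr (1 + \<eta>) = exp (- (1 + \<eta>) * (?r b)\<^sup>2 / (2 * \<Delta>))"
        using \<Delta> by (simp add: powr_def) (simp add: field_simps)
      finally show ?thesis ..
    qed
    have intp: "integrable (sphere_uniform p) (\<lambda>b. exp (- (1 + \<eta>) * (?r b)\<^sup>2 / (2 * \<Delta>)))"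
      by (rule S.integrable_const_bound[where B=1]) (use \<eta> \<Delta> in \<open>auto intro!: divide_nonpos_pos mult_nonpos_nonneg\<close>)
    \<comment> \<open>\<open>t\<close> is the likelihood normalised to spherical mean 1, so the
      tangent line of \<open>bernoulli_powr\<close> integrates to 1.\<close>
    have "Z powr (1 + \<eta>) = S.expectation (\<lambda>b. Z powr (1 + \<eta>) * (1 + (1 + \<eta>) * (t b - 1)))"
      using tint S.prob_space by simp
    also have "\<dots> \<le> S.expectation (\<lambda>b. exp (- (1 + \<eta>) * (?r b)\<^sup>2 / (2 * \<Delta>)))"
    proof (rule integral_mono[OF _ intp])
      show "integrable (sphere_uniform p) (\<lambda>b. Z powr (1 + \<eta>) * (1 + (1 + \<eta>) * (t b - 1)))"
        using tint by simp
      show "Z powr (1 + \<eta>) * (1 + (1 + \<eta>) * (t b - 1)) \<le> exp (- (1 + \<eta>) * (?r b)\<^sup>2 / (2 * \<Delta>))" for b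
        unfolding tZ using \<eta> by (intro mult_left_mono bernoulli_powr tpos) auto
    qed
    finally have "ennreal (exp (- c) * Z powr (1 + \<eta>)) \<le>
        ennreal (exp (- c)) * (\<integral>\<^sup>+b. ennreal (exp (- (1 + \<eta>) * (?r b)\<^sup>2 / (2 * \<Delta>))) \<partial>sphere_uniform p)"
      using nn_integral_eq_integral[OF intp] by (simp add: ennreal_mult mult_left_mono ennreal_leI)
    also have "\<dots> = (\<integral>\<^sup>+b. ennreal (exp (- ((1 + \<eta>) * (?r b)\<^sup>2 / (2 * \<Delta>) + c))) \<partial>sphere_uniform p)"
    proof (subst nn_integral_cmult[symmetric])
      show "(\<integral>\<^sup>+b. ennreal (exp (- c)) * ennreal (exp (- (1 + \<eta>) * (?r b)\<^sup>2 / (2 * \<Delta>))) \<partial>sphere_uniform p)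
        = (\<integral>\<^sup>+b. ennreal (exp (- ((1 + \<eta>) * (?r b)\<^sup>2 / (2 * \<Delta>) + c))) \<partial>sphere_uniform p)"
      proof (intro nn_integral_cong)
        fix b
        have "- c + - (1 + \<eta>) * (?r b)\<^sup>2 / (2 * \<Delta>) = - ((1 + \<eta>) * (?r b)\<^sup>2 / (2 * \<Delta>) + c)"
          using \<Delta> by (simp add: field_simps)
        then show "ennreal (exp (- c)) * ennreal (exp (- (1 + \<eta>) * (?r b)\<^sup>2 / (2 * \<Delta>))) =
          ennreal (exp (- ((1 + \<eta>) * (?r b)\<^sup>2 / (2 * \<Delta>) + c)))"
          by (metis exp_add ennreal_mult exp_ge_zero)
      qed
    qed measurable
    also have "\<dots> \<le> (\<integral>\<^sup>+b. (\<integral>\<^sup>+z. ennreal (exp (- (1 / (2 * \<Delta>)) * (?r (scale_vec p (radius p z) b))\<^sup>2)) \<partial>gauss 1 {..<p}) \<partial>sphere_uniform p)"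
      by (intro nn_integral_mono inner)
    also have "\<dots> = (\<integral>\<^sup>+z. ennreal (exp (- (1 / (2 * \<Delta>)) * (?r z)\<^sup>2)) \<partial>gauss 1 {..<p})"
      by (rule nn_integral_gauss_polar[OF p, symmetric]) measurable
    also have "\<dots> = ennreal (exp (log_gauss_partition N \<Delta> p A v))"
      by (rule gauss_partition[OF \<Delta>])
    finally show ?thesis by (simp add: ennreal_le_iff)
  qed
  then have "ln (exp (- c) * Z powr (1 + \<eta>)) \<le> log_gauss_partition N \<Delta> p A v"
    using Z by (subst ln_le_cancel_iff[symmetric, of _ "exp _", simplified, THEN iffD1]) auto
  then have "- c + (1 + \<eta>) * ln Z \<le> log_gauss_partition N \<Delta> p A v"
    using Z by (simp add: ln_mult ln_powr)
  then show ?thesis unfolding Z_def c_def by simp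
qed

section \<open>The limiting free energy\<close>

text \<open>The positive root g of g^2 + (\<Delta> + s - 1) g - \<Delta> = 0, where s is the number
  of columns over N. It is the Marchenko-Pastur prediction for tr G / N.\<close>

definition mp_root :: "real \<Rightarrow> real \<Rightarrow> real" where
  "mp_root \<Delta> s = (1 - \<Delta> - s + sqrt ((1 - \<Delta> - s)\<^sup>2 + 4 * \<Delta>)) / 2"

text \<open>Asymptotic value of ln det (I + x x^T / \<Delta>) / N at aspect ratio s. Its derivative
  in s is the logarithm that multiplies s.\<close>

definition mp_log_det :: "real \<Rightarrow> real \<Rightarrow> real" where
  "mp_log_det \<Delta> s = s * ln (1 + mp_root \<Delta> s / \<Delta>) - ln (mp_root \<Delta> s) - 1 + mp_root \<Delta> s"

text \<open>The last term is the contribution of y^T G y / (2 \<Delta> p), in which y^T G y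
  concentrates at \<Delta> N.\<close>

definition limit_free_energy :: "real \<Rightarrow> real \<Rightarrow> real" where
  "limit_free_energy \<Delta> \<alpha> = - (\<alpha> / 2) * mp_log_det \<Delta> (1 / \<alpha>) - \<alpha> / 2"

text \<open>The limit of 1 - q at the ridge estimator.\<close>

definition optimal_E :: "real \<Rightarrow> real \<Rightarrow> real" where
  "optimal_E \<Delta> \<alpha> = 1 - \<alpha> * (1 - mp_root \<Delta> (1 / \<alpha>))"

definition entropic :: "real \<Rightarrow> real \<Rightarrow> real \<Rightarrow> real" where
  "entropic \<Delta> \<alpha> E = - \<alpha> / 2 * ln (1 + E / (\<Delta> * \<alpha>)) + 1 / 2 * ln E"

lemma frac_mono:
  fixes c x y :: real
  shows "c > 0 \<Longrightarrow> 0 \<le> x \<Longrightarrow> x \<le> y \<Longrightarrow> x / (c + x) \<le> y / (c + y)"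
  by (simp add: field_simps)

lemma minimum_of_derivative_sign:
  fixes f f' :: "real \<Rightarrow> real"
  assumes der: "\<And>x. x > 0 \<Longrightarrow> (f has_real_derivative f' x) (at x)"
    and le: "\<And>x. 0 < x \<Longrightarrow> x \<le> m \<Longrightarrow> f' x \<le> 0" and ge: "\<And>x. m \<le> x \<Longrightarrow> 0 \<le> f' x"
    and m: "m > 0" and h: "h > 0"
  shows "f m \<le> f h"
proof (cases "h \<le> m")
  case True
  show ?thesis
    by (rule DERIV_nonpos_imp_nonincreasing[OF True]) (use der le h in force)
next
  case False
  show ?thesis
  proof (rule DERIV_nonneg_imp_nondecreasing[of m h])
    show "\<exists>y. (f has_real_derivative y) (at x) \<and> 0 \<le> y" if "m \<le> x" for x
      using der[of x] ge[OF that] m that by (intro exI[of _ "f' x"]) auto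
  qed (use False in simp)
qed

section \<open>The fixed point equation and the limiting log determinant\<close>

context
  fixes \<Delta> :: real
  assumes \<Delta>: "\<Delta> > 0"
begin

lemma mp_root_pos: "mp_root \<Delta> s > 0"
proof -
  have "\<bar>1 - \<Delta> - s\<bar> = sqrt ((1 - \<Delta> - s)\<^sup>2)" by simp
  also have "\<dots> < sqrt ((1 - \<Delta> - s)\<^sup>2 + 4 * \<Delta>)"
    using \<Delta> by (intro real_sqrt_less_mono) simp
  finally show ?thesis by (simp add: mp_root_def)
qed

lemma mp_root_eq: "(1 - mp_root \<Delta> s) * (\<Delta> + mp_root \<Delta> s) = s * mp_root \<Delta> s"
proof -
  define q where "q = sqrt ((1 - \<Delta> - s)\<^sup>2 + 4 * \<Delta>)"
  have "q\<^sup>2 = (1 - \<Delta> - s)\<^sup>2 + 4 * \<Delta>" using \<Delta> by (simp add: q_def)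
  then show ?thesis
    unfolding mp_root_def q_def[symmetric] by (simp add: field_simps power2_eq_square)
qed

lemma mp_root_le_1: "s \<ge> 0 \<Longrightarrow> mp_root \<Delta> s \<le> 1"
proof -
  assume "s \<ge> 0"
  then have "0 \<le> (1 - mp_root \<Delta> s) * (\<Delta> + mp_root \<Delta> s)"
    unfolding mp_root_eq using mp_root_pos[of s] by simp
  then show ?thesis
    using mp_root_pos[of s] \<Delta> by (simp add: zero_le_mult_iff)
qed

lemma mp_root_fixed_point: "1 - mp_root \<Delta> s = s * (mp_root \<Delta> s / (\<Delta> + mp_root \<Delta> s))"
proof -
  have "\<Delta> + mp_root \<Delta> s \<noteq> 0" using mp_root_pos[of s] \<Delta> by simp
  then have "1 - mp_root \<Delta> s = s * mp_root \<Delta> s / (\<Delta> + mp_root \<Delta> s)"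
    using mp_root_eq[of s] by (rule nonzero_eq_divide_eq[THEN iffD2])
  then show ?thesis by simp
qed

text \<open>The function 1 - t - s t / (\<Delta> + t) has slope at most -1 and vanishes at the root,
  so its value at t dominates the distance from t to the root, with constant 1.\<close>

lemma mp_root_stable:
  assumes "s \<ge> 0" "t \<ge> 0"
  shows "\<bar>t - mp_root \<Delta> s\<bar> \<le> \<bar>1 - t - s * (t / (\<Delta> + t))\<bar>"
proof -
  let ?g = "mp_root \<Delta> s"
  have eq: "1 - t - s * (t / (\<Delta> + t)) = (?g - t) + s * (?g / (\<Delta> + ?g) - t / (\<Delta> + t))"
    using mp_root_fixed_point[of s] by (simp add: algebra_simps)
  show ?thesis
  proof (cases "t \<le> ?g")
    case True
    then have "0 \<le> s * (?g / (\<Delta> + ?g) - t / (\<Delta> + t))"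
      using assms frac_mono[OF \<Delta>, of t ?g] by (intro mult_nonneg_nonneg) auto
    then show ?thesis unfolding eq using True by linarith
  next
    case False
    then have "s * (?g / (\<Delta> + ?g) - t / (\<Delta> + t)) \<le> 0"
      using assms frac_mono[OF \<Delta>, of ?g t] mp_root_pos[of s] by (intro mult_nonneg_nonpos) auto
    then show ?thesis unfolding eq using False by linarith
  qed
qed

text \<open>A variational formula: the right-hand side has derivative s / (\<Delta> + h) - 1 / h + 1
  in h, which changes sign exactly at the root, so the root is the global minimiser.\<close>

lemma mp_log_det_le:
  assumes "s \<ge> 0" "h > 0"
  shows "mp_log_det \<Delta> s \<le> s * ln (1 + h / \<Delta>) - ln h - 1 + h"
proof -
  let ?f = "\<lambda>h. s * ln (1 + h / \<Delta>) - ln h - 1 + h"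
  let ?f' = "\<lambda>h. s / (\<Delta> + h) - 1 / h + 1"
  have "?f (mp_root \<Delta> s) \<le> ?f h"
  proof (rule minimum_of_derivative_sign[where f="?f" and f'="?f'"])
    fix x :: real assume x: "x > 0"
    have "1 + x / \<Delta> > 0" using x \<Delta> by (simp add: add_pos_pos)
    moreover have "1 / \<Delta> / (1 + x / \<Delta>) = 1 / (\<Delta> + x)"
      using x \<Delta> by (simp add: field_simps)
    moreover have "(?f has_real_derivative (s * (1 / \<Delta> / (1 + x / \<Delta>)) - 1 / x + 1)) (at x)"
      using x \<open>1 + x / \<Delta> > 0\<close> \<Delta> by (auto intro!: derivative_eq_intros simp: divide_inverse)
    ultimately show "(?f has_real_derivative ?f' x) (at x)" by simp
  next
    have eq: "?f' x = (s * (x / (\<Delta> + x)) - (1 - x)) / x" if "x > 0" for x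
      using that by (simp add: diff_divide_distrib)
    show "?f' x \<le> 0" if "0 < x" "x \<le> mp_root \<Delta> s" for x
    proof -
      have "s * (x / (\<Delta> + x)) \<le> s * (mp_root \<Delta> s / (\<Delta> + mp_root \<Delta> s))"
        using frac_mono[OF \<Delta>] that assms by (intro mult_left_mono) auto
      then show ?thesis
        unfolding eq[OF that(1)] using that mp_root_fixed_point[of s] by (intro divide_nonpos_pos) auto
    qed
    show "0 \<le> ?f' x" if "mp_root \<Delta> s \<le> x" for x
    proof -
      have x: "x > 0" using that mp_root_pos[of s] by linarith
      have "s * (mp_root \<Delta> s / (\<Delta> + mp_root \<Delta> s)) \<le> s * (x / (\<Delta> + x))"
        using frac_mono[OF \<Delta>] mp_root_pos[of s] that assms by (intro mult_left_mono) auto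
      then show ?thesis
        unfolding eq[OF x] using that x mp_root_fixed_point[of s] by (intro divide_nonneg_pos) auto
    qed
  qed (use mp_root_pos assms in auto)
  then show ?thesis by (simp add: mp_log_det_def)
qed

text \<open>A minimum over h of functions affine in s is concave; inserting the minimiser for r
  gives the supporting line at r.\<close>

lemma mp_log_det_tangent:
  assumes "s \<ge> 0"
  shows "mp_log_det \<Delta> s \<le> mp_log_det \<Delta> r + (s - r) * ln (1 + mp_root \<Delta> r / \<Delta>)"
  using mp_log_det_le[OF assms mp_root_pos[of r]]
  by (simp add: mp_log_det_def[of \<Delta> r] algebra_simps)

lemma ln_root_bounds:
  assumes "s \<ge> 0"
  shows "0 \<le> ln (1 + mp_root \<Delta> s / \<Delta>)" "ln (1 + mp_root \<Delta> s / \<Delta>) \<le> ln (1 + 1 / \<Delta>)"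
proof -
  have "mp_root \<Delta> s / \<Delta> \<le> 1 / \<Delta>"
    using mp_root_le_1[OF assms] \<Delta> by (intro divide_right_mono) auto
  moreover have "0 \<le> mp_root \<Delta> s / \<Delta>" using mp_root_pos[of s] \<Delta> by simp
  ultimately show "0 \<le> ln (1 + mp_root \<Delta> s / \<Delta>)" "ln (1 + mp_root \<Delta> s / \<Delta>) \<le> ln (1 + 1 / \<Delta>)"
    by auto
qed

lemma mp_log_det_0: "mp_log_det \<Delta> 0 = 0"
proof -
  have "(1 - \<Delta>)\<^sup>2 + 4 * \<Delta> = (1 + \<Delta>)\<^sup>2" by (simp add: power2_eq_square algebra_simps)
  then have "mp_root \<Delta> 0 = 1" using \<Delta> by (simp add: mp_root_def)
  then show ?thesis by (simp add: mp_log_det_def)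
qed

text \<open>Concavity replaces integration: the supporting line at the left end of a step bounds the
  increment from above, the one at the right end bounds it from below. Both bounds telescope,
  starting from \<open>mp_log_det_0\<close>, and they differ only by the end terms of the
  sum.\<close>

lemma mp_log_det_riemann_sum:
  assumes N: "N > 0"
  shows "\<bar>(\<Sum>k<p. ln (1 + mp_root \<Delta> (real k / real N) / \<Delta>)) - real N * mp_log_det \<Delta> (real p / real N)\<bar>
    \<le> ln (1 + 1 / \<Delta>)"
proof -
  let ?l = "\<lambda>k. ln (1 + mp_root \<Delta> (real k / real N) / \<Delta>)"
  let ?\<psi> = "\<lambda>k. real N * mp_log_det \<Delta> (real k / real N)"
  have st: "real (Suc k) / real N - real k / real N = 1 / real N" for k
    by (simp add: diff_divide_distrib[symmetric])
  have up: "?\<psi> (Suc k) - ?\<psi> k \<le> ?l k" for k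
  proof -
    have "mp_log_det \<Delta> (real (Suc k) / real N) \<le> mp_log_det \<Delta> (real k / real N) + 1 / real N * ?l k"
      using mp_log_det_tangent[of "real (Suc k) / real N" "real k / real N"] by (simp only: st) simp
    then have "real N * mp_log_det \<Delta> (real (Suc k) / real N) \<le>
       real N * (mp_log_det \<Delta> (real k / real N) + 1 / real N * ?l k)"
      by (rule mult_left_mono) simp
    then show ?thesis using N by (simp add: distrib_left)
  qed
  have lo: "?l (Suc k) \<le> ?\<psi> (Suc k) - ?\<psi> k" for k
  proof -
    have "real k / real N - real (Suc k) / real N = - (1 / real N)" using st[of k] by simp
    then have "mp_log_det \<Delta> (real k / real N) \<le> mp_log_det \<Delta> (real (Suc k) / real N) - 1 / real N * ?l (Suc k)"
      using mp_log_det_tangent[of "real k / real N" "real (Suc k) / real N"] by simp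
    then have "real N * mp_log_det \<Delta> (real k / real N) \<le>
       real N * (mp_log_det \<Delta> (real (Suc k) / real N) - 1 / real N * ?l (Suc k))"
      by (rule mult_left_mono) simp
    then show ?thesis using N by (simp add: right_diff_distrib)
  qed
  have tel: "(\<Sum>k<p. ?\<psi> (Suc k) - ?\<psi> k) = ?\<psi> p"
    by (subst sum_lessThan_telescope) (simp add: mp_log_det_0)
  have "?\<psi> p \<le> (\<Sum>k<p. ?l k)"
    unfolding tel[symmetric] by (rule sum_mono) (rule up)
  moreover have "(\<Sum>k<p. ?l (Suc k)) \<le> ?\<psi> p"
    unfolding tel[symmetric] by (rule sum_mono) (rule lo)
  moreover have "(\<Sum>k<p. ?l k) \<le> (\<Sum>k<p. ?l (Suc k)) + ?l 0"
  proof -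
    have "(\<Sum>k<p. ?l k) + ?l p = ?l 0 + (\<Sum>k<p. ?l (Suc k))"
      using sum.lessThan_Suc[of ?l p] sum.lessThan_Suc_shift[of ?l p] by simp
    moreover have "0 \<le> ?l p" by (rule ln_root_bounds) simp
    ultimately show ?thesis by linarith
  qed
  moreover have "?l 0 \<le> ln (1 + 1 / \<Delta>)" using ln_root_bounds(2)[of 0] by simp
  moreover have "0 \<le> ln (1 + 1 / \<Delta>)" using \<Delta> by simp
  ultimately show ?thesis by linarith
qed

lemma tendsto_mp_root:
  assumes "(f \<longlongrightarrow> s) F"
  shows "((\<lambda>x. mp_root \<Delta> (f x)) \<longlongrightarrow> mp_root \<Delta> s) F"
  unfolding mp_root_def by (intro tendsto_intros assms) auto

lemma tendsto_mp_log_det: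
  assumes f: "(f \<longlongrightarrow> s) F" and "s > 0"
  shows "((\<lambda>x. mp_log_det \<Delta> (f x)) \<longlongrightarrow> mp_log_det \<Delta> s) F"
proof -
  have "1 + mp_root \<Delta> s / \<Delta> > 0" using mp_root_pos[of s] \<Delta> by (simp add: add_pos_pos)
  then show ?thesis
    unfolding mp_log_det_def
    using mp_root_pos[of s] \<Delta> by (intro tendsto_intros tendsto_mp_root f) auto
qed

section \<open>The optimal overlap\<close>

context
  fixes \<alpha> :: real
  assumes \<alpha>: "\<alpha> > 0"
begin

private abbreviation "g\<^sub>0 \<equiv> mp_root \<Delta> (1 / \<alpha>)"

lemma optimal_E_eq: "(optimal_E \<Delta> \<alpha>) = \<Delta> / (\<Delta> + g\<^sub>0)"
proof -
  have "\<alpha> * (1 - g\<^sub>0) = g\<^sub>0 / (\<Delta> + g\<^sub>0)"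
    unfolding mp_root_fixed_point using \<alpha> by simp
  then show ?thesis
    unfolding optimal_E_def using mp_root_pos[of "1 / \<alpha>"] \<Delta> by (simp add: field_simps)
qed

lemma optimal_E_bounds: "0 < (optimal_E \<Delta> \<alpha>)" "(optimal_E \<Delta> \<alpha>) < 1"
  unfolding optimal_E_eq using mp_root_pos[of "1 / \<alpha>"] \<Delta> by auto

lemma optimal_E_g0: "\<Delta> * \<alpha> + (optimal_E \<Delta> \<alpha>) = \<Delta> * \<alpha> / g\<^sub>0"
proof -
  have "\<alpha> * (1 - g\<^sub>0) = g\<^sub>0 / (\<Delta> + g\<^sub>0)"
    unfolding mp_root_fixed_point using \<alpha> by simp
  then have "\<Delta> * (\<alpha> * (1 - g\<^sub>0)) = (optimal_E \<Delta> \<alpha>) * g\<^sub>0"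
    unfolding optimal_E_eq by simp
  then have "(\<Delta> * \<alpha> + (optimal_E \<Delta> \<alpha>)) * g\<^sub>0 = \<Delta> * \<alpha> * g\<^sub>0 + \<Delta> * (\<alpha> * (1 - g\<^sub>0))"
    by (simp only: distrib_right)
  also have "\<dots> = \<Delta> * \<alpha>"
    by (simp add: algebra_simps)
  finally have *: "(\<Delta> * \<alpha> + (optimal_E \<Delta> \<alpha>)) * g\<^sub>0 = \<Delta> * \<alpha>" .
  have "g\<^sub>0 \<noteq> 0" using mp_root_pos[of "1 / \<alpha>"] by simp
  then show ?thesis
    using * by (rule nonzero_eq_divide_eq[THEN iffD2])
qed

text \<open>At the optimal E one has 1 + E / (\<Delta> \<alpha>) = 1 / g and 1 / E = 1 + g /
  \<Delta>. The two logarithms of the TAP functional thus turn into the two logarithms of the log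
  determinant.\<close>

lemma entropic_optimal: "entropic \<Delta> \<alpha> (optimal_E \<Delta> \<alpha>) + (1 - (optimal_E \<Delta> \<alpha>)) / 2 = - (\<alpha> / 2) * mp_log_det \<Delta> (1 / \<alpha>)"
proof -
  have g: "g\<^sub>0 > 0" by (rule mp_root_pos)
  have "1 + (optimal_E \<Delta> \<alpha>) / (\<Delta> * \<alpha>) = (\<Delta> * \<alpha> + (optimal_E \<Delta> \<alpha>)) / (\<Delta> * \<alpha>)"
    using \<Delta> \<alpha> by (simp add: field_simps)
  also have "\<dots> = 1 / g\<^sub>0"
    unfolding optimal_E_g0 using \<Delta> \<alpha> by simp
  finally have "ln (1 + (optimal_E \<Delta> \<alpha>) / (\<Delta> * \<alpha>)) = - ln g\<^sub>0"
    using g by (simp add: ln_div)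
  moreover have "ln (optimal_E \<Delta> \<alpha>) = - ln (1 + g\<^sub>0 / \<Delta>)"
  proof -
    have "(optimal_E \<Delta> \<alpha>) = 1 / (1 + g\<^sub>0 / \<Delta>)"
      unfolding optimal_E_eq using g \<Delta> by (simp add: field_simps)
    then show ?thesis using g \<Delta> by (simp add: ln_div add_pos_pos)
  qed
  ultimately show ?thesis
    unfolding entropic_def mp_log_det_def optimal_E_def using \<alpha> by (simp add: field_simps)
qed

text \<open>The quadratic part of the TAP functional costs at most q / 2 = (1 - E) / 2, so this
  one-variable maximum is all that remains of the optimisation over a.\<close>

lemma entropic_le:
  assumes "E > 0"
  shows "entropic \<Delta> \<alpha> E + (1 - E) / 2 \<le> - (\<alpha> / 2) * mp_log_det \<Delta> (1 / \<alpha>)"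
proof -
  let ?f = "\<lambda>E. - (entropic \<Delta> \<alpha> E + (1 - E) / 2)"
  let ?f' = "\<lambda>E. (\<alpha> / (\<Delta> * \<alpha> + E) - 1 / E + 1) / 2"
  have d: "\<Delta> * \<alpha> > 0" using \<Delta> \<alpha> by simp
  have "?f (optimal_E \<Delta> \<alpha>) \<le> ?f E"
  proof (rule minimum_of_derivative_sign[where f="?f" and f'="?f'"])
    fix x :: real assume x: "x > 0"
    have p: "1 + x / (\<Delta> * \<alpha>) > 0" using x d by (simp add: add_pos_pos)
    have q: "1 / (1 + x / (\<Delta> * \<alpha>)) * (1 / (\<Delta> * \<alpha>)) = 1 / (\<Delta> * \<alpha> + x)"
      using x d \<Delta> \<alpha> by (simp add: field_simps)
    have "((\<lambda>x. 1 + x / (\<Delta> * \<alpha>)) has_real_derivative 1 / (\<Delta> * \<alpha>)) (at x)"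
      using \<Delta> \<alpha> by (auto intro!: derivative_eq_intros)
    from DERIV_chain2[OF DERIV_ln_divide[OF p] this]
    have d1: "((\<lambda>x. ln (1 + x / (\<Delta> * \<alpha>))) has_real_derivative 1 / (\<Delta> * \<alpha> + x)) (at x)"
      unfolding q .
    have "(?f has_real_derivative
        - (- \<alpha> / 2 * (1 / (\<Delta> * \<alpha> + x)) + 1 / 2 * (1 / x) + (0 - 1) / 2)) (at x)"
      unfolding entropic_def
      by (intro DERIV_minus DERIV_add DERIV_cmult DERIV_cdivide DERIV_diff DERIV_const DERIV_ident
          d1 DERIV_ln_divide x)
    moreover have "- (- \<alpha> / 2 * u + 1 / 2 * w + (0 - 1) / 2) = (\<alpha> * u - w + 1) / 2" for u w :: real
      by (simp add: field_simps)
    ultimately have "(?f has_real_derivative (\<alpha> * (1 / (\<Delta> * \<alpha> + x)) - 1 / x + 1) / 2) (at x)"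
      by metis
    then show "(?f has_real_derivative ?f' x) (at x)"
      unfolding times_divide_eq_right mult_1_right .
  next
    \<comment> \<open>The derivative has the sign of \<open>?k\<close>, which is increasing, so it
      vanishes only at the optimal E.\<close>
    let ?k = "\<lambda>x. \<alpha> * (x / (\<Delta> * \<alpha> + x)) - (1 - x)"
    have eq: "?f' x = ?k x / x / 2" if "x > 0" for x
      using that by (simp add: field_simps)
    have k0: "?k (optimal_E \<Delta> \<alpha>) = 0"
    proof -
      have g: "g\<^sub>0 > 0" by (rule mp_root_pos)
      have "\<alpha> * ((optimal_E \<Delta> \<alpha>) / (\<Delta> * \<alpha> + (optimal_E \<Delta> \<alpha>))) = (optimal_E \<Delta> \<alpha>) * g\<^sub>0 / \<Delta>"
        unfolding optimal_E_g0 using \<alpha> \<Delta> by simp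
      also have "\<dots> = g\<^sub>0 / (\<Delta> + g\<^sub>0)"
        unfolding optimal_E_eq using \<Delta> by simp
      also have "\<dots> = \<alpha> * (1 - g\<^sub>0)"
        unfolding mp_root_fixed_point using \<alpha> by simp
      also have "\<dots> = 1 - (optimal_E \<Delta> \<alpha>)"
        by (simp add: optimal_E_def)
      finally show ?thesis by simp
    qed
    have k_mono: "?k x \<le> ?k y" if "0 < x" "x \<le> y" for x y
    proof -
      have "x / (\<Delta> * \<alpha> + x) \<le> y / (\<Delta> * \<alpha> + y)"
        using frac_mono[OF d] that by simp
      then have "\<alpha> * (x / (\<Delta> * \<alpha> + x)) \<le> \<alpha> * (y / (\<Delta> * \<alpha> + y))"
        using \<alpha> by (intro mult_left_mono) auto
      then show ?thesis using that by linarith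
    qed
    show "?f' x \<le> 0" if "0 < x" "x \<le> (optimal_E \<Delta> \<alpha>)" for x
      unfolding eq[OF that(1)] using k_mono[OF that] k0 that by (intro divide_nonpos_pos) auto
    show "0 \<le> ?f' x" if "(optimal_E \<Delta> \<alpha>) \<le> x" for x
    proof -
      have x: "x > 0" using that optimal_E_bounds by linarith
      show ?thesis
        unfolding eq[OF x] using k_mono[OF optimal_E_bounds(1) that] k0 x by (intro divide_nonneg_pos) auto
    qed
  qed (use optimal_E_bounds assms in auto)
  then show ?thesis using entropic_optimal by linarith
qed

end

end

section \<open>The Gaussian design\<close>

abbreviation design :: "nat \<Rightarrow> nat \<Rightarrow> (nat \<times> nat \<Rightarrow> real) measure" where
  "design N p \<equiv> gauss (sqrt (1 / real N)) ({..<N} \<times> {..<p})"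

definition norm_trace :: "nat \<Rightarrow> real \<Rightarrow> nat \<Rightarrow> (nat \<times> nat \<Rightarrow> real) \<Rightarrow> real" where
  "norm_trace N \<Delta> n A = mat_trace N (resolvent N \<Delta> A (rev [0..<n])) / real N"

text \<open>The resolvent is a function of the listed columns alone. For a random design this makes
  it independent of every other column.\<close>

lemma resolvent_cong:
  assumes "\<And>i l. i < n \<Longrightarrow> l \<in> set ks \<Longrightarrow> A (i, l) = A' (i, l)" "i < n" "j < n"
  shows "resolvent n \<Delta> A ks i j = resolvent n \<Delta> A' ks i j"
  using assms
proof (induction ks arbitrary: i j)
  case (Cons k ks)
  have IH: "resolvent n \<Delta> A ks i j = resolvent n \<Delta> A' ks i j" if "i < n" "j < n" for i j
    using that Cons by auto
  have c: "col A k i = col A' k i" if "i < n" for i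
    using Cons that by (simp add: col_def)
  have m: "mv n (resolvent n \<Delta> A ks) (col A k) i = mv n (resolvent n \<Delta> A' ks) (col A' k) i"
    if "i < n" for i by (rule mv_cong) (use IH c that in auto)
  have "dot n (col A k) (mv n (resolvent n \<Delta> A ks) (col A k)) =
    dot n (col A' k) (mv n (resolvent n \<Delta> A' ks) (col A' k))"
    by (rule dot_cong) (use c m in auto)
  then show ?case using Cons(3,4) by (simp add: IH m)
qed simp

lemma mat_trace_cong:
  assumes "\<And>i j. i < n \<Longrightarrow> j < n \<Longrightarrow> B i j = B' i j"
  shows "mat_trace n B = mat_trace n B'"
  using assms by (simp add: mat_trace_def)

lemma dot_mv_double_sum: "dot n u (mv n B v) = (\<Sum>i<n. \<Sum>j<n. B i j * (u i * v j))"
  by (simp add: dot_def mv_def sum_distrib_left mult_ac)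

lemma measurable_mat_trace_resolvent [measurable (raw)]:
  assumes f: "f \<in> M \<rightarrow>\<^sub>M mat_borel N p" and "set ks \<subseteq> {..<p}"
  shows "(\<lambda>x. mat_trace N (resolvent N \<Delta> (f x) ks)) \<in> borel_measurable M"
  unfolding mat_trace_def by (intro borel_measurable_sum measurable_resolvent[OF f]) (use assms in auto)

text \<open>Given the other columns, the form is a Gaussian quadratic form with entry variance 1 / N
  and a fixed matrix. Its variance 2 / N^2 times the squared Frobenius norm is at most 2 / N,
  uniformly in those columns.\<close>

lemma column_form_variance:
  assumes \<Delta>: "\<Delta> > 0" and N: "N > 0" and k: "k < p" and ks: "distinct ks" "k \<notin> set ks" "set ks \<subseteq> {..<p}"
  shows "(\<integral>\<^sup>+A. ennreal ((dot N (col A k) (mv N (resolvent N \<Delta> A ks) (col A k))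
      - mat_trace N (resolvent N \<Delta> A ks) / real N)\<^sup>2) \<partial>design N p) \<le> ennreal (2 / real N)"
proof -
  let ?\<sigma> = "sqrt (1 / real N)"
  have \<sigma>: "?\<sigma> > 0" using N by simp
  have \<sigma>4: "?\<sigma> ^ 4 = (1 / real N)\<^sup>2"
    using power_mult[of ?\<sigma> 2 2] by simp
  interpret product_sigma_finite "\<lambda>_::nat \<times> nat. density lborel (normal_density 0 ?\<sigma>)"
    by (rule product_sigma_finite_gauss[OF \<sigma>])
  \<comment> \<open>Fubini splits the design into \<open>?K\<close>, which is column k, and
    \<open>?J\<close>, which contains every column that the resolvent uses.\<close>
  let ?J = "{..<N} \<times> ({..<p} - {k})" and ?K = "{..<N} \<times> {k}"
  interpret J: prob_space "gauss ?\<sigma> ?J" by (rule prob_space_gauss[OF \<sigma>])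
  let ?f = "\<lambda>A. ennreal ((dot N (col A k) (mv N (resolvent N \<Delta> A ks) (col A k))
      - mat_trace N (resolvent N \<Delta> A ks) / real N)\<^sup>2)"
  have un: "{..<N} \<times> {..<p} = ?J \<union> ?K" using k by auto
  have id: "(\<lambda>A. A) \<in> design N p \<rightarrow>\<^sub>M mat_borel N p" by (simp cong: measurable_cong_sets add: sets_gauss)
  have m1: "(\<lambda>A. dot N (col A k) (mv N (resolvent N \<Delta> A ks) (col A k))) \<in> borel_measurable (design N p)"
    by (intro measurable_dot measurable_mv_resolvent[OF id] measurable_col[OF id]) (use k ks in auto)
  have m2: "(\<lambda>A. mat_trace N (resolvent N \<Delta> A ks)) \<in> borel_measurable (design N p)"
    by (rule measurable_mat_trace_resolvent[OF id ks(3)])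
  have "?f \<in> borel_measurable (design N p)"
    using m1 m2 by measurable
  then have "(\<integral>\<^sup>+A. ?f A \<partial>design N p) = (\<integral>\<^sup>+x. (\<integral>\<^sup>+y. ?f (merge ?J ?K (x, y)) \<partial>gauss ?\<sigma> ?K) \<partial>gauss ?\<sigma> ?J)"
    unfolding un by (intro product_nn_integral_fold) auto
  also have "\<dots> \<le> (\<integral>\<^sup>+x. ennreal (2 / real N) \<partial>gauss ?\<sigma> ?J)"
  proof (rule nn_integral_mono)
    fix x assume "x \<in> space (gauss ?\<sigma> ?J)"
    let ?B = "resolvent N \<Delta> x ks"
    let ?C = "\<lambda>a b. ?B (fst a) (fst b) :: real"
    have cg: "resolvent N \<Delta> (merge ?J ?K (x, y)) ks i j = ?B i j" if "i < N" "j < N" for i j y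
      using that ks by (intro resolvent_cong) (auto simp: merge_def)
    have s: "(\<Sum>a\<in>?K. h a) = (\<Sum>i<N. h (i, k))" for h :: "nat \<times> nat \<Rightarrow> real"
      by (simp add: sum.cartesian_product')
    have "?f (merge ?J ?K (x, y)) =
      ennreal (((\<Sum>a\<in>?K. \<Sum>b\<in>?K. ?C a b * (y a * y b)) - ?\<sigma>\<^sup>2 * (\<Sum>a\<in>?K. ?C a a))\<^sup>2)" for y
    proof -
      have "mat_trace N (resolvent N \<Delta> (merge ?J ?K (x, y)) ks) = mat_trace N ?B"
        by (rule mat_trace_cong) (use cg in auto)
      moreover have "dot N (col (merge ?J ?K (x, y)) k) (mv N (resolvent N \<Delta> (merge ?J ?K (x, y)) ks) (col (merge ?J ?K (x, y)) k))
        = (\<Sum>i<N. \<Sum>j<N. ?B i j * (y (i, k) * y (j, k)))"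
      proof -
        have c: "col (merge ?J ?K (x, y)) k i = y (i, k)" if "i < N" for i
          using that by (simp add: col_def merge_def)
        show ?thesis
          unfolding dot_mv_double_sum
          by (intro sum.cong refl) (simp only: lessThan_iff cg c)
      qed
      ultimately show ?thesis
        unfolding s by (simp add: mat_trace_def)
    qed
    then have "(\<integral>\<^sup>+y. ?f (merge ?J ?K (x, y)) \<partial>gauss ?\<sigma> ?K) = ennreal (2 * ?\<sigma> ^ 4 * (\<Sum>a\<in>?K. \<Sum>b\<in>?K. (?C a b)\<^sup>2))"
      using gauss_quad_form_variance[OF \<sigma>, of ?K ?C] resolvent_sym by simp
    also have "\<dots> \<le> ennreal (2 / real N)"
    proof (rule ennreal_leI)
      have "(\<Sum>i<N. \<Sum>j<N. (?B i j)\<^sup>2) \<le> real N"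
        using frobenius_resolvent_le[OF \<Delta> ks(1)] trace_le[OF \<Delta> ks(1)] by (rule order_trans)
      then have "2 * (1 / real N)\<^sup>2 * (\<Sum>i<N. \<Sum>j<N. (?B i j)\<^sup>2) \<le> 2 * (1 / real N)\<^sup>2 * real N"
        by (intro mult_left_mono) auto
      also have "2 * (1 / real N)\<^sup>2 * real N = 2 / real N"
        using N by (simp add: power2_eq_square)
      finally show "2 * ?\<sigma> ^ 4 * (\<Sum>a\<in>?K. \<Sum>b\<in>?K. (?C a b)\<^sup>2) \<le> 2 / real N"
        unfolding s \<sigma>4 by simp
    qed
    finally show "(\<integral>\<^sup>+y. ?f (merge ?J ?K (x, y)) \<partial>gauss ?\<sigma> ?K) \<le> ennreal (2 / real N)" .
  qed
  also have "\<dots> = ennreal (2 / real N)"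
    by (simp add: J.emeasure_space_1)
  finally show ?thesis .
qed

text \<open>In place of Cauchy-Schwarz, |X| \<le> s / 2 + X^2 / (2 s) is integrated; it gives 3 s /
  2, rounded up to 2 s.\<close>

lemma (in prob_space) nn_integral_abs_le:
  assumes X[measurable]: "X \<in> borel_measurable M" and s: "s > 0"
    and le: "(\<integral>\<^sup>+x. ennreal ((X x)\<^sup>2) \<partial>M) \<le> ennreal (2 * s\<^sup>2)"
  shows "(\<integral>\<^sup>+x. ennreal \<bar>X x\<bar> \<partial>M) \<le> ennreal (2 * s)"
proof -
  have "(\<integral>\<^sup>+x. ennreal \<bar>X x\<bar> \<partial>M) \<le> (\<integral>\<^sup>+x. ennreal (s / 2) + ennreal (1 / (2 * s)) * ennreal ((X x)\<^sup>2) \<partial>M)"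
  proof (rule nn_integral_mono)
    fix x
    have "0 \<le> (s - \<bar>X x\<bar>)\<^sup>2 / (2 * s)" using s by simp
    also have "\<dots> = s / 2 + 1 / (2 * s) * (X x)\<^sup>2 - \<bar>X x\<bar>"
      using s by (simp add: field_simps power2_eq_square)
    finally have "ennreal \<bar>X x\<bar> \<le> ennreal (s / 2 + 1 / (2 * s) * (X x)\<^sup>2)" by (intro ennreal_leI) simp
    also have "\<dots> = ennreal (s / 2) + ennreal (1 / (2 * s)) * ennreal ((X x)\<^sup>2)"
      using s by (subst ennreal_plus) (auto simp: ennreal_mult[symmetric])
    finally show "ennreal \<bar>X x\<bar> \<le> ennreal (s / 2) + ennreal (1 / (2 * s)) * ennreal ((X x)\<^sup>2)" .
  qed
  also have "\<dots> = ennreal (s / 2) + ennreal (1 / (2 * s)) * (\<integral>\<^sup>+x. ennreal ((X x)\<^sup>2) \<partial>M)"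
    by (subst nn_integral_add) (auto simp: nn_integral_cmult emeasure_space_1)
  also have "\<dots> \<le> ennreal (s / 2) + ennreal (1 / (2 * s)) * ennreal (2 * s\<^sup>2)"
    by (intro add_left_mono mult_left_mono le) auto
  also have "\<dots> = ennreal (s / 2 + 1 / (2 * s) * (2 * s\<^sup>2))"
    using s by (subst ennreal_plus) (auto simp: ennreal_mult[symmetric])
  also have "\<dots> \<le> ennreal (2 * s)"
    using s by (intro ennreal_leI) (simp add: power2_eq_square)
  finally show ?thesis .
qed

section \<open>Concentration of traces and pivots of the random design\<close>

context
  fixes N p :: nat and \<Delta> :: real
  assumes \<Delta>: "\<Delta> > 0" and N: "N > 0"
begin

interpretation X: prob_space "design N p"
  by (rule prob_space_gauss) (use N in simp)

lemma measurable_id_design: "(\<lambda>A. A) \<in> design N p \<rightarrow>\<^sub>M mat_borel N p"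
  by (simp cong: measurable_cong_sets add: sets_gauss)

lemma measurable_column_form:
  assumes "k < p" "set ks \<subseteq> {..<p}"
  shows "(\<lambda>A. dot N (col A k) (mv N (resolvent N \<Delta> A ks) (col A k)) - mat_trace N (resolvent N \<Delta> A ks) / real N)
    \<in> borel_measurable (design N p)"
proof -
  have "(\<lambda>A. dot N (col A k) (mv N (resolvent N \<Delta> A ks) (col A k))) \<in> borel_measurable (design N p)"
    by (intro measurable_dot measurable_mv_resolvent[OF measurable_id_design] measurable_col[OF measurable_id_design])
      (use assms in auto)
  moreover have "(\<lambda>A. mat_trace N (resolvent N \<Delta> A ks)) \<in> borel_measurable (design N p)"
    by (rule measurable_mat_trace_resolvent[OF measurable_id_design assms(2)])
  ultimately show ?thesis by measurable
qed

lemma column_form_l1: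
  assumes "k < p" "distinct ks" "k \<notin> set ks" "set ks \<subseteq> {..<p}"
  shows "(\<integral>\<^sup>+A. ennreal \<bar>dot N (col A k) (mv N (resolvent N \<Delta> A ks) (col A k))
      - mat_trace N (resolvent N \<Delta> A ks) / real N\<bar> \<partial>design N p) \<le> ennreal (2 / sqrt (real N))"
proof -
  have "(\<integral>\<^sup>+A. ennreal \<bar>dot N (col A k) (mv N (resolvent N \<Delta> A ks) (col A k))
      - mat_trace N (resolvent N \<Delta> A ks) / real N\<bar> \<partial>design N p) \<le> ennreal (2 * (1 / sqrt (real N)))"
  proof (rule X.nn_integral_abs_le)
    show "(\<integral>\<^sup>+A. ennreal ((dot N (col A k) (mv N (resolvent N \<Delta> A ks) (col A k))
      - mat_trace N (resolvent N \<Delta> A ks) / real N)\<^sup>2) \<partial>design N p) \<le> ennreal (2 * (1 / sqrt (real N))\<^sup>2)"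
      using column_form_variance[OF \<Delta> N assms] by (simp add: power_divide)
  qed (use N measurable_column_form assms in auto)
  then show ?thesis by simp
qed

lemma norm_trace_nonneg: "0 \<le> norm_trace N \<Delta> n A"
  unfolding norm_trace_def using trace_nonneg[OF \<Delta>, of "rev [0..<n]"] by simp

lemma measurable_norm_trace:
  assumes "n \<le> p"
  shows "norm_trace N \<Delta> n \<in> borel_measurable (design N p)"
proof -
  have "set (rev [0..<n]) \<subseteq> {..<p}" using assms by auto
  from measurable_mat_trace_resolvent[OF measurable_id_design this]
  show ?thesis unfolding norm_trace_def[abs_def] by measurable
qed

text \<open>Stability of the root turns the fixed point defect into an error bound. Each of the n
  \<le> p leave-one-out forms contributes 2 / sqrt N + 1 / N, which is at most 3 / sqrt N.\<close>

lemma norm_trace_l1: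
  assumes n: "n \<le> p"
  shows "(\<integral>\<^sup>+A. ennreal \<bar>norm_trace N \<Delta> n A - mp_root \<Delta> (real n / real N)\<bar> \<partial>design N p)
     \<le> ennreal (3 * real p / (real N * \<Delta> * sqrt (real N)))"
proof -
  let ?ks = "rev [0..<n]"
  let ?r = "\<lambda>k. filter (\<lambda>l. l \<noteq> k) ?ks"
  let ?e = "\<lambda>k A. \<bar>dot N (col A k) (mv N (resolvent N \<Delta> A (?r k)) (col A k))
         - mat_trace N (resolvent N \<Delta> A (?r k)) / real N\<bar>"
  let ?c = "1 / (real N * \<Delta>)"
  have c: "?c \<ge> 0" using \<Delta> by simp
  have me: "(\<lambda>A. ?e k A) \<in> borel_measurable (design N p)" if "k < n" for k
    by (intro borel_measurable_abs measurable_column_form) (use that n in auto)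
  have "(\<integral>\<^sup>+A. ennreal \<bar>norm_trace N \<Delta> n A - mp_root \<Delta> (real n / real N)\<bar> \<partial>design N p) \<le>
    (\<integral>\<^sup>+A. ennreal ?c * (\<Sum>k<n. ennreal (?e k A) + ennreal (1 / real N)) \<partial>design N p)"
  proof (rule nn_integral_mono)
    fix A
    have "\<bar>norm_trace N \<Delta> n A - mp_root \<Delta> (real n / real N)\<bar> \<le>
       \<bar>1 - norm_trace N \<Delta> n A - real n / real N * (norm_trace N \<Delta> n A / (\<Delta> + norm_trace N \<Delta> n A))\<bar>"
      by (rule mp_root_stable[OF \<Delta>]) (auto simp: norm_trace_nonneg)
    also have "\<dots> \<le> ?c * (\<Sum>k<n. ?e k A + 1 / real N)"
      using trace_fixed_point[OF \<Delta> N, of ?ks A] unfolding norm_trace_def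
      by (simp add: atLeast0LessThan)
    finally have "ennreal \<bar>norm_trace N \<Delta> n A - mp_root \<Delta> (real n / real N)\<bar> \<le> ennreal (?c * (\<Sum>k<n. ?e k A + 1 / real N))"
      by (rule ennreal_leI)
    also have "\<dots> = ennreal ?c * (\<Sum>k<n. ennreal (?e k A) + ennreal (1 / real N))"
    proof -
      have "ennreal (\<Sum>k<n. ?e k A + 1 / real N) = (\<Sum>k<n. ennreal (?e k A) + ennreal (1 / real N))"
        by (subst sum_ennreal[symmetric]) (auto simp: sum_nonneg intro!: sum.cong ennreal_plus)
      moreover have "0 \<le> (\<Sum>k<n. ?e k A + 1 / real N)" by (intro sum_nonneg) auto
      ultimately show ?thesis using c by (simp only: ennreal_mult)
    qed
    finally show "ennreal \<bar>norm_trace N \<Delta> n A - mp_root \<Delta> (real n / real N)\<bar> \<le>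
        ennreal ?c * (\<Sum>k<n. ennreal (?e k A) + ennreal (1 / real N))" .
  qed
  also have "\<dots> = ennreal ?c * (\<Sum>k<n. (\<integral>\<^sup>+A. ennreal (?e k A) \<partial>design N p) + ennreal (1 / real N))"
  proof (subst nn_integral_cmult)
    show "(\<lambda>A. \<Sum>k<n. ennreal (?e k A) + ennreal (1 / real N)) \<in> borel_measurable (design N p)"
      by (intro borel_measurable_sum borel_measurable_add measurable_compose[OF me measurable_ennreal]) auto
    show "ennreal ?c * (\<integral>\<^sup>+A. (\<Sum>k<n. ennreal (?e k A) + ennreal (1 / real N)) \<partial>design N p) =
      ennreal ?c * (\<Sum>k<n. (\<integral>\<^sup>+A. ennreal (?e k A) \<partial>design N p) + ennreal (1 / real N))"
      by (subst nn_integral_sum)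
        (auto intro!: borel_measurable_add measurable_compose[OF me measurable_ennreal] sum.cong arg_cong2[where f="(*)"]
          simp: nn_integral_add[OF measurable_compose[OF me measurable_ennreal]] X.emeasure_space_1)
  qed
  also have "\<dots> \<le> ennreal ?c * (\<Sum>k<n. ennreal (2 / sqrt (real N)) + ennreal (1 / real N))"
    by (intro mult_left_mono sum_mono add_right_mono column_form_l1) (use n in auto)
  also have "\<dots> = ennreal (?c * (real n * (2 / sqrt (real N) + 1 / real N)))"
  proof -
    have d: "ennreal (2 / sqrt (real N)) + ennreal (1 / real N) = ennreal (2 / sqrt (real N) + 1 / real N)"
      by (rule ennreal_plus[symmetric]) auto
    have e: "ennreal ?c * (ennreal (real n) * ennreal d) = ennreal (?c * (real n * d))" if "0 \<le> d" for d
      using c that by (simp only: ennreal_mult mult_nonneg_nonneg of_nat_0_le_iff)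
    show ?thesis
      unfolding d sum_constant card_lessThan ennreal_of_nat_eq_real_of_nat by (rule e) simp
  qed
  also have "\<dots> \<le> ennreal (?c * (real p * (3 / sqrt (real N))))"
  proof (intro ennreal_leI mult_left_mono c mult_mono)
    have "1 \<le> sqrt (real N)" using N by simp
    then have "1 * sqrt (real N) \<le> sqrt (real N) * sqrt (real N)" by (intro mult_right_mono) auto
    then have "sqrt (real N) \<le> real N" by simp
    then have "1 / real N \<le> 1 / sqrt (real N)" using N by (intro divide_left_mono) auto
    then show "2 / sqrt (real N) + 1 / real N \<le> 3 / sqrt (real N)"
      by (simp add: divide_inverse)
  qed (use n in auto)
  finally show ?thesis by (simp add: mult_ac)
qed

text \<open>Pivot k pairs column k with a resolvent of earlier columns only, so it is close to the
  normalised trace, and that is close to the root at s = k / N. The logarithm ln(1 + u / \<Delta>)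
  is 1 / \<Delta>-Lipschitz, so the errors of the p terms add up.\<close>

lemma log_pivot_l1:
  "(\<integral>\<^sup>+A. ennreal \<bar>(\<Sum>k<p. ln (1 + pivot N \<Delta> A k / \<Delta>)) - (\<Sum>k<p. ln (1 + mp_root \<Delta> (real k / real N) / \<Delta>))\<bar> \<partial>design N p)
   \<le> ennreal (real p / \<Delta> * (2 / sqrt (real N) + 3 * real p / (real N * \<Delta> * sqrt (real N))))"
proof -
  let ?a = "\<lambda>k A. \<bar>dot N (col A k) (mv N (resolvent N \<Delta> A (rev [0..<k])) (col A k))
      - mat_trace N (resolvent N \<Delta> A (rev [0..<k])) / real N\<bar>"
  let ?b = "\<lambda>k A. \<bar>norm_trace N \<Delta> k A - mp_root \<Delta> (real k / real N)\<bar>"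
  have ma: "(\<lambda>A. ennreal (?a k A)) \<in> borel_measurable (design N p)" if "k < p" for k
    by (intro measurable_compose[OF _ measurable_ennreal] borel_measurable_abs measurable_column_form)
      (use that in auto)
  have mb: "(\<lambda>A. ennreal (?b k A)) \<in> borel_measurable (design N p)" if "k < p" for k
    using measurable_norm_trace[of k] that by auto
  have lip: "\<bar>ln (1 + u / \<Delta>) - ln (1 + w / \<Delta>)\<bar> \<le> \<bar>u - w\<bar> / \<Delta>" if "0 \<le> u" "0 \<le> w" for u w :: real
  proof -
    have *: "ln (1 + u / \<Delta>) - ln (1 + w / \<Delta>) \<le> \<bar>u - w\<bar> / \<Delta>" if "0 \<le> u" "0 \<le> w" for u w :: real
    proof -
      have p: "0 < 1 + u / \<Delta>" "0 < 1 + w / \<Delta>" "1 \<le> 1 + w / \<Delta>" using that \<Delta> by (auto simp: add_pos_nonneg)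
      have "ln (1 + u / \<Delta>) - ln (1 + w / \<Delta>) = ln ((1 + u / \<Delta>) / (1 + w / \<Delta>))"
        using p by (simp add: ln_div)
      also have "\<dots> \<le> (1 + u / \<Delta>) / (1 + w / \<Delta>) - 1"
        using p by (intro ln_le_minus_one) auto
      also have "\<dots> = ((1 + u / \<Delta>) - (1 + w / \<Delta>)) / (1 + w / \<Delta>)"
        using p by (subst diff_divide_distrib) simp
      also have "(1 + u / \<Delta>) - (1 + w / \<Delta>) = (u - w) / \<Delta>"
        by (simp add: diff_divide_distrib)
      also have "(u - w) / \<Delta> / (1 + w / \<Delta>) \<le> \<bar>u - w\<bar> / \<Delta> / (1 + w / \<Delta>)"
        using p \<Delta> by (intro divide_right_mono) auto
      also have "\<dots> \<le> \<bar>u - w\<bar> / \<Delta> / 1"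
        using p \<Delta> by (intro divide_left_mono) auto
      finally show ?thesis by simp
    qed
    show ?thesis using *[OF that] *[OF that(2,1)] by (simp add: abs_le_iff abs_minus_commute)
  qed
  have "(\<integral>\<^sup>+A. ennreal \<bar>(\<Sum>k<p. ln (1 + pivot N \<Delta> A k / \<Delta>)) - (\<Sum>k<p. ln (1 + mp_root \<Delta> (real k / real N) / \<Delta>))\<bar> \<partial>design N p)
    \<le> (\<integral>\<^sup>+A. (\<Sum>k<p. ennreal (1 / \<Delta>) * (ennreal (?a k A) + ennreal (?b k A))) \<partial>design N p)"
  proof (rule nn_integral_mono)
    fix A
    have "\<bar>(\<Sum>k<p. ln (1 + pivot N \<Delta> A k / \<Delta>)) - (\<Sum>k<p. ln (1 + mp_root \<Delta> (real k / real N) / \<Delta>))\<bar>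
      \<le> (\<Sum>k<p. \<bar>ln (1 + pivot N \<Delta> A k / \<Delta>) - ln (1 + mp_root \<Delta> (real k / real N) / \<Delta>)\<bar>)"
      unfolding sum_subtractf[symmetric] by (rule sum_abs)
    also have "\<dots> \<le> (\<Sum>k<p. 1 / \<Delta> * (?a k A + ?b k A))"
    proof (rule sum_mono)
      fix k
      have "\<bar>ln (1 + pivot N \<Delta> A k / \<Delta>) - ln (1 + mp_root \<Delta> (real k / real N) / \<Delta>)\<bar>
        \<le> \<bar>pivot N \<Delta> A k - mp_root \<Delta> (real k / real N)\<bar> / \<Delta>"
        using pivot_nonneg[OF \<Delta>] mp_root_pos[OF \<Delta>, of "real k / real N"] by (intro lip) auto
      also have "\<dots> \<le> (?a k A + ?b k A) / \<Delta>"
        using \<Delta> by (intro divide_right_mono) (auto simp: pivot_def norm_trace_def)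
      finally show "\<bar>ln (1 + pivot N \<Delta> A k / \<Delta>) - ln (1 + mp_root \<Delta> (real k / real N) / \<Delta>)\<bar> \<le> 1 / \<Delta> * (?a k A + ?b k A)"
        by simp
    qed
    finally have "ennreal \<bar>(\<Sum>k<p. ln (1 + pivot N \<Delta> A k / \<Delta>)) - (\<Sum>k<p. ln (1 + mp_root \<Delta> (real k / real N) / \<Delta>))\<bar>
      \<le> ennreal (\<Sum>k<p. 1 / \<Delta> * (?a k A + ?b k A))" by (rule ennreal_leI)
    also have "\<dots> = (\<Sum>k<p. ennreal (1 / \<Delta>) * (ennreal (?a k A) + ennreal (?b k A)))"
    proof -
      have e: "ennreal (1 / \<Delta> * (a + b)) = ennreal (1 / \<Delta>) * (ennreal a + ennreal b)"
        if "0 \<le> a" "0 \<le> b" for a b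
        using that \<Delta> by (subst ennreal_mult) auto
      have "ennreal (\<Sum>k<p. 1 / \<Delta> * (?a k A + ?b k A)) = (\<Sum>k<p. ennreal (1 / \<Delta> * (?a k A + ?b k A)))"
        using \<Delta> by (intro sum_ennreal[symmetric]) auto
      then show ?thesis
        by (simp only: e abs_ge_zero)
    qed
    finally show "ennreal \<bar>(\<Sum>k<p. ln (1 + pivot N \<Delta> A k / \<Delta>)) - (\<Sum>k<p. ln (1 + mp_root \<Delta> (real k / real N) / \<Delta>))\<bar>
      \<le> (\<Sum>k<p. ennreal (1 / \<Delta>) * (ennreal (?a k A) + ennreal (?b k A)))" .
  qed
  also have "\<dots> = (\<Sum>k<p. ennreal (1 / \<Delta>) * ((\<integral>\<^sup>+A. ennreal (?a k A) \<partial>design N p) + (\<integral>\<^sup>+A. ennreal (?b k A) \<partial>design N p)))"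
  proof (subst nn_integral_sum)
    show "(\<lambda>A. ennreal (1 / \<Delta>) * (ennreal (?a k A) + ennreal (?b k A))) \<in> borel_measurable (design N p)"
      if "k \<in> {..<p}" for k
    proof -
      have "k < p" using that by simp
      note [measurable] = ma[OF this] mb[OF this]
      show ?thesis by measurable
    qed
    show "(\<Sum>k<p. \<integral>\<^sup>+A. ennreal (1 / \<Delta>) * (ennreal (?a k A) + ennreal (?b k A)) \<partial>design N p) =
      (\<Sum>k<p. ennreal (1 / \<Delta>) * ((\<integral>\<^sup>+A. ennreal (?a k A) \<partial>design N p) + (\<integral>\<^sup>+A. ennreal (?b k A) \<partial>design N p)))"
    proof (rule sum.cong[OF refl])
      fix k assume "k \<in> {..<p}"
      then have k: "k < p" by simp
      show "(\<integral>\<^sup>+A. ennreal (1 / \<Delta>) * (ennreal (?a k A) + ennreal (?b k A)) \<partial>design N p) =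
        ennreal (1 / \<Delta>) * ((\<integral>\<^sup>+A. ennreal (?a k A) \<partial>design N p) + (\<integral>\<^sup>+A. ennreal (?b k A) \<partial>design N p))"
        by (subst nn_integral_cmult[OF borel_measurable_add[OF ma[OF k] mb[OF k]]])
          (simp only: nn_integral_add[OF ma[OF k] mb[OF k]])
    qed
  qed
  also have "\<dots> \<le> (\<Sum>k<p. ennreal (1 / \<Delta>) * (ennreal (2 / sqrt (real N)) + ennreal (3 * real p / (real N * \<Delta> * sqrt (real N)))))"
    by (intro sum_mono mult_left_mono add_mono column_form_l1 norm_trace_l1) auto
  also have "\<dots> = ennreal (real p / \<Delta> * (2 / sqrt (real N) + 3 * real p / (real N * \<Delta> * sqrt (real N))))"
  proof -
    have "ennreal (1 / \<Delta>) * (ennreal (2 / sqrt (real N)) + ennreal (3 * real p / (real N * \<Delta> * sqrt (real N)))) =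
      ennreal (1 / \<Delta> * (2 / sqrt (real N) + 3 * real p / (real N * \<Delta> * sqrt (real N))))"
      using \<Delta> by (subst ennreal_mult) auto
    then show ?thesis
      using \<Delta> by (simp only: sum_constant card_lessThan ennreal_of_nat_eq_real_of_nat)
        (subst ennreal_mult[symmetric], auto simp: mult_ac)
  qed
  finally show ?thesis .
qed

lemma design_sq_norm:
  "(\<integral>\<^sup>+A. ennreal (\<Sum>k<p. dot N (col A k) (col A k)) \<partial>design N p) = ennreal (real p)"
proof -
  let ?I = "{..<N} \<times> {..<p}" and ?\<sigma> = "sqrt (1 / real N)"
  have \<sigma>: "?\<sigma> > 0" using N by simp
  let ?B = "\<lambda>a b. if a = b then 1 else (0::real)"
  have eq: "(\<Sum>k<p. dot N (col A k) (col A k)) = (\<Sum>a\<in>?I. \<Sum>b\<in>?I. ?B a b * (A a * A b))" for A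
  proof -
    have "(\<Sum>a\<in>?I. \<Sum>b\<in>?I. ?B a b * (A a * A b)) = (\<Sum>a\<in>?I. \<Sum>b\<in>?I. if a = b then A a * A b else 0)"
      by (intro sum.cong refl) auto
    also have "\<dots> = (\<Sum>a\<in>?I. A a * A a)"
      by (intro sum.cong refl) simp
    also have "\<dots> = (\<Sum>i<N. \<Sum>k<p. A (i, k) * A (i, k))"
      by (simp add: sum.cartesian_product')
    also have "\<dots> = (\<Sum>k<p. dot N (col A k) (col A k))"
      by (subst sum.swap) (simp add: dot_def col_def)
    finally show ?thesis ..
  qed
  have fin: "finite ?I" by simp
  have "(\<integral>\<^sup>+A. ennreal (\<Sum>k<p. dot N (col A k) (col A k)) \<partial>design N p) =
    ennreal (\<integral>A. (\<Sum>k<p. dot N (col A k) (col A k)) \<partial>design N p)"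
    using gauss_quad_form(1)[OF \<sigma> fin, of ?B] unfolding eq[symmetric]
    by (rule nn_integral_eq_integral) (simp add: dot_self_nonneg sum_nonneg)
  also have "(\<integral>A. (\<Sum>k<p. dot N (col A k) (col A k)) \<partial>design N p) = ?\<sigma>\<^sup>2 * (\<Sum>a\<in>?I. ?B a a)"
    using gauss_quad_form(2)[OF \<sigma> fin, of ?B] unfolding eq[symmetric] .
  also have "\<dots> = real p" using N by simp
  finally show ?thesis .
qed

end

section \<open>Quadratic forms of the observation\<close>

lemma square_sum2_le: "(a + b)\<^sup>2 \<le> 2 * (a\<^sup>2 + (b::real)\<^sup>2)"
proof -
  have "0 \<le> (a - b)\<^sup>2" by simp
  then show ?thesis by (simp add: power2_eq_square algebra_simps)
qed

lemma square_sum3_le: "(a + b + c)\<^sup>2 \<le> 3 * (a\<^sup>2 + b\<^sup>2 + (c::real)\<^sup>2)"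
proof -
  have "0 \<le> (a - b)\<^sup>2 + (b - c)\<^sup>2 + (a - c)\<^sup>2" by simp
  then show ?thesis by (simp add: power2_eq_square algebra_simps)
qed

lemma mv_sum_right: "mv n B (\<lambda>i. \<Sum>k\<in>S. f k i) i = (\<Sum>k\<in>S. mv n B (f k) i)"
  unfolding mv_def by (subst sum.swap) (simp add: sum_distrib_left)

lemma mv_scale_right: "mv n B (\<lambda>i. c * u i) i = c * mv n B u i"
  by (simp add: mv_def sum_distrib_left mult_ac)

lemma mv_add_right: "mv n B (\<lambda>i. u i + v i) i = mv n B u i + mv n B v i"
  by (simp add: mv_def algebra_simps sum.distrib)

section \<open>Variance of a quadratic form of the observation, for a general matrix
  \<open>K\<close>\<close>

context
  fixes N p :: nat and \<Delta> :: real and A :: "nat \<times> nat \<Rightarrow> real" and K :: "nat \<Rightarrow> nat \<Rightarrow> real"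
  assumes N: "N > 0" and p: "p > 0" and \<Delta>: "\<Delta> > 0"
    and K_sym: "\<And>i j. K i j = K j i" and K_nonneg: "\<And>u. 0 \<le> dot N u (mv N K u)"
begin

lemma observation_form:
  "dot N (observation N p \<Delta> A b e) (mv N K (observation N p \<Delta> A b e)) =
    (\<Sum>k<p. \<Sum>l<p. dot N (col A k) (mv N K (col A l)) * (b k * b l))
     + 2 * sqrt \<Delta> * (\<Sum>i<N. e i * (\<Sum>k<p. mv N K (col A k) i * b k))
     + \<Delta> * (\<Sum>i<N. \<Sum>j<N. K i j * (e i * e j))"
proof -
  define m where "m i = (\<Sum>k<p. b k * col A k i)" for i
  have obs: "observation N p \<Delta> A b e i = m i + sqrt \<Delta> * e i" if "i < N" for i
    using that by (simp add: observation_def mat_vec_def m_def col_def mult.commute)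
  have mvm: "mv N K m = (\<lambda>i. \<Sum>k<p. mv N K (col A k) i * b k)"
    unfolding m_def by (rule ext) (simp add: mv_sum_right mv_scale_right mult.commute)
  have mvo: "mv N K (\<lambda>i. m i + sqrt \<Delta> * e i) = (\<lambda>i. mv N K m i + sqrt \<Delta> * mv N K e i)"
    by (rule ext) (simp add: mv_add_right mv_scale_right)
  have "dot N (observation N p \<Delta> A b e) (mv N K (observation N p \<Delta> A b e)) =
     dot N (\<lambda>i. m i + sqrt \<Delta> * e i) (mv N K (\<lambda>i. m i + sqrt \<Delta> * e i))"
    by (intro dot_cong obs mv_cong) auto
  also have "\<dots> = dot N m (mv N K m) + sqrt \<Delta> * dot N m (mv N K e) + sqrt \<Delta> * dot N e (mv N K m)
       + (sqrt \<Delta> * sqrt \<Delta>) * dot N e (mv N K e)"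
    unfolding mvo by (simp only: dot_add_left dot_add_right dot_scale_left dot_scale_right distrib_left add.assoc mult.assoc)
  also have "dot N m (mv N K e) = dot N e (mv N K m)"
    using dot_mv_sym[where B=K and n=N and u=m and v=e, OF K_sym] dot_commute[of N "mv N K m" e] by simp
  also have "sqrt \<Delta> * sqrt \<Delta> = \<Delta>" using \<Delta> by simp
  also have "dot N m (mv N K m) = (\<Sum>k<p. \<Sum>l<p. dot N (col A k) (mv N K (col A l)) * (b k * b l))"
  proof -
    have "dot N m (mv N K m) = (\<Sum>k<p. b k * (\<Sum>l<p. b l * dot N (col A k) (mv N K (col A l))))"
      unfolding mvm m_def
      by (simp only: dot_sum_left dot_sum_right dot_scale_left dot_scale_right mult.commute[of _ "b _"] sum_distrib_left)
    then show ?thesis by (simp add: sum_distrib_left mult_ac)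
  qed
  also have "dot N e (mv N K e) = (\<Sum>i<N. \<Sum>j<N. K i j * (e i * e j))"
    by (rule dot_mv_double_sum)
  also have "dot N e (mv N K m) = (\<Sum>i<N. e i * (\<Sum>k<p. mv N K (col A k) i * b k))"
    unfolding mvm by (simp add: dot_def)
  finally show ?thesis by (simp add: algebra_simps)
qed

text \<open>Integrating the noise first leaves a nonnegative quadratic form in the signal, whose
  spherical mean is its trace.\<close>

lemma nn_integral_cross_term:
  "(\<integral>\<^sup>+b. (\<integral>\<^sup>+e. ennreal ((\<Sum>i<N. e i * (\<Sum>k<p. mv N K (col A k) i * b k))\<^sup>2) \<partial>gauss 1 {..<N}) \<partial>sphere_uniform p)
    = ennreal (\<Sum>k<p. dot N (mv N K (col A k)) (mv N K (col A k)))"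
proof -
  let ?c = "\<lambda>i k. mv N K (col A k) i"
  have e: "(\<integral>\<^sup>+e. ennreal ((\<Sum>i<N. e i * w i)\<^sup>2) \<partial>gauss 1 {..<N}) = ennreal (\<Sum>i<N. w i * w i)" for w :: "nat \<Rightarrow> real"
  proof -
    have eq: "(\<Sum>i<N. e i * w i)\<^sup>2 = (\<Sum>i<N. \<Sum>j<N. w i * w j * (e i * e j))" for e :: "nat \<Rightarrow> real"
      unfolding power2_eq_square sum_product by (intro sum.cong refl) (simp add: mult_ac)
    show ?thesis
      unfolding eq by (rule nn_integral_quad_form[OF N]) (simp add: eq[symmetric])
  qed
  have eq: "(\<Sum>i<N. (\<Sum>k<p. ?c i k * b k) * (\<Sum>k<p. ?c i k * b k)) =
      (\<Sum>k<p. \<Sum>l<p. (\<Sum>i<N. ?c i k * ?c i l) * (b k * b l))" for b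
  proof -
    have "(\<Sum>i<N. (\<Sum>k<p. ?c i k * b k) * (\<Sum>k<p. ?c i k * b k)) =
      (\<Sum>i<N. \<Sum>k<p. \<Sum>l<p. ?c i k * ?c i l * (b k * b l))"
      unfolding sum_product by (intro sum.cong refl) (simp add: mult_ac)
    also have "\<dots> = (\<Sum>k<p. \<Sum>i<N. \<Sum>l<p. ?c i k * ?c i l * (b k * b l))"
      by (rule sum.swap)
    also have "\<dots> = (\<Sum>k<p. \<Sum>l<p. \<Sum>i<N. ?c i k * ?c i l * (b k * b l))"
      by (intro sum.cong refl sum.swap)
    finally show ?thesis by (simp add: sum_distrib_right)
  qed
  have "(\<integral>\<^sup>+b. (\<integral>\<^sup>+e. ennreal ((\<Sum>i<N. e i * (\<Sum>k<p. ?c i k * b k))\<^sup>2) \<partial>gauss 1 {..<N}) \<partial>sphere_uniform p)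
     = (\<integral>\<^sup>+b. ennreal (\<Sum>k<p. \<Sum>l<p. (\<Sum>i<N. ?c i k * ?c i l) * (b k * b l)) \<partial>sphere_uniform p)"
    unfolding e eq ..
  also have "\<dots> = ennreal (\<Sum>k<p. \<Sum>i<N. ?c i k * ?c i k)"
    by (rule sphere_quad_form[OF p]) (simp add: eq[symmetric] sum_nonneg)
  finally show ?thesis by (simp add: dot_def)
qed

text \<open>\<open>T\<close> is the mean of the form for a fixed design. The deviation splits into
  the signal form, the signal-noise cross term and the noise form, with second moments at most 2, 4
  and 2 times \<Delta>^2 N. Squaring a sum of three terms costs a factor 3, hence 24.\<close>

lemma observation_form_variance:
  assumes 1: "(\<Sum>k<p. \<Sum>l<p. (dot N (col A k) (mv N K (col A l)))\<^sup>2) \<le> \<Delta>\<^sup>2 * real N"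
    and 2: "(\<Sum>k<p. dot N (mv N K (col A k)) (mv N K (col A k))) \<le> \<Delta> * real N"
    and 3: "(\<Sum>i<N. \<Sum>j<N. (K i j)\<^sup>2) \<le> real N"
    and T: "T = (\<Sum>k<p. dot N (col A k) (mv N K (col A k))) + \<Delta> * mat_trace N K"
  shows "(\<integral>\<^sup>+b. (\<integral>\<^sup>+e. ennreal ((dot N (observation N p \<Delta> A b e) (mv N K (observation N p \<Delta> A b e)) - T)\<^sup>2)
     \<partial>gauss 1 {..<N}) \<partial>sphere_uniform p) \<le> ennreal (24 * \<Delta>\<^sup>2 * real N)"
proof -
  interpret S: prob_space "sphere_uniform p" by (rule prob_space_sphere_uniform)
  interpret G: prob_space "gauss 1 {..<N}" by (rule prob_space_gauss) simp
  let ?B = "\<lambda>k l. dot N (col A k) (mv N K (col A l))"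
  let ?Q1 = "\<lambda>b. (\<Sum>k<p. \<Sum>l<p. ?B k l * (b k * b l)) - (\<Sum>k<p. ?B k k)"
  let ?C = "\<lambda>b e. \<Sum>i<N. e i * (\<Sum>k<p. mv N K (col A k) i * b k)"
  let ?Q2 = "\<lambda>e. (\<Sum>i<N. \<Sum>j<N. K i j * (e i * e j)) - (\<Sum>i<N. K i i)"
  have B_sym: "?B k l = ?B l k" for k l
    using dot_mv_sym[where B=K and n=N and u="col A k" and v="col A l", OF K_sym]
      dot_commute[of N "mv N K (col A k)" "col A l"] by simp
  \<comment> \<open>With the noise set to 0, the form of the observation is exactly the signal
    form.\<close>
  have B_nonneg: "0 \<le> (\<Sum>k<p. \<Sum>l<p. ?B k l * (b k * b l))" for b
  proof -
    have "0 \<le> dot N (observation N p \<Delta> A b (\<lambda>_. 0)) (mv N K (observation N p \<Delta> A b (\<lambda>_. 0)))"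
      by (rule K_nonneg)
    then show ?thesis unfolding observation_form by simp
  qed
  have m1: "?Q1 \<in> borel_measurable (sphere_uniform p)"
    unfolding measurable_cong_sets[OF sets_sphere_uniform refl] by measurable
  have m2: "?Q2 \<in> borel_measurable (gauss 1 {..<N})"
    unfolding measurable_cong_sets[OF sets_gauss refl] by measurable
  have mC: "(\<lambda>e. ?C b e) \<in> borel_measurable (gauss 1 {..<N})" for b
    unfolding measurable_cong_sets[OF sets_gauss refl] by measurable
  have mC2: "(\<lambda>b. \<integral>\<^sup>+e. ennreal ((?C b e)\<^sup>2) \<partial>gauss 1 {..<N}) \<in> borel_measurable (sphere_uniform p)"
  proof -
    have [measurable]: "(\<lambda>x. fst x i) \<in> borel_measurable (sphere_uniform p \<Otimes>\<^sub>M gauss 1 {..<N})" if "i < p" for i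
      using measurable_fst[of "sphere_uniform p" "gauss 1 {..<N}"] that
      unfolding measurable_cong_sets[OF refl sets_sphere_uniform] by (rule measurable_vec_component)
    have [measurable]: "(\<lambda>x. snd x i) \<in> borel_measurable (sphere_uniform p \<Otimes>\<^sub>M gauss 1 {..<N})" if "i < N" for i
      using measurable_snd[of "sphere_uniform p" "gauss 1 {..<N}"] that
      unfolding measurable_cong_sets[OF refl sets_gauss] by (rule measurable_vec_component)
    have "(\<lambda>x. ?C (fst x) (snd x)) \<in> borel_measurable (sphere_uniform p \<Otimes>\<^sub>M gauss 1 {..<N})"
      by (intro borel_measurable_sum borel_measurable_times) auto
    then have "(\<lambda>x. ennreal ((?C (fst x) (snd x))\<^sup>2)) \<in> borel_measurable (sphere_uniform p \<Otimes>\<^sub>M gauss 1 {..<N})"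
      by measurable
    then show ?thesis
      by (intro G.borel_measurable_nn_integral) (simp add: case_prod_unfold)
  qed
  have "(\<integral>\<^sup>+b. (\<integral>\<^sup>+e. ennreal ((dot N (observation N p \<Delta> A b e) (mv N K (observation N p \<Delta> A b e)) - T)\<^sup>2)
      \<partial>gauss 1 {..<N}) \<partial>sphere_uniform p) \<le>
    (\<integral>\<^sup>+b. (\<integral>\<^sup>+e. 3 * (ennreal ((?Q1 b)\<^sup>2) + (ennreal (4 * \<Delta>) * ennreal ((?C b e)\<^sup>2)
        + ennreal (\<Delta>\<^sup>2) * ennreal ((?Q2 e)\<^sup>2))) \<partial>gauss 1 {..<N}) \<partial>sphere_uniform p)"
  proof (intro nn_integral_mono)
    fix b e
    have "dot N (observation N p \<Delta> A b e) (mv N K (observation N p \<Delta> A b e)) - T =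
      ?Q1 b + 2 * sqrt \<Delta> * ?C b e + \<Delta> * ?Q2 e"
      unfolding observation_form T mat_trace_def by (simp add: algebra_simps)
    then have "(dot N (observation N p \<Delta> A b e) (mv N K (observation N p \<Delta> A b e)) - T)\<^sup>2
       \<le> 3 * ((?Q1 b)\<^sup>2 + (2 * sqrt \<Delta> * ?C b e)\<^sup>2 + (\<Delta> * ?Q2 e)\<^sup>2)"
      using square_sum3_le by simp
    also have "\<dots> = 3 * ((?Q1 b)\<^sup>2 + (4 * \<Delta> * (?C b e)\<^sup>2 + \<Delta>\<^sup>2 * (?Q2 e)\<^sup>2))"
      using \<Delta> by (simp add: power_mult_distrib)
    finally have "ennreal ((dot N (observation N p \<Delta> A b e) (mv N K (observation N p \<Delta> A b e)) - T)\<^sup>2)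
      \<le> ennreal (3 * ((?Q1 b)\<^sup>2 + (4 * \<Delta> * (?C b e)\<^sup>2 + \<Delta>\<^sup>2 * (?Q2 e)\<^sup>2)))" by (rule ennreal_leI)
    also have "\<dots> = 3 * (ennreal ((?Q1 b)\<^sup>2) + (ennreal (4 * \<Delta>) * ennreal ((?C b e)\<^sup>2)
        + ennreal (\<Delta>\<^sup>2) * ennreal ((?Q2 e)\<^sup>2)))"
    proof -
      have "ennreal (3 * (q + (4 * \<Delta> * c + \<Delta>\<^sup>2 * d))) = 3 * (ennreal q + (ennreal (4 * \<Delta>) * ennreal c + ennreal (\<Delta>\<^sup>2) * ennreal d))"
        if "0 \<le> q" "0 \<le> c" "0 \<le> d" for q c d
        using that \<Delta> by (simp only: ennreal_mult ennreal_plus mult_nonneg_nonneg add_nonneg_nonneg zero_le_power2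
            zero_le_numeral less_imp_le ennreal_numeral)
      then show ?thesis by (simp only: zero_le_power2)
    qed
    finally show "ennreal ((dot N (observation N p \<Delta> A b e) (mv N K (observation N p \<Delta> A b e)) - T)\<^sup>2)
      \<le> 3 * (ennreal ((?Q1 b)\<^sup>2) + (ennreal (4 * \<Delta>) * ennreal ((?C b e)\<^sup>2)
        + ennreal (\<Delta>\<^sup>2) * ennreal ((?Q2 e)\<^sup>2)))" .
  qed
  also have "\<dots> = (\<integral>\<^sup>+b. 3 * (ennreal ((?Q1 b)\<^sup>2) + (ennreal (4 * \<Delta>) * (\<integral>\<^sup>+e. ennreal ((?C b e)\<^sup>2) \<partial>gauss 1 {..<N})
        + ennreal (\<Delta>\<^sup>2) * (\<integral>\<^sup>+e. ennreal ((?Q2 e)\<^sup>2) \<partial>gauss 1 {..<N}))) \<partial>sphere_uniform p)"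
  proof (intro nn_integral_cong)
    fix b
    note [measurable] = m2 mC
    show "(\<integral>\<^sup>+e. 3 * (ennreal ((?Q1 b)\<^sup>2) + (ennreal (4 * \<Delta>) * ennreal ((?C b e)\<^sup>2)
        + ennreal (\<Delta>\<^sup>2) * ennreal ((?Q2 e)\<^sup>2))) \<partial>gauss 1 {..<N}) =
       3 * (ennreal ((?Q1 b)\<^sup>2) + (ennreal (4 * \<Delta>) * (\<integral>\<^sup>+e. ennreal ((?C b e)\<^sup>2) \<partial>gauss 1 {..<N})
        + ennreal (\<Delta>\<^sup>2) * (\<integral>\<^sup>+e. ennreal ((?Q2 e)\<^sup>2) \<partial>gauss 1 {..<N})))"
      by (subst nn_integral_cmult, measurable, subst nn_integral_add, measurable, subst nn_integral_add, measurable,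
          subst nn_integral_cmult, measurable, subst nn_integral_cmult, measurable, simp add: G.emeasure_space_1)
  qed
  also have "\<dots> = 3 * ((\<integral>\<^sup>+b. ennreal ((?Q1 b)\<^sup>2) \<partial>sphere_uniform p) + (ennreal (4 * \<Delta>) *
      (\<integral>\<^sup>+b. (\<integral>\<^sup>+e. ennreal ((?C b e)\<^sup>2) \<partial>gauss 1 {..<N}) \<partial>sphere_uniform p)
        + ennreal (\<Delta>\<^sup>2) * (\<integral>\<^sup>+e. ennreal ((?Q2 e)\<^sup>2) \<partial>gauss 1 {..<N})))"
  proof -
    note [measurable] = m1 mC2
    have one: "emeasure (sphere_uniform p) (space (vec_borel p)) = 1" using S.emeasure_space_1 by simp
    show ?thesis
      by (subst nn_integral_cmult, measurable, subst nn_integral_add, measurable, subst nn_integral_add, measurable,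
          subst nn_integral_cmult, measurable, simp add: one)
  qed
  also have "\<dots> \<le> 3 * (ennreal (2 * (\<Delta>\<^sup>2 * real N)) + (ennreal (4 * \<Delta>) * ennreal (\<Delta> * real N) + ennreal (\<Delta>\<^sup>2) * ennreal (2 * real N)))"
  proof (intro mult_left_mono add_mono)
    show "(\<integral>\<^sup>+b. ennreal ((?Q1 b)\<^sup>2) \<partial>sphere_uniform p) \<le> ennreal (2 * (\<Delta>\<^sup>2 * real N))"
      by (rule order_trans[OF sphere_quad_form_variance[OF p B_nonneg B_sym]]) (use 1 in \<open>auto intro!: ennreal_leI\<close>)
    show "(\<integral>\<^sup>+b. (\<integral>\<^sup>+e. ennreal ((?C b e)\<^sup>2) \<partial>gauss 1 {..<N}) \<partial>sphere_uniform p) \<le> ennreal (\<Delta> * real N)"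
      unfolding nn_integral_cross_term using 2 by (rule ennreal_leI)
    have "(\<integral>\<^sup>+e. ennreal ((?Q2 e)\<^sup>2) \<partial>gauss 1 {..<N}) = ennreal (2 * (\<Sum>i<N. \<Sum>j<N. (K i j)\<^sup>2))"
      using gauss_quad_form_variance[of 1 "{..<N}" K] K_sym by simp
    also have "\<dots> \<le> ennreal (2 * real N)" using 3 by (intro ennreal_leI) auto
    finally show "(\<integral>\<^sup>+e. ennreal ((?Q2 e)\<^sup>2) \<partial>gauss 1 {..<N}) \<le> ennreal (2 * real N)" .
  qed auto
  also have "\<dots> = ennreal (3 * (2 * (\<Delta>\<^sup>2 * real N) + (4 * \<Delta> * (\<Delta> * real N) + \<Delta>\<^sup>2 * (2 * real N))))"
    using \<Delta> by (simp only: ennreal_mult ennreal_plus mult_nonneg_nonneg add_nonneg_nonneg zero_le_power2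
            zero_le_numeral less_imp_le ennreal_numeral of_nat_0_le_iff)
  also have "3 * (2 * (\<Delta>\<^sup>2 * real N) + (4 * \<Delta> * (\<Delta> * real N) + \<Delta>\<^sup>2 * (2 * real N))) = 24 * \<Delta>\<^sup>2 * real N"
    by (simp add: power2_eq_square)
  finally show ?thesis .
qed

end

text \<open>The inverse identity v = G v + x x^T G v / \<Delta> exhibits G v as the residual of the
  ridge estimator x^T G v / \<Delta>.\<close>

definition ridge_residual :: "nat \<Rightarrow> real \<Rightarrow> nat \<Rightarrow> (nat \<times> nat \<Rightarrow> real) \<Rightarrow> (nat \<Rightarrow> real) \<Rightarrow> nat \<Rightarrow> real" where
  "ridge_residual N \<Delta> p A v = mv N (resolvent N \<Delta> A (rev [0..<p])) v"

section \<open>The forms belonging to G and G^2, and the norm of the observation\<close>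

context
  fixes N p :: nat and \<Delta> :: real and A :: "nat \<times> nat \<Rightarrow> real"
  assumes N: "N > 0" and p: "p > 0" and \<Delta>: "\<Delta> > 0"
begin

private abbreviation "R \<equiv> resolvent N \<Delta> A (rev [0..<p])"

lemma set_rev_upt: "set (rev [0..<p]) = {..<p}"
  by auto

lemma sum_col_form_le: "(\<Sum>k<p. dot N (col A k) (mv N R (col A k))) \<le> \<Delta> * real N"
  using sum_dot_col_resolvent_le[OF \<Delta>, of "rev [0..<p]" N A] unfolding set_rev_upt by simp

lemma sum_dot_sq_R_le: "(\<Sum>k<p. (dot N (col A k) (mv N R u))\<^sup>2) \<le> \<Delta> * dot N u (mv N R u)"
  using sum_dot_sq_le[OF \<Delta>, of "rev [0..<p]" N A u] unfolding set_rev_upt by simp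

lemma R_contraction: "dot N (mv N R u) (mv N R u) \<le> dot N u u"
  using sq_le_dot_resolvent[OF \<Delta>, of "rev [0..<p]" N A u] dot_resolvent_le[OF \<Delta>, of "rev [0..<p]" N u A] by simp

lemma R_sq_le: "dot N (mv N R u) (mv N R u) \<le> dot N u (mv N R u)"
  by (rule sq_le_dot_resolvent[OF \<Delta>]) simp

lemma frobenius_R_le: "(\<Sum>i<N. \<Sum>j<N. (R i j)\<^sup>2) \<le> real N"
  using frobenius_resolvent_le[OF \<Delta>, of "rev [0..<p]" N A] trace_le[OF \<Delta>, of "rev [0..<p]" N A] by simp

text \<open>The mean is \<Delta> N for every design, because x x^T + \<Delta> I is \<Delta> times
  the inverse of G; this is \<open>trace_resolvent\<close> again.\<close>

lemma resolvent_form_variance: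
  "(\<integral>\<^sup>+b. (\<integral>\<^sup>+e. ennreal ((resolvent_form N \<Delta> p A (observation N p \<Delta> A b e) - \<Delta> * real N)\<^sup>2)
     \<partial>gauss 1 {..<N}) \<partial>sphere_uniform p) \<le> ennreal (24 * \<Delta>\<^sup>2 * real N)"
  unfolding resolvent_form_def
proof (rule observation_form_variance[OF N p \<Delta> resolvent_sym])
  show "0 \<le> dot N u (mv N R u)" for u
    by (rule dot_resolvent_nonneg[OF \<Delta>]) simp
  have "(\<Sum>k<p. \<Sum>l<p. (dot N (col A k) (mv N R (col A l)))\<^sup>2) = (\<Sum>l<p. \<Sum>k<p. (dot N (col A k) (mv N R (col A l)))\<^sup>2)"
    by (rule sum.swap)
  also have "\<dots> \<le> (\<Sum>l<p. \<Delta> * dot N (col A l) (mv N R (col A l)))"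
    by (intro sum_mono sum_dot_sq_R_le)
  also have "\<dots> \<le> \<Delta> * (\<Delta> * real N)"
    unfolding sum_distrib_left[symmetric] using sum_col_form_le \<Delta> by (intro mult_left_mono) auto
  finally show "(\<Sum>k<p. \<Sum>l<p. (dot N (col A k) (mv N R (col A l)))\<^sup>2) \<le> \<Delta>\<^sup>2 * real N"
    by (simp add: power2_eq_square mult.assoc)
  have "(\<Sum>k<p. dot N (mv N R (col A k)) (mv N R (col A k))) \<le> (\<Sum>k<p. dot N (col A k) (mv N R (col A k)))"
    by (intro sum_mono R_sq_le)
  then show "(\<Sum>k<p. dot N (mv N R (col A k)) (mv N R (col A k))) \<le> \<Delta> * real N"
    using sum_col_form_le by linarith
  show "(\<Sum>i<N. \<Sum>j<N. (R i j)\<^sup>2) \<le> real N" by (rule frobenius_R_le)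
  show "\<Delta> * real N = (\<Sum>k<p. dot N (col A k) (mv N R (col A k))) + \<Delta> * mat_trace N R"
    using trace_resolvent[OF \<Delta>, of "rev [0..<p]" N A] \<Delta> unfolding set_rev_upt by (simp add: field_simps)
qed

text \<open>The energy identity \<open>dot_resolvent\<close>, summed over the unit vectors. It
  identifies \<Delta> tr G as the mean of y^T G^2 y.\<close>

lemma trace_resolvent_square:
  "\<Delta> * mat_trace N R = (\<Sum>k<p. dot N (mv N R (col A k)) (mv N R (col A k))) + \<Delta> * (\<Sum>i<N. \<Sum>j<N. (R i j)\<^sup>2)"
proof -
  let ?e = "\<lambda>i j. if j = i then 1 else (0::real)"
  have "R i i = (\<Sum>j<N. (R j i)\<^sup>2) + (\<Sum>k<p. (mv N R (col A k) i)\<^sup>2) / \<Delta>" if i: "i < N" for i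
  proof -
    have m: "mv N R (?e i) = (\<lambda>j. R j i)"
      using i by (intro ext) (simp add: mv_unit[OF \<Delta>])
    have "dot N (?e i) (mv N R (?e i)) = R i i"
      unfolding m using i by (simp add: dot_def if_distrib[of "\<lambda>x. x * _"] cong: if_cong)
    moreover have "dot N (mv N R (?e i)) (mv N R (?e i)) = (\<Sum>j<N. (R j i)\<^sup>2)"
      unfolding m by (simp add: dot_def power2_eq_square)
    moreover have "dot N (col A k) (mv N R (?e i)) = mv N R (col A k) i" for k
      unfolding dot_resolvent_sym
      using i by (simp add: dot_def if_distrib[of "\<lambda>x. _ * x"] cong: if_cong)
    ultimately show ?thesis
      using dot_resolvent[OF \<Delta>, of "rev [0..<p]" N "?e i" A] unfolding set_rev_upt by simp
  qed
  then have "mat_trace N R = (\<Sum>i<N. (\<Sum>j<N. (R j i)\<^sup>2) + (\<Sum>k<p. (mv N R (col A k) i)\<^sup>2) / \<Delta>)"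
    unfolding mat_trace_def by (intro sum.cong) auto
  also have "\<dots> = (\<Sum>i<N. \<Sum>j<N. (R j i)\<^sup>2) + (\<Sum>i<N. \<Sum>k<p. (mv N R (col A k) i)\<^sup>2) / \<Delta>"
    by (simp add: sum.distrib sum_divide_distrib)
  also have "(\<Sum>i<N. \<Sum>j<N. (R j i)\<^sup>2) = (\<Sum>i<N. \<Sum>j<N. (R i j)\<^sup>2)"
    by (rule sum.swap)
  also have "(\<Sum>i<N. \<Sum>k<p. (mv N R (col A k) i)\<^sup>2) = (\<Sum>k<p. dot N (mv N R (col A k)) (mv N R (col A k)))"
    by (subst sum.swap) (simp add: dot_def power2_eq_square)
  finally have t: "mat_trace N R = (\<Sum>i<N. \<Sum>j<N. (R i j)\<^sup>2) + (\<Sum>k<p. dot N (mv N R (col A k)) (mv N R (col A k))) / \<Delta>" .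
  show ?thesis unfolding t using \<Delta> by (simp add: distrib_left)
qed

text \<open>The general bound for K = G^2, whose form is |G y|^2. The inequalities G^2 \<le> G \<le>
  I reduce its hypotheses to those already verified for K = G.\<close>

lemma ridge_residual_variance:
  "(\<integral>\<^sup>+b. (\<integral>\<^sup>+e. ennreal ((dot N (ridge_residual N \<Delta> p A (observation N p \<Delta> A b e))
        (ridge_residual N \<Delta> p A (observation N p \<Delta> A b e)) - \<Delta> * mat_trace N R)\<^sup>2)
     \<partial>gauss 1 {..<N}) \<partial>sphere_uniform p) \<le> ennreal (24 * \<Delta>\<^sup>2 * real N)"
proof -
  define K where "K i j = (\<Sum>m<N. R i m * R m j)" for i j
  have mvK: "mv N K u = mv N R (mv N R u)" for u
  proof
    fix i
    have "mv N K u i = (\<Sum>j<N. \<Sum>m<N. R i m * (R m j * u j))"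
      by (simp add: mv_def K_def sum_distrib_right mult.assoc)
    also have "\<dots> = (\<Sum>m<N. \<Sum>j<N. R i m * (R m j * u j))"
      by (rule sum.swap)
    finally show "mv N K u i = mv N R (mv N R u) i"
      by (simp add: mv_def sum_distrib_left)
  qed
  have form: "dot N u (mv N K u) = dot N (mv N R u) (mv N R u)" for u
    unfolding mvK by (rule dot_resolvent_sym)
  have Ksym: "K i j = K j i" for i j
    unfolding K_def by (intro sum.cong refl) (subst resolvent_sym, subst (2) resolvent_sym, simp add: mult.commute)
  show ?thesis
    unfolding ridge_residual_def form[symmetric]
  proof (rule observation_form_variance[OF N p \<Delta> Ksym])
    show "0 \<le> dot N u (mv N K u)" for u
      unfolding form by (rule dot_self_nonneg)
    have "(\<Sum>k<p. \<Sum>l<p. (dot N (col A k) (mv N K (col A l)))\<^sup>2) = (\<Sum>l<p. \<Sum>k<p. (dot N (col A k) (mv N K (col A l)))\<^sup>2)"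
      by (rule sum.swap)
    also have "\<dots> \<le> (\<Sum>l<p. \<Delta> * dot N (col A l) (mv N R (col A l)))"
    proof (intro sum_mono)
      fix l
      have "(\<Sum>k<p. (dot N (col A k) (mv N K (col A l)))\<^sup>2) \<le> \<Delta> * dot N (mv N R (col A l)) (mv N R (mv N R (col A l)))"
        unfolding mvK by (rule sum_dot_sq_R_le)
      also have "\<dots> \<le> \<Delta> * dot N (mv N R (col A l)) (mv N R (col A l))"
        using \<Delta> by (intro mult_left_mono dot_resolvent_le) auto
      also have "\<dots> \<le> \<Delta> * dot N (col A l) (mv N R (col A l))"
        using \<Delta> by (intro mult_left_mono R_sq_le) auto
      finally show "(\<Sum>k<p. (dot N (col A k) (mv N K (col A l)))\<^sup>2) \<le> \<Delta> * dot N (col A l) (mv N R (col A l))" .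
    qed
    also have "\<dots> \<le> \<Delta> * (\<Delta> * real N)"
      unfolding sum_distrib_left[symmetric] using sum_col_form_le \<Delta> by (intro mult_left_mono) auto
    finally show "(\<Sum>k<p. \<Sum>l<p. (dot N (col A k) (mv N K (col A l)))\<^sup>2) \<le> \<Delta>\<^sup>2 * real N"
      by (simp add: power2_eq_square mult.assoc)
    have "(\<Sum>k<p. dot N (mv N K (col A k)) (mv N K (col A k))) \<le> (\<Sum>k<p. dot N (col A k) (mv N R (col A k)))"
      unfolding mvK by (intro sum_mono order_trans[OF R_contraction R_sq_le])
    then show "(\<Sum>k<p. dot N (mv N K (col A k)) (mv N K (col A k))) \<le> \<Delta> * real N"
      using sum_col_form_le by linarith
    have "(\<Sum>i<N. \<Sum>j<N. (K i j)\<^sup>2) = (\<Sum>j<N. \<Sum>i<N. (K i j)\<^sup>2)"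
      by (rule sum.swap)
    also have "\<dots> = (\<Sum>j<N. dot N (mv N R (\<lambda>m. R m j)) (mv N R (\<lambda>m. R m j)))"
      by (simp add: dot_def mv_def K_def power2_eq_square)
    also have "\<dots> \<le> (\<Sum>j<N. dot N (\<lambda>m. R m j) (\<lambda>m. R m j))"
      by (intro sum_mono R_contraction)
    also have "\<dots> = (\<Sum>i<N. \<Sum>j<N. (R i j)\<^sup>2)"
      by (subst sum.swap) (simp add: dot_def power2_eq_square)
    also have "\<dots> \<le> real N" by (rule frobenius_R_le)
    finally show "(\<Sum>i<N. \<Sum>j<N. (K i j)\<^sup>2) \<le> real N" .
    have "mat_trace N K = (\<Sum>i<N. \<Sum>j<N. (R i j)\<^sup>2)"
      unfolding mat_trace_def K_def by (intro sum.cong refl) (subst (2) resolvent_sym, simp add: power2_eq_square)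
    then show "\<Delta> * mat_trace N R = (\<Sum>k<p. dot N (col A k) (mv N K (col A k))) + \<Delta> * mat_trace N K"
      unfolding form using trace_resolvent_square by simp
  qed
qed

text \<open>A crude bound is enough: it only has to give order p after averaging over the design,
  for the error term of \<open>log_gauss_partition_ge\<close>.\<close>

lemma observation_sq_norm:
  "(\<integral>\<^sup>+b. (\<integral>\<^sup>+e. ennreal (dot N (observation N p \<Delta> A b e) (observation N p \<Delta> A b e))
     \<partial>gauss 1 {..<N}) \<partial>sphere_uniform p) \<le> 2 * (ennreal (\<Sum>k<p. dot N (col A k) (col A k)) + ennreal (\<Delta> * real N))"
proof -
  interpret S: prob_space "sphere_uniform p" by (rule prob_space_sphere_uniform)
  interpret G: prob_space "gauss 1 {..<N}" by (rule prob_space_gauss) simp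
  let ?m = "\<lambda>b i. \<Sum>k<p. A (i, k) * b k"
  have eq: "(\<Sum>i<N. (?m b i)\<^sup>2) = (\<Sum>k<p. \<Sum>l<p. dot N (col A k) (col A l) * (b k * b l))" for b
  proof -
    have "(\<Sum>i<N. (?m b i)\<^sup>2) = (\<Sum>i<N. \<Sum>k<p. \<Sum>l<p. A (i, k) * A (i, l) * (b k * b l))"
      unfolding power2_eq_square sum_product by (intro sum.cong refl) (simp add: mult_ac)
    also have "\<dots> = (\<Sum>k<p. \<Sum>i<N. \<Sum>l<p. A (i, k) * A (i, l) * (b k * b l))"
      by (rule sum.swap)
    also have "\<dots> = (\<Sum>k<p. \<Sum>l<p. \<Sum>i<N. A (i, k) * A (i, l) * (b k * b l))"
      by (intro sum.cong refl sum.swap)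
    finally show ?thesis by (simp add: dot_def col_def sum_distrib_right)
  qed
  have mb: "(\<lambda>b. ennreal (\<Sum>i<N. (?m b i)\<^sup>2)) \<in> borel_measurable (sphere_uniform p)"
    unfolding measurable_cong_sets[OF sets_sphere_uniform refl] by measurable
  have me: "(\<lambda>e. ennreal (\<Delta> * (\<Sum>i<N. (e i)\<^sup>2))) \<in> borel_measurable (gauss 1 {..<N})"
    unfolding measurable_cong_sets[OF sets_gauss refl] by measurable
  have "(\<integral>\<^sup>+b. (\<integral>\<^sup>+e. ennreal (dot N (observation N p \<Delta> A b e) (observation N p \<Delta> A b e)) \<partial>gauss 1 {..<N}) \<partial>sphere_uniform p)
    \<le> (\<integral>\<^sup>+b. (\<integral>\<^sup>+e. 2 * (ennreal (\<Sum>i<N. (?m b i)\<^sup>2) + ennreal (\<Delta> * (\<Sum>i<N. (e i)\<^sup>2))) \<partial>gauss 1 {..<N}) \<partial>sphere_uniform p)"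
  proof (intro nn_integral_mono)
    fix b e :: "nat \<Rightarrow> real"
    have "dot N (observation N p \<Delta> A b e) (observation N p \<Delta> A b e) = (\<Sum>i<N. (?m b i + sqrt \<Delta> * e i)\<^sup>2)"
      by (simp add: dot_def observation_def mat_vec_def power2_eq_square)
    also have "\<dots> \<le> (\<Sum>i<N. 2 * ((?m b i)\<^sup>2 + (sqrt \<Delta> * e i)\<^sup>2))"
      by (intro sum_mono square_sum2_le)
    also have "\<dots> = 2 * ((\<Sum>i<N. (?m b i)\<^sup>2) + \<Delta> * (\<Sum>i<N. (e i)\<^sup>2))"
      using \<Delta> by (simp add: power_mult_distrib sum.distrib sum_distrib_left[symmetric])
    finally have "ennreal (dot N (observation N p \<Delta> A b e) (observation N p \<Delta> A b e)) \<le>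
      ennreal (2 * ((\<Sum>i<N. (?m b i)\<^sup>2) + \<Delta> * (\<Sum>i<N. (e i)\<^sup>2)))" by (rule ennreal_leI)
    also have "\<dots> = 2 * (ennreal (\<Sum>i<N. (?m b i)\<^sup>2) + ennreal (\<Delta> * (\<Sum>i<N. (e i)\<^sup>2)))"
      using \<Delta> by (simp only: ennreal_mult ennreal_plus ennreal_numeral zero_le_numeral sum_nonneg
          zero_le_power2 mult_nonneg_nonneg less_imp_le add_nonneg_nonneg)
    finally show "ennreal (dot N (observation N p \<Delta> A b e) (observation N p \<Delta> A b e)) \<le>
       2 * (ennreal (\<Sum>i<N. (?m b i)\<^sup>2) + ennreal (\<Delta> * (\<Sum>i<N. (e i)\<^sup>2)))" .
  qed
  also have "\<dots> = (\<integral>\<^sup>+b. 2 * (ennreal (\<Sum>i<N. (?m b i)\<^sup>2) + ennreal (\<Delta> * real N)) \<partial>sphere_uniform p)"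
  proof (intro nn_integral_cong)
    fix b
    have n: "(\<integral>\<^sup>+e. ennreal (\<Delta> * (\<Sum>i<N. (e i)\<^sup>2)) \<partial>gauss 1 {..<N}) = ennreal (\<Delta> * real N)"
    proof -
      have "\<Delta> * (\<Sum>i<N. (e i)\<^sup>2) = (\<Delta> * real N) * (radius N e)\<^sup>2" for e
        using N by (simp add: radius_sq)
      then have "(\<integral>\<^sup>+e. ennreal (\<Delta> * (\<Sum>i<N. (e i)\<^sup>2)) \<partial>gauss 1 {..<N}) =
        (\<integral>\<^sup>+e. ennreal (\<Delta> * real N) * ennreal ((radius N e)\<^sup>2) \<partial>gauss 1 {..<N})"
        using \<Delta> by (simp add: ennreal_mult mult.assoc)
      also have "\<dots> = ennreal (\<Delta> * real N) * 1"
        by (subst nn_integral_cmult) (auto simp: nn_integral_radius_sq[OF N])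
      finally show ?thesis by simp
    qed
    show "(\<integral>\<^sup>+e. 2 * (ennreal (\<Sum>i<N. (?m b i)\<^sup>2) + ennreal (\<Delta> * (\<Sum>i<N. (e i)\<^sup>2))) \<partial>gauss 1 {..<N}) =
      2 * (ennreal (\<Sum>i<N. (?m b i)\<^sup>2) + ennreal (\<Delta> * real N))"
      using me by (subst nn_integral_cmult, measurable, subst nn_integral_add) (auto simp: n G.emeasure_space_1)
  qed
  also have "\<dots> = 2 * ((\<integral>\<^sup>+b. ennreal (\<Sum>i<N. (?m b i)\<^sup>2) \<partial>sphere_uniform p) + ennreal (\<Delta> * real N))"
  proof -
    have one: "emeasure (sphere_uniform p) (space (vec_borel p)) = 1" using S.emeasure_space_1 by simp
    show ?thesis
      using mb by (subst nn_integral_cmult, measurable, subst nn_integral_add) (auto simp: one)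
  qed
  also have "(\<integral>\<^sup>+b. ennreal (\<Sum>i<N. (?m b i)\<^sup>2) \<partial>sphere_uniform p) = ennreal (\<Sum>k<p. dot N (col A k) (col A k))"
    unfolding eq by (rule sphere_quad_form[OF p]) (simp add: eq[symmetric] sum_nonneg)
  finally show ?thesis .
qed

end

section \<open>The law of the model\<close>

context linear_regression
begin

lemma prob_triple:
  assumes "A \<in> sets (mat_borel N p)" "B \<in> sets (vec_borel p)" "C \<in> sets (vec_borel N)"
  shows "emeasure M ((x -` A \<inter> space M) \<inter> (\<beta> -` B \<inter> space M) \<inter> (\<epsilon> -` C \<inter> space M)) =
    emeasure (design N p) A * (emeasure (sphere_uniform p) B * emeasure (gauss 1 {..<N}) C)"
proof -
  let ?S = "\<lambda>j. [x -` A \<inter> space M, \<beta> -` B \<inter> space M, \<epsilon> -` C \<inter> space M] ! j"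
  have three: "{..<3::nat} = {0, 1, 2}" by auto
  have "prob (\<Inter>j\<in>{..<3::nat}. ?S j) = (\<Prod>j\<in>{..<3::nat}. prob (?S j))"
    by (rule indep_setsD[OF independent])
      (use assms in \<open>auto simp: three numeral_2_eq_2 intro!: in_vimage_algebra\<close>)
  then have "prob ((x -` A \<inter> space M) \<inter> (\<beta> -` B \<inter> space M) \<inter> (\<epsilon> -` C \<inter> space M)) =
    prob (x -` A \<inter> space M) * (prob (\<beta> -` B \<inter> space M) * prob (\<epsilon> -` C \<inter> space M))"
    by (simp add: three numeral_2_eq_2 Int_assoc)
  moreover have "emeasure (design N p) A = prob (x -` A \<inter> space M)"
    unfolding x_law[symmetric] using assms x_measurable by (simp add: emeasure_distr emeasure_eq_measure)
  moreover have "emeasure (sphere_uniform p) B = prob (\<beta> -` B \<inter> space M)"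
    unfolding \<beta>_law[symmetric] using assms \<beta>_measurable by (simp add: emeasure_distr emeasure_eq_measure)
  moreover have "emeasure (gauss 1 {..<N}) C = prob (\<epsilon> -` C \<inter> space M)"
    unfolding \<epsilon>_law[symmetric] using assms \<epsilon>_measurable by (simp add: emeasure_distr emeasure_eq_measure)
  ultimately show ?thesis
    by (simp add: emeasure_eq_measure ennreal_mult)
qed

text \<open>Uniqueness of product measures tests rectangles only, but here the second factor is
  itself a product. The argument is therefore nested: for each set \<open>A\<close> of designs, the
  law of (\<beta>, \<epsilon>) restricted to x in \<open>A\<close> is identified first.\<close>

lemma distr_triple:
  "distr M (mat_borel N p \<Otimes>\<^sub>M (vec_borel p \<Otimes>\<^sub>M vec_borel N)) (\<lambda>\<omega>. (x \<omega>, \<beta> \<omega>, \<epsilon> \<omega>)) =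
    design N p \<Otimes>\<^sub>M (sphere_uniform p \<Otimes>\<^sub>M gauss 1 {..<N})"
proof -
  note [measurable] = x_measurable \<beta>_measurable \<epsilon>_measurable
  interpret S: prob_space "sphere_uniform p" by (rule prob_space_sphere_uniform)
  interpret E: prob_space "gauss 1 {..<N}" by (rule prob_space_gauss) simp
  interpret X: prob_space "design N p"
    unfolding x_law[symmetric] by (rule prob_space_distr[OF x_measurable])
  interpret SE: pair_prob_space "sphere_uniform p" "gauss 1 {..<N}" ..
  have sets2: "sets (sphere_uniform p \<Otimes>\<^sub>M gauss 1 {..<N}) = sets (vec_borel p \<Otimes>\<^sub>M vec_borel N)"
    by (intro sets_pair_measure_cong sets_gauss sets_sphere_uniform)
  have be: "(\<lambda>\<omega>. (\<beta> \<omega>, \<epsilon> \<omega>)) \<in> M \<rightarrow>\<^sub>M vec_borel p \<Otimes>\<^sub>M vec_borel N" by measurable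
  have xbe: "(\<lambda>\<omega>. (x \<omega>, \<beta> \<omega>, \<epsilon> \<omega>)) \<in> M \<rightarrow>\<^sub>M mat_borel N p \<Otimes>\<^sub>M (vec_borel p \<Otimes>\<^sub>M vec_borel N)" by measurable
  show ?thesis
  proof (rule pair_measure_eqI[symmetric])
    show "sigma_finite_measure (design N p)" "sigma_finite_measure (sphere_uniform p \<Otimes>\<^sub>M gauss 1 {..<N})"
      by unfold_locales
    show "sets (design N p \<Otimes>\<^sub>M (sphere_uniform p \<Otimes>\<^sub>M gauss 1 {..<N})) =
      sets (distr M (mat_borel N p \<Otimes>\<^sub>M (vec_borel p \<Otimes>\<^sub>M vec_borel N)) (\<lambda>\<omega>. (x \<omega>, \<beta> \<omega>, \<epsilon> \<omega>)))"
      unfolding sets_distr by (intro sets_pair_measure_cong sets_gauss sets2)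
    fix A D assume A: "A \<in> sets (design N p)" and D: "D \<in> sets (sphere_uniform p \<Otimes>\<^sub>M gauss 1 {..<N})"
    have A'[measurable]: "A \<in> sets (mat_borel N p)" using A by (simp add: sets_gauss)
    have D'[measurable]: "D \<in> sets (vec_borel p \<Otimes>\<^sub>M vec_borel N)" using D unfolding sets2 .
    define c where "c = emeasure (design N p) A"
    have c: "c \<noteq> \<infinity>" unfolding c_def by simp
    let ?XA = "x -` A \<inter> space M"
    have XA[measurable]: "?XA \<in> sets M" by measurable
    let ?\<nu> = "distr (density M (indicator ?XA)) (vec_borel p \<Otimes>\<^sub>M vec_borel N) (\<lambda>\<omega>. (\<beta> \<omega>, \<epsilon> \<omega>))"
    have \<nu>: "emeasure ?\<nu> F = emeasure M (?XA \<inter> ((\<lambda>\<omega>. (\<beta> \<omega>, \<epsilon> \<omega>)) -` F \<inter> space M))"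
      if "F \<in> sets (vec_borel p \<Otimes>\<^sub>M vec_borel N)" for F
    proof -
      have s: "(\<lambda>\<omega>. (\<beta> \<omega>, \<epsilon> \<omega>)) -` F \<inter> space M \<in> sets M" using be that by (rule measurable_sets)
      have "emeasure ?\<nu> F = emeasure (density M (indicator ?XA)) ((\<lambda>\<omega>. (\<beta> \<omega>, \<epsilon> \<omega>)) -` F \<inter> space M)"
        using that be by (subst emeasure_distr) auto
      also have "\<dots> = emeasure M (?XA \<inter> ((\<lambda>\<omega>. (\<beta> \<omega>, \<epsilon> \<omega>)) -` F \<inter> space M))"
        using s XA by (simp add: emeasure_density indicator_inter_arith[symmetric] del: nn_integral_indicator)
          (subst nn_integral_indicator, auto)
      finally show ?thesis .
    qed
    have sig: "sigma_finite_measure (scale_measure c (sphere_uniform p))"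
    proof -
      have "finite_measure (scale_measure c (sphere_uniform p))"
        using c S.emeasure_space_1 by (intro finite_measureI) (simp add: space_scale_measure)
      then show ?thesis by (rule finite_measure.axioms(1))
    qed
    \<comment> \<open>Agreement on products B \<times> C determines the restricted law, which
      extends the factorisation to every measurable \<open>D\<close>.\<close>
    have eq: "scale_measure c (sphere_uniform p) \<Otimes>\<^sub>M gauss 1 {..<N} = ?\<nu>"
    proof (rule pair_measure_eqI[OF sig])
      show "sigma_finite_measure (gauss 1 {..<N})" by unfold_locales
      show "sets (scale_measure c (sphere_uniform p) \<Otimes>\<^sub>M gauss 1 {..<N}) = sets ?\<nu>"
        unfolding sets_distr by (intro sets_pair_measure_cong sets_gauss) simp
      fix B C assume "B \<in> sets (scale_measure c (sphere_uniform p))" "C \<in> sets (gauss 1 {..<N})"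
      then have B: "B \<in> sets (vec_borel p)" and C: "C \<in> sets (vec_borel N)" by (auto simp: sets_gauss)
      have "(\<lambda>\<omega>. (\<beta> \<omega>, \<epsilon> \<omega>)) -` (B \<times> C) \<inter> space M = (\<beta> -` B \<inter> space M) \<inter> (\<epsilon> -` C \<inter> space M)"
        by auto
      then have "emeasure ?\<nu> (B \<times> C) = emeasure M (?XA \<inter> (\<beta> -` B \<inter> space M) \<inter> (\<epsilon> -` C \<inter> space M))"
        using B C by (subst \<nu>) (auto intro!: arg_cong2[where f=emeasure])
      then show "emeasure (scale_measure c (sphere_uniform p)) B * emeasure (gauss 1 {..<N}) C = emeasure ?\<nu> (B \<times> C)"
        using prob_triple[OF A' B C] by (simp add: c_def mult.assoc)
    qed
    have "c * emeasure (sphere_uniform p \<Otimes>\<^sub>M gauss 1 {..<N}) D =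
      emeasure (scale_measure c (sphere_uniform p) \<Otimes>\<^sub>M gauss 1 {..<N}) D"
    proof -
      have D2: "D \<in> sets (scale_measure c (sphere_uniform p) \<Otimes>\<^sub>M gauss 1 {..<N})"
        unfolding eq sets_distr by (rule D')
      have "(\<lambda>b. emeasure (gauss 1 {..<N}) (Pair b -` D)) \<in> borel_measurable (sphere_uniform p)"
        by (rule E.measurable_emeasure_Pair[OF D])
      then show ?thesis
        unfolding E.emeasure_pair_measure_alt[OF D] E.emeasure_pair_measure_alt[OF D2]
        by (simp add: nn_integral_scale_measure)
    qed
    also have "\<dots> = emeasure M (?XA \<inter> ((\<lambda>\<omega>. (\<beta> \<omega>, \<epsilon> \<omega>)) -` D \<inter> space M))"
      unfolding eq by (rule \<nu>[OF D'])
    also have "\<dots> = emeasure (distr M (mat_borel N p \<Otimes>\<^sub>M (vec_borel p \<Otimes>\<^sub>M vec_borel N)) (\<lambda>\<omega>. (x \<omega>, \<beta> \<omega>, \<epsilon> \<omega>))) (A \<times> D)"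
      using xbe by (subst emeasure_distr) (auto intro!: arg_cong2[where f=emeasure])
    finally show "emeasure (design N p) A * emeasure (sphere_uniform p \<Otimes>\<^sub>M gauss 1 {..<N}) D =
      emeasure (distr M (mat_borel N p \<Otimes>\<^sub>M (vec_borel p \<Otimes>\<^sub>M vec_borel N)) (\<lambda>\<omega>. (x \<omega>, \<beta> \<omega>, \<epsilon> \<omega>))) (A \<times> D)"
      by (simp add: c_def)
  qed
qed

lemma nn_integral_model:
  assumes f: "f \<in> borel_measurable (mat_borel N p \<Otimes>\<^sub>M (vec_borel p \<Otimes>\<^sub>M vec_borel N))"
  shows "(\<integral>\<^sup>+\<omega>. f (x \<omega>, \<beta> \<omega>, \<epsilon> \<omega>) \<partial>M) =
    (\<integral>\<^sup>+A. (\<integral>\<^sup>+b. (\<integral>\<^sup>+e. f (A, b, e) \<partial>gauss 1 {..<N}) \<partial>sphere_uniform p) \<partial>design N p)"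
proof -
  note [measurable] = x_measurable \<beta>_measurable \<epsilon>_measurable
  interpret S: prob_space "sphere_uniform p" by (rule prob_space_sphere_uniform)
  interpret E: prob_space "gauss 1 {..<N}" by (rule prob_space_gauss) simp
  interpret SE: pair_prob_space "sphere_uniform p" "gauss 1 {..<N}" ..
  have sets2: "sets (sphere_uniform p \<Otimes>\<^sub>M gauss 1 {..<N}) = sets (vec_borel p \<Otimes>\<^sub>M vec_borel N)"
    by (intro sets_pair_measure_cong sets_gauss sets_sphere_uniform)
  have sets3: "sets (design N p \<Otimes>\<^sub>M (sphere_uniform p \<Otimes>\<^sub>M gauss 1 {..<N})) =
      sets (mat_borel N p \<Otimes>\<^sub>M (vec_borel p \<Otimes>\<^sub>M vec_borel N))"
    by (intro sets_pair_measure_cong sets_gauss sets2)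
  have f': "f \<in> borel_measurable (design N p \<Otimes>\<^sub>M (sphere_uniform p \<Otimes>\<^sub>M gauss 1 {..<N}))"
    using f unfolding measurable_cong_sets[OF sets3 refl] .
  have xbe: "(\<lambda>\<omega>. (x \<omega>, \<beta> \<omega>, \<epsilon> \<omega>)) \<in> M \<rightarrow>\<^sub>M mat_borel N p \<Otimes>\<^sub>M (vec_borel p \<Otimes>\<^sub>M vec_borel N)" by measurable
  have "(\<integral>\<^sup>+\<omega>. f (x \<omega>, \<beta> \<omega>, \<epsilon> \<omega>) \<partial>M) =
    (\<integral>\<^sup>+z. f z \<partial>(design N p \<Otimes>\<^sub>M (sphere_uniform p \<Otimes>\<^sub>M gauss 1 {..<N})))"
    unfolding distr_triple[symmetric] using f by (subst nn_integral_distr[OF xbe]) auto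
  also have "\<dots> = (\<integral>\<^sup>+A. (\<integral>\<^sup>+z. f (A, z) \<partial>(sphere_uniform p \<Otimes>\<^sub>M gauss 1 {..<N})) \<partial>design N p)"
    by (rule SE.nn_integral_fst[symmetric, OF f'])
  also have "\<dots> = (\<integral>\<^sup>+A. (\<integral>\<^sup>+b. (\<integral>\<^sup>+e. f (A, b, e) \<partial>gauss 1 {..<N}) \<partial>sphere_uniform p) \<partial>design N p)"
  proof (intro nn_integral_cong)
    fix A assume A: "A \<in> space (design N p)"
    have "(\<lambda>z. f (A, z)) \<in> borel_measurable (sphere_uniform p \<Otimes>\<^sub>M gauss 1 {..<N})"
      using A by (intro measurable_compose[OF measurable_Pair1' f'])
    from E.nn_integral_fst[OF this]
    show "(\<integral>\<^sup>+z. f (A, z) \<partial>(sphere_uniform p \<Otimes>\<^sub>M gauss 1 {..<N})) =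
      (\<integral>\<^sup>+b. (\<integral>\<^sup>+e. f (A, b, e) \<partial>gauss 1 {..<N}) \<partial>sphere_uniform p)" by simp
  qed
  finally show ?thesis .
qed

end

section \<open>The TAP functional\<close>

definition real_f_TAP :: "real \<Rightarrow> real \<Rightarrow> nat \<Rightarrow> nat \<Rightarrow> (nat \<times> nat \<Rightarrow> real) \<Rightarrow> (nat \<Rightarrow> real)
    \<Rightarrow> (nat \<Rightarrow> real) \<Rightarrow> real" where
  "real_f_TAP \<alpha> \<Delta> N p A v a =
     - (1 / (2 * \<Delta> * real p)) * (residual_norm N p A v a)\<^sup>2 + entropic \<Delta> \<alpha> (1 - overlap p a)"

lemma f_TAP_eq_real: "overlap p a \<noteq> 1 \<Longrightarrow> f_TAP \<alpha> \<Delta> N p A v a = ereal (real_f_TAP \<alpha> \<Delta> N p A v a)"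
  by (simp add: f_TAP_def real_f_TAP_def ext_ln_def entropic_def)

lemma f_TAP_eq_minfty: "overlap p a = 1 \<Longrightarrow> f_TAP \<alpha> \<Delta> N p A v a = -\<infinity>"
  by (simp add: f_TAP_def ext_ln_def)

lemma residual_norm_cong:
  "(\<And>i. i < N \<Longrightarrow> v i = v' i) \<Longrightarrow> residual_norm N p A v b = residual_norm N p A v' b"
  unfolding residual_norm_def by (intro L2_set_cong) auto

lemma max_f_TAP_cong:
  "(\<And>i. i < N \<Longrightarrow> v i = v' i) \<Longrightarrow> max_f_TAP \<alpha> \<Delta> N p A v = max_f_TAP \<alpha> \<Delta> N p A v'"
  unfolding max_f_TAP_def f_TAP_def using residual_norm_cong[of N v v'] by simp

lemma free_energy_cong:
  "(\<And>i. i < N \<Longrightarrow> v i = v' i) \<Longrightarrow> free_energy \<Delta> N p A v = free_energy \<Delta> N p A v'"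
  unfolding free_energy_def partition_function_def using residual_norm_cong[of N v v'] by simp

lemma tendsto_overlap:
  assumes "\<And>i. i < p \<Longrightarrow> ((\<lambda>n. a n i) \<longlongrightarrow> b i) F"
  shows "((\<lambda>n. overlap p (a n)) \<longlongrightarrow> overlap p b) F"
proof -
  have "((\<lambda>n. (L2_set (a n) {..<p})\<^sup>2 * inverse (real p)) \<longlongrightarrow> (L2_set b {..<p})\<^sup>2 * inverse (real p)) F"
    unfolding L2_set_def by (intro tendsto_intros assms) auto
  then show ?thesis by (simp add: overlap_def divide_inverse)
qed

lemma tendsto_entropic:
  assumes "\<alpha> > 0" "\<Delta> > 0" "E > 0" "(f \<longlongrightarrow> E) F"
  shows "((\<lambda>n. entropic \<Delta> \<alpha> (f n)) \<longlongrightarrow> entropic \<Delta> \<alpha> E) F"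
proof -
  have "1 + E / (\<Delta> * \<alpha>) \<noteq> 0"
    using assms by (intro less_imp_neq[symmetric] add_pos_pos divide_pos_pos mult_pos_pos) auto
  then show ?thesis
    unfolding entropic_def using assms by (intro tendsto_intros) auto
qed

text \<open>Reduces an uncountable supremum to a countable one, which is what measurability
  requires.\<close>

lemma max_f_TAP_rational:
  assumes \<alpha>: "\<alpha> > 0" and \<Delta>: "\<Delta> > 0"
  shows "max_f_TAP \<alpha> \<Delta> N p A v = (SUP a\<in>vec_cball p \<inter> ({..<p} \<rightarrow>\<^sub>E \<rat>). f_TAP \<alpha> \<Delta> N p A v a)"
  unfolding max_f_TAP_def
proof (rule antisym)
  let ?D = "vec_cball p \<inter> ({..<p} \<rightarrow>\<^sub>E \<rat>)"
  show "(SUP a\<in>?D. f_TAP \<alpha> \<Delta> N p A v a) \<le> (SUP a\<in>vec_cball p. f_TAP \<alpha> \<Delta> N p A v a)"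
    by (intro SUP_subset_mono) auto
  show "(SUP a\<in>vec_cball p. f_TAP \<alpha> \<Delta> N p A v a) \<le> (SUP a\<in>?D. f_TAP \<alpha> \<Delta> N p A v a)"
  proof (rule SUP_least)
    fix a assume a: "a \<in> vec_cball p"
    show "f_TAP \<alpha> \<Delta> N p A v a \<le> (SUP a\<in>?D. f_TAP \<alpha> \<Delta> N p A v a)"
    proof (cases "overlap p a = 1")
      case True
      then show ?thesis by (simp add: f_TAP_eq_minfty)
    next
      case False
      then have q: "overlap p a < 1" using overlap_le_1[OF a] by simp
      \<comment> \<open>Rounding down to the grid of mesh 1 / n. At \<open>n = 0\<close> the
        division gives a default value that the limit does not see.\<close>
      define b where "b n = (\<lambda>i\<in>{..<p}. of_int \<lfloor>a i * real n\<rfloor> / real n)" for n :: nat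
      have lim: "(\<lambda>n. b n i) \<longlonglongrightarrow> a i" if "i < p" for i
      proof (rule tendsto_sandwich)
        show "(\<lambda>n. a i - 1 / real n) \<longlonglongrightarrow> a i" by real_asymp
        show "\<forall>\<^sub>F n in sequentially. a i - 1 / real n \<le> b n i"
          using eventually_gt_at_top[of 0]
        proof eventually_elim
          case (elim n)
          have "a i * real n - 1 \<le> of_int \<lfloor>a i * real n\<rfloor>" by linarith
          then have "(a i * real n - 1) / real n \<le> of_int \<lfloor>a i * real n\<rfloor> / real n"
            by (rule divide_right_mono) simp
          then show ?case using elim that by (simp add: b_def diff_divide_distrib)
        qed
        show "\<forall>\<^sub>F n in sequentially. b n i \<le> a i"
          using eventually_gt_at_top[of 0]
        proof eventually_elim
          case (elim n)
          have "of_int \<lfloor>a i * real n\<rfloor> / real n \<le> a i * real n / real n"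
            by (rule divide_right_mono) auto
          then show ?case using elim that by (simp add: b_def)
        qed
      qed simp
      have ov: "(\<lambda>n. overlap p (b n)) \<longlonglongrightarrow> overlap p a"
        by (rule tendsto_overlap) (rule lim)
      \<comment> \<open>The overlap of \<open>a\<close> is strictly below 1, so the rounded points
        eventually stay in the ball and the functional is finite and continuous along them. On the
        sphere its value is -\<infinity> and nothing has to be approximated.\<close>
      have ev: "\<forall>\<^sub>F n in sequentially. overlap p (b n) < 1"
        using ov q by (rule order_tendstoD)
      have "(\<lambda>n. (residual_norm N p A v (b n))\<^sup>2) \<longlonglongrightarrow> (residual_norm N p A v a)\<^sup>2"
        unfolding residual_norm_def L2_set_def mat_vec_def
        by (intro tendsto_intros lim) auto
      moreover have "(\<lambda>n. entropic \<Delta> \<alpha> (1 - overlap p (b n))) \<longlonglongrightarrow> entropic \<Delta> \<alpha> (1 - overlap p a)"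
        using q by (intro tendsto_entropic \<alpha> \<Delta> tendsto_intros ov) auto
      ultimately have "(\<lambda>n. real_f_TAP \<alpha> \<Delta> N p A v (b n)) \<longlonglongrightarrow> real_f_TAP \<alpha> \<Delta> N p A v a"
        unfolding real_f_TAP_def by (intro tendsto_add tendsto_mult tendsto_const)
      then have "(\<lambda>n. ereal (real_f_TAP \<alpha> \<Delta> N p A v (b n))) \<longlonglongrightarrow> ereal (real_f_TAP \<alpha> \<Delta> N p A v a)"
        by simp
      moreover have "\<forall>\<^sub>F n in sequentially. ereal (real_f_TAP \<alpha> \<Delta> N p A v (b n)) \<le> (SUP a\<in>?D. f_TAP \<alpha> \<Delta> N p A v a)"
        using ev
      proof eventually_elim
        case (elim n)
        have "(L2_set (b n) {..<p})\<^sup>2 \<le> (sqrt (real p))\<^sup>2"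
        proof (cases "p = 0")
          case False
          then show ?thesis using elim by (simp add: overlap_def divide_less_eq)
        qed simp
        then have "L2_set (b n) {..<p} \<le> sqrt (real p)"
          by (rule power2_le_imp_le) simp
        then have "b n \<in> ?D"
          by (auto simp: b_def vec_cball_def intro!: Rats_divide)
        then have "f_TAP \<alpha> \<Delta> N p A v (b n) \<le> (SUP a\<in>?D. f_TAP \<alpha> \<Delta> N p A v a)"
          by (rule SUP_upper)
        then show ?case using elim by (simp add: f_TAP_eq_real)
      qed
      ultimately have "ereal (real_f_TAP \<alpha> \<Delta> N p A v a) \<le> (SUP a\<in>?D. f_TAP \<alpha> \<Delta> N p A v a)"
        by (rule tendsto_upperbound) simp
      then show ?thesis using False by (simp add: f_TAP_eq_real)
    qed
  qed
qed

lemma measurable_max_f_TAP: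
  assumes "\<alpha> > 0" "\<Delta> > 0"
    and f[measurable]: "f \<in> M \<rightarrow>\<^sub>M mat_borel N p" and g[measurable]: "g \<in> M \<rightarrow>\<^sub>M vec_borel N"
  shows "(\<lambda>\<omega>. max_f_TAP \<alpha> \<Delta> N p (f \<omega>) (g \<omega>)) \<in> borel_measurable M"
  unfolding max_f_TAP_rational[OF assms(1,2)]
proof (rule borel_measurable_SUP)
  have "countable ({..<p} \<rightarrow>\<^sub>E (\<rat> :: real set))"
    by (intro countable_PiE) (auto simp: countable_rat)
  then show "countable (vec_cball p \<inter> ({..<p} \<rightarrow>\<^sub>E \<rat>))" by (rule countable_subset[rotated]) auto
  fix a assume "a \<in> vec_cball p \<inter> ({..<p} \<rightarrow>\<^sub>E (\<rat> :: real set))"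
  then have [measurable]: "(\<lambda>_. a) \<in> M \<rightarrow>\<^sub>M vec_borel p"
    by (auto simp: vec_cball_def space_PiM)
  show "(\<lambda>\<omega>. f_TAP \<alpha> \<Delta> N p (f \<omega>) (g \<omega>) a) \<in> borel_measurable M"
  proof (cases "overlap p a = 1")
    case True
    then show ?thesis by (simp add: f_TAP_eq_minfty)
  next
    case False
    have "(\<lambda>\<omega>. real_f_TAP \<alpha> \<Delta> N p (f \<omega>) (g \<omega>) a) \<in> borel_measurable M"
      unfolding real_f_TAP_def by measurable
    then show ?thesis unfolding f_TAP_eq_real[OF False] by simp
  qed
qed

section \<open>Bounds for the maximum of the TAP functional\<close>

lemma overlap_sum: "p > 0 \<Longrightarrow> real p * overlap p a = (\<Sum>k<p. (a k)\<^sup>2)"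
  by (simp add: overlap_def L2_set_def sum_nonneg)

text \<open>\<open>resolvent_variational\<close> trades the residual for y^T G y at the price q / 2,
  and \<open>entropic_le\<close> absorbs that price; the resulting bound no longer contains
  a.\<close>

lemma max_f_TAP_le:
  assumes \<alpha>: "\<alpha> > 0" and \<Delta>: "\<Delta> > 0" and p: "p > 0"
  shows "max_f_TAP \<alpha> \<Delta> N p A v \<le>
    ereal (- (resolvent_form N \<Delta> p A v / real p) / (2 * \<Delta>) - \<alpha> / 2 * mp_log_det \<Delta> (1 / \<alpha>))"
  unfolding max_f_TAP_def
proof (rule SUP_least)
  fix a assume a: "a \<in> vec_cball p"
  show "f_TAP \<alpha> \<Delta> N p A v a \<le>
    ereal (- (resolvent_form N \<Delta> p A v / real p) / (2 * \<Delta>) - \<alpha> / 2 * mp_log_det \<Delta> (1 / \<alpha>))"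
  proof (cases "overlap p a = 1")
    case True
    then show ?thesis by (simp add: f_TAP_eq_minfty)
  next
    case False
    then have E: "0 < 1 - overlap p a" using overlap_le_1[OF a] by simp
    have "resolvent_form N \<Delta> p A v \<le> (residual_norm N p A v a)\<^sup>2 + \<Delta> * (real p * overlap p a)"
      unfolding resolvent_form_def residual_norm_sq overlap_sum[OF p]
      using resolvent_variational[OF \<Delta>, of "rev [0..<p]" N v A a] by (simp add: atLeast0LessThan)
    then have "resolvent_form N \<Delta> p A v / (2 * \<Delta> * real p) \<le>
        ((residual_norm N p A v a)\<^sup>2 + \<Delta> * (real p * overlap p a)) / (2 * \<Delta> * real p)"
      using \<Delta> by (intro divide_right_mono) auto
    also have "\<dots> = (residual_norm N p A v a)\<^sup>2 / (2 * \<Delta> * real p) + overlap p a / 2"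
      using \<Delta> p by (simp add: add_divide_distrib)
    finally have "resolvent_form N \<Delta> p A v / (2 * \<Delta> * real p) \<le>
      (residual_norm N p A v a)\<^sup>2 / (2 * \<Delta> * real p) + overlap p a / 2" .
    moreover have "entropic \<Delta> \<alpha> (1 - overlap p a) + overlap p a / 2 \<le> - (\<alpha> / 2 * mp_log_det \<Delta> (1 / \<alpha>))"
      using entropic_le[OF \<Delta> \<alpha> E] by simp
    moreover have "- (resolvent_form N \<Delta> p A v / real p) / (2 * \<Delta>) = - (resolvent_form N \<Delta> p A v / (2 * \<Delta> * real p))"
      by (simp add: mult_ac)
    moreover have "real_f_TAP \<alpha> \<Delta> N p A v a = entropic \<Delta> \<alpha> (1 - overlap p a) - (residual_norm N p A v a)\<^sup>2 / (2 * \<Delta> * real p)"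
      by (simp add: real_f_TAP_def)
    moreover have "s \<le> r + q / 2 \<Longrightarrow> h + q / 2 \<le> - m \<Longrightarrow> h - r \<le> - s - m" for s r q h m :: real
      by linarith
    ultimately have "real_f_TAP \<alpha> \<Delta> N p A v a \<le>
      - (resolvent_form N \<Delta> p A v / real p) / (2 * \<Delta>) - \<alpha> / 2 * mp_log_det \<Delta> (1 / \<alpha>)"
      by presburger
    then show ?thesis using False by (simp add: f_TAP_eq_real)
  qed
qed

text \<open>Evaluation at the ridge estimator. By the energy identity \<open>dot_resolvent\<close>
  its value of 1 - q is exactly \<open>E\<close>, and \<open>E > 0\<close> is what places it inside
  the ball.\<close>

lemma max_f_TAP_ge:
  fixes A :: "nat \<times> nat \<Rightarrow> real" and v :: "nat \<Rightarrow> real" and N :: nat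
  assumes \<alpha>: "\<alpha> > 0" and \<Delta>: "\<Delta> > 0" and p: "p > 0"
  defines "w \<equiv> ridge_residual N \<Delta> p A v"
  defines "E \<equiv> 1 - (resolvent_form N \<Delta> p A v / real p - dot N w w / real p) / \<Delta>"
  assumes E: "E > 0"
  shows "ereal (- (dot N w w / real p) / (2 * \<Delta>) + entropic \<Delta> \<alpha> E) \<le> max_f_TAP \<alpha> \<Delta> N p A v"
proof -
  let ?ks = "rev [0..<p]"
  have ks: "set ?ks = {..<p}" "distinct ?ks" by auto
  define a where "a = (\<lambda>k\<in>{..<p}. dot N (col A k) w / \<Delta>)"
  have res: "v i - (\<Sum>k<p. A (i, k) * a k) = w i" if "i < N" for i
  proof -
    have "w i + (\<Sum>k<p. col A k i * dot N (col A k) w) / \<Delta> = v i"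
      using resolvent_inverse[OF \<Delta> ks(2) that, of A v] unfolding w_def ridge_residual_def ks(1) .
    then show ?thesis by (simp add: a_def col_def sum_divide_distrib)
  qed
  have r: "(residual_norm N p A v a)\<^sup>2 = dot N w w"
    unfolding residual_norm_sq by (intro dot_cong res)
  have "resolvent_form N \<Delta> p A v = dot N w w + (\<Sum>k<p. (dot N (col A k) w)\<^sup>2) / \<Delta>"
    using dot_resolvent[OF \<Delta> ks(2), of N v A] unfolding ks(1) resolvent_form_def w_def ridge_residual_def .
  moreover have "(\<Sum>k<p. (a k)\<^sup>2) = (\<Sum>k<p. (dot N (col A k) w)\<^sup>2) / \<Delta> / \<Delta>"
    unfolding sum_divide_distrib by (intro sum.cong) (auto simp: a_def power2_eq_square)
  ultimately have "real p * overlap p a = (resolvent_form N \<Delta> p A v - dot N w w) / \<Delta>"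
    unfolding overlap_sum[OF p] by simp
  then have "real p * overlap p a / real p = (resolvent_form N \<Delta> p A v - dot N w w) / \<Delta> / real p"
    by (rule arg_cong)
  then have "overlap p a = (resolvent_form N \<Delta> p A v / real p - dot N w w / real p) / \<Delta>"
    using p by (simp add: diff_divide_distrib mult.commute)
  then have ov: "1 - overlap p a = E" by (simp add: E_def)
  then have lt: "overlap p a < 1" using E by simp
  have "(L2_set a {..<p})\<^sup>2 \<le> (sqrt (real p))\<^sup>2"
    using lt p by (simp add: overlap_def divide_less_eq)
  then have "L2_set a {..<p} \<le> sqrt (real p)"
    by (rule power2_le_imp_le) simp
  then have "a \<in> vec_cball p" by (auto simp: vec_cball_def a_def)
  then have "f_TAP \<alpha> \<Delta> N p A v a \<le> max_f_TAP \<alpha> \<Delta> N p A v"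
    unfolding max_f_TAP_def by (rule SUP_upper)
  moreover have "f_TAP \<alpha> \<Delta> N p A v a = ereal (- (dot N w w / real p) / (2 * \<Delta>) + entropic \<Delta> \<alpha> E)"
    using lt by (simp add: f_TAP_eq_real real_f_TAP_def ov r mult_ac)
  ultimately show ?thesis by simp
qed

section \<open>Convergence in probability as convergence along a filter\<close>

text \<open>The filter of properties that hold outside measurable sets of vanishing probability.
  Limits along it yield convergence in probability, so sums, products, continuous functions and
  sandwiching are available as ordinary filter limits, although the probability space changes with
  p.\<close>

definition whp :: "(nat \<Rightarrow> 'a measure) \<Rightarrow> (nat \<times> 'a) filter" where
  "whp M = Abs_filter (\<lambda>P. \<exists>B. (\<forall>p. B p \<in> sets (M p)) \<and> (\<lambda>p. measure (M p) (B p)) \<longlonglongrightarrow> 0 \<and>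
     (\<forall>p. \<forall>\<omega>\<in>space (M p) - B p. P (p, \<omega>)))"

context
  fixes M :: "nat \<Rightarrow> 'a measure"
  assumes M: "\<And>p. prob_space (M p)"
begin

lemma eventually_whp:
  "eventually P (whp M) \<longleftrightarrow> (\<exists>B. (\<forall>p. B p \<in> sets (M p)) \<and> (\<lambda>p. measure (M p) (B p)) \<longlonglongrightarrow> 0 \<and>
     (\<forall>p. \<forall>\<omega>\<in>space (M p) - B p. P (p, \<omega>)))"
  unfolding whp_def
proof (rule eventually_Abs_filter, rule is_filter.intro, goal_cases)
  case 1
  show ?case by (rule exI[of _ "\<lambda>_. {}"]) simp
next
  case (2 P Q)
  from 2(1) obtain B where B: "\<forall>p. B p \<in> sets (M p)" "(\<lambda>p. measure (M p) (B p)) \<longlonglongrightarrow> 0"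
      "\<forall>p. \<forall>\<omega>\<in>space (M p) - B p. P (p, \<omega>)" by (elim exE conjE)
  from 2(2) obtain C where C: "\<forall>p. C p \<in> sets (M p)" "(\<lambda>p. measure (M p) (C p)) \<longlonglongrightarrow> 0"
      "\<forall>p. \<forall>\<omega>\<in>space (M p) - C p. Q (p, \<omega>)" by (elim exE conjE)
  have "(\<lambda>p. measure (M p) (B p \<union> C p)) \<longlonglongrightarrow> 0"
  proof (rule tendsto_sandwich[OF _ _ tendsto_const])
    show "(\<lambda>p. measure (M p) (B p) + measure (M p) (C p)) \<longlonglongrightarrow> 0"
      using tendsto_add[OF B(2) C(2)] by simp
    show "\<forall>\<^sub>F p in sequentially. measure (M p) (B p \<union> C p) \<le> measure (M p) (B p) + measure (M p) (C p)"
      using B(1) C(1) by (intro always_eventually allI measure_Un_le) auto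
  qed simp
  then show ?case
    using B(1,3) C(1,3) by (intro exI[of _ "\<lambda>p. B p \<union> C p"]) simp
next
  case (3 P Q)
  then show ?case by blast
qed

lemma filterlim_fst_whp: "filterlim fst sequentially (whp M)"
  unfolding filterlim_def le_filter_def eventually_filtermap
proof (intro allI impI)
  fix P :: "nat \<Rightarrow> bool" assume P: "eventually P sequentially"
  have "(\<lambda>p. measure (M p) (if P p then {} else space (M p))) \<longlonglongrightarrow> 0"
    using P by (intro tendsto_eventually) (auto elim: eventually_mono)
  then show "\<forall>\<^sub>F z in whp M. P (fst z)"
    unfolding eventually_whp by (intro exI[of _ "\<lambda>p. if P p then {} else space (M p)"]) auto
qed

lemma tendsto_seq_whp: "u \<longlonglongrightarrow> l \<Longrightarrow> ((\<lambda>z. u (fst z)) \<longlongrightarrow> l) (whp M)"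
  by (rule filterlim_compose[OF _ filterlim_fst_whp])

lemma eventually_seq_whp: "eventually P sequentially \<Longrightarrow> \<forall>\<^sub>F z in whp M. P (fst z)"
  using filterlim_fst_whp by (simp add: filterlim_iff)

lemma eventually_space_whp: "\<forall>\<^sub>F z in whp M. snd z \<in> space (M (fst z))"
  unfolding eventually_whp by (intro exI[of _ "\<lambda>_. {}"]) simp

lemma whp_markov:
  assumes X: "\<And>p. X p \<in> borel_measurable (M p)" and nn: "\<And>p \<omega>. 0 \<le> X p \<omega>"
    and le: "\<forall>\<^sub>F p in sequentially. (\<integral>\<^sup>+\<omega>. ennreal (X p \<omega>) \<partial>M p) \<le> ennreal (c p)" and c: "c \<longlonglongrightarrow> 0"
  shows "((\<lambda>z. X (fst z) (snd z)) \<longlongrightarrow> (0::real)) (whp M)"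
proof (rule tendstoI)
  fix e :: real assume e: "e > 0"
  define B where "B p = {\<omega> \<in> space (M p). e \<le> X p \<omega>}" for p
  have B: "B p \<in> sets (M p)" for p
    unfolding B_def using X[of p] by measurable
  have "(\<lambda>p. measure (M p) (B p)) \<longlonglongrightarrow> 0"
  proof (rule tendsto_sandwich[OF _ _ tendsto_const])
    \<comment> \<open>The absolute value covers indices at which \<open>c p\<close> is
      negative.\<close>
    show "(\<lambda>p. 1 / e * \<bar>c p\<bar>) \<longlonglongrightarrow> 0"
      using tendsto_mult[OF tendsto_const[of "1 / e"] tendsto_rabs[OF c]] by simp
    show "\<forall>\<^sub>F p in sequentially. measure (M p) (B p) \<le> 1 / e * \<bar>c p\<bar>"
      using le
    proof eventually_elim
      case (elim p)
      interpret prob_space "M p" by (rule M)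
      have "emeasure (M p) (B p) = (\<integral>\<^sup>+\<omega>. indicator (B p) \<omega> \<partial>M p)"
        using B by simp
      also have "\<dots> \<le> (\<integral>\<^sup>+\<omega>. ennreal (1 / e) * ennreal (X p \<omega>) \<partial>M p)"
      proof (rule nn_integral_mono)
        fix \<omega>
        have "1 \<le> 1 / e * X p \<omega>" if "e \<le> X p \<omega>" using that e by (simp add: field_simps)
        then show "indicator (B p) \<omega> \<le> ennreal (1 / e) * ennreal (X p \<omega>)"
          using e nn[of p \<omega>] by (auto simp: indicator_def B_def ennreal_mult[symmetric] ennreal_1[symmetric]
              simp del: ennreal_1 intro!: ennreal_leI)
      qed
      also have "\<dots> = ennreal (1 / e) * (\<integral>\<^sup>+\<omega>. ennreal (X p \<omega>) \<partial>M p)"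
        using X[of p] by (intro nn_integral_cmult) simp
      also have "\<dots> \<le> ennreal (1 / e) * ennreal \<bar>c p\<bar>"
        by (intro mult_left_mono order_trans[OF elim] ennreal_leI) auto
      also have "\<dots> = ennreal (1 / e * \<bar>c p\<bar>)"
        using e by (simp add: ennreal_mult[symmetric])
      finally show ?case
        using e by (simp add: emeasure_eq_measure ennreal_le_iff)
    qed
  qed simp
  then show "\<forall>\<^sub>F z in whp M. dist (X (fst z) (snd z)) 0 < e"
    unfolding eventually_whp using B nn
    by (intro exI[of _ B]) (auto simp: B_def not_le)
qed

lemma whp_second_moment:
  assumes X: "\<And>p. X p \<in> borel_measurable (M p)"
    and le: "\<forall>\<^sub>F p in sequentially. (\<integral>\<^sup>+\<omega>. ennreal ((X p \<omega>)\<^sup>2) \<partial>M p) \<le> ennreal (c p)" and c: "c \<longlonglongrightarrow> 0"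
  shows "((\<lambda>z. X (fst z) (snd z)) \<longlongrightarrow> (0::real)) (whp M)"
proof -
  have "((\<lambda>z. (X (fst z) (snd z))\<^sup>2) \<longlongrightarrow> 0) (whp M)"
    by (rule whp_markov[OF _ _ le c]) (use X in auto)
  from tendsto_real_sqrt[OF this] show ?thesis
    by (simp add: tendsto_rabs_zero_iff)
qed

lemma converges_in_prob_whp:
  assumes X: "\<And>p. X p \<in> borel_measurable (M p)"
    and lim: "((\<lambda>z. X (fst z) (snd z)) \<longlongrightarrow> ereal c) (whp M)"
  shows "converges_in_prob M X c"
  unfolding converges_in_prob_def
proof (intro conjI allI impI)
  show "X p \<in> borel_measurable (M p)" for p by (rule X)
  fix e :: real assume e: "e > 0"
  have "\<forall>\<^sub>F z in whp M. ereal (c - e) < X (fst z) (snd z)" "\<forall>\<^sub>F z in whp M. X (fst z) (snd z) < ereal (c + e)"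
    using e by (auto intro!: order_tendstoD[OF lim])
  then have "\<forall>\<^sub>F z in whp M. ereal (c - e) < X (fst z) (snd z) \<and> X (fst z) (snd z) < ereal (c + e)"
    by (rule eventually_conj)
  then obtain B where B: "\<And>p. B p \<in> sets (M p)" "(\<lambda>p. measure (M p) (B p)) \<longlonglongrightarrow> 0"
      "\<And>p \<omega>. \<omega> \<in> space (M p) - B p \<Longrightarrow> ereal (c - e) < X p \<omega> \<and> X p \<omega> < ereal (c + e)"
    unfolding eventually_whp by auto
  show "(\<lambda>p. measure (M p) {\<omega> \<in> space (M p). \<bar>X p \<omega> - ereal c\<bar> \<ge> ereal e}) \<longlonglongrightarrow> 0"
  proof (rule tendsto_sandwich[OF _ _ tendsto_const B(2)])
    show "\<forall>\<^sub>F p in sequentially. measure (M p) {\<omega> \<in> space (M p). \<bar>X p \<omega> - ereal c\<bar> \<ge> ereal e} \<le> measure (M p) (B p)"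
    proof (intro always_eventually allI)
      fix p
      interpret prob_space "M p" by (rule M)
      show "measure (M p) {\<omega> \<in> space (M p). \<bar>X p \<omega> - ereal c\<bar> \<ge> ereal e} \<le> measure (M p) (B p)"
      proof (rule finite_measure_mono[OF _ B(1)], safe, rule ccontr)
        fix \<omega> assume w: "\<omega> \<in> space (M p)" "ereal e \<le> \<bar>X p \<omega> - ereal c\<bar>" "\<omega> \<notin> B p"
        \<comment> \<open>Two finite one-sided bounds exclude the infinite values, so the comparison
          can be done in the reals.\<close>
        from B(3)[of \<omega> p] w obtain r where r: "X p \<omega> = ereal r"
          by (cases "X p \<omega>") auto
        have "c - e < r" "r < c + e" using B(3)[of \<omega> p] w(1,3) unfolding r by simp_all
        moreover have "e \<le> \<bar>r - c\<bar>" using w(2) unfolding r by simp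
        ultimately show False by linarith
      qed
    qed
  qed simp
qed

end

section \<open>Convergence in the regression model\<close>

lemma measurable_ridge_sq [measurable (raw)]:
  assumes f: "f \<in> M \<rightarrow>\<^sub>M mat_borel N p" and g: "g \<in> M \<rightarrow>\<^sub>M vec_borel N"
  shows "(\<lambda>x. dot N (ridge_residual N \<Delta> p (f x) (g x)) (ridge_residual N \<Delta> p (f x) (g x))) \<in> borel_measurable M"
  unfolding ridge_residual_def
  by (intro measurable_dot measurable_mv_resolvent[OF f] measurable_vec_component[OF g]) auto

lemma measurable_dot_self [measurable (raw)]:
  assumes g: "g \<in> M \<rightarrow>\<^sub>M vec_borel N"
  shows "(\<lambda>x. dot N (g x) (g x)) \<in> borel_measurable M"
  by (intro measurable_dot measurable_vec_component[OF g])

lemma measurable_norm_trace_raw [measurable (raw)]: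
  assumes f: "f \<in> M \<rightarrow>\<^sub>M mat_borel N p"
  shows "(\<lambda>x. norm_trace N \<Delta> p (f x)) \<in> borel_measurable M"
proof -
  have "(\<lambda>x. mat_trace N (resolvent N \<Delta> (f x) (rev [0..<p]))) \<in> borel_measurable M"
    by (rule measurable_mat_trace_resolvent[OF f]) auto
  then show ?thesis unfolding norm_trace_def by measurable
qed

lemma measurable_log_pivots [measurable (raw)]:
  assumes f: "f \<in> M \<rightarrow>\<^sub>M mat_borel N p"
  shows "(\<lambda>x. \<Sum>k<p. ln (1 + pivot N \<Delta> (f x) k / \<Delta>)) \<in> borel_measurable M"
  by (intro borel_measurable_sum borel_measurable_ln borel_measurable_add borel_measurable_divide
        measurable_pivot[OF f]) auto

lemma nn_integral_scaled_le:
  assumes "Y \<in> borel_measurable M" "k \<ge> 0" "\<And>\<omega>. 0 \<le> Y \<omega>"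
    and "(\<integral>\<^sup>+\<omega>. ennreal (Y \<omega>) \<partial>M) \<le> ennreal c" "c \<ge> 0"
  shows "(\<integral>\<^sup>+\<omega>. ennreal (k * Y \<omega>) \<partial>M) \<le> ennreal (k * c)"
proof -
  have "(\<integral>\<^sup>+\<omega>. ennreal (k * Y \<omega>) \<partial>M) = ennreal k * (\<integral>\<^sup>+\<omega>. ennreal (Y \<omega>) \<partial>M)"
    using assms by (subst nn_integral_cmult[symmetric]) (auto simp: ennreal_mult)
  also have "\<dots> \<le> ennreal k * ennreal c" by (intro mult_left_mono assms) auto
  finally show ?thesis using assms by (simp add: ennreal_mult)
qed

context linear_regression
begin

abbreviation "obs \<omega> \<equiv> observation N p \<Delta> (x \<omega>) (\<beta> \<omega>) (\<epsilon> \<omega>)"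

lemma obs_eq: "\<omega> \<in> space M \<Longrightarrow> i < N \<Longrightarrow> y \<omega> i = obs \<omega> i"
  by (simp add: y_eq observation_def)

lemma measurable_obs: "obs \<in> M \<rightarrow>\<^sub>M vec_borel N"
  by (intro measurable_observation x_measurable \<beta>_measurable \<epsilon>_measurable)

lemma prob_space_design: "prob_space (design N p)"
  unfolding x_law[symmetric] by (rule prob_space_distr[OF x_measurable])

text \<open>Bounds are proved over signal and noise for a fixed design and then averaged. The bound
  \<open>K\<close> may depend on the design, which the norm of the observation needs.\<close>

lemma nn_integral_obs_le:
  assumes h[measurable]: "(\<lambda>(A, v). h A v) \<in> borel_measurable (mat_borel N p \<Otimes>\<^sub>M vec_borel N)"
    and le: "\<And>A. A \<in> space (mat_borel N p) \<Longrightarrow>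
      (\<integral>\<^sup>+b. (\<integral>\<^sup>+e. h A (observation N p \<Delta> A b e) \<partial>gauss 1 {..<N}) \<partial>sphere_uniform p) \<le> K A"
  shows "(\<integral>\<^sup>+\<omega>. h (x \<omega>) (obs \<omega>) \<partial>M) \<le> (\<integral>\<^sup>+A. K A \<partial>design N p)"
proof -
  have "(\<lambda>z. (\<lambda>(A, v). h A v) (fst z, observation N p \<Delta> (fst z) (fst (snd z)) (snd (snd z))))
     \<in> borel_measurable (mat_borel N p \<Otimes>\<^sub>M (vec_borel p \<Otimes>\<^sub>M vec_borel N))"
    by (rule measurable_compose[OF _ h]) (intro measurable_Pair measurable_observation; measurable)
  then have m: "(\<lambda>(A, b, e). h A (observation N p \<Delta> A b e)) \<in> borel_measurable (mat_borel N p \<Otimes>\<^sub>M (vec_borel p \<Otimes>\<^sub>M vec_borel N))"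
    by (simp add: case_prod_unfold)
  have "(\<integral>\<^sup>+\<omega>. h (x \<omega>) (obs \<omega>) \<partial>M) =
    (\<integral>\<^sup>+A. (\<integral>\<^sup>+b. (\<integral>\<^sup>+e. h A (observation N p \<Delta> A b e) \<partial>gauss 1 {..<N}) \<partial>sphere_uniform p) \<partial>design N p)"
    using nn_integral_model[OF m] by simp
  also have "\<dots> \<le> (\<integral>\<^sup>+A. K A \<partial>design N p)"
    by (intro nn_integral_mono le) (simp add: space_PiM)
  finally show ?thesis .
qed

lemma nn_integral_obs_const_le:
  assumes "(\<lambda>(A, v). h A v) \<in> borel_measurable (mat_borel N p \<Otimes>\<^sub>M vec_borel N)"
    and "\<And>A. A \<in> space (mat_borel N p) \<Longrightarrow>
      (\<integral>\<^sup>+b. (\<integral>\<^sup>+e. h A (observation N p \<Delta> A b e) \<partial>gauss 1 {..<N}) \<partial>sphere_uniform p) \<le> c"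
  shows "(\<integral>\<^sup>+\<omega>. h (x \<omega>) (obs \<omega>) \<partial>M) \<le> c"
proof -
  interpret X: prob_space "design N p" by (rule prob_space_design)
  show ?thesis
    using nn_integral_obs_le[OF assms] by (simp add: X.emeasure_space_1)
qed

lemma nn_integral_design:
  assumes h: "h \<in> borel_measurable (mat_borel N p)"
  shows "(\<integral>\<^sup>+\<omega>. h (x \<omega>) \<partial>M) = (\<integral>\<^sup>+A. h A \<partial>design N p)"
  unfolding x_law[symmetric] using h by (subst nn_integral_distr[OF x_measurable]) auto

section \<open>Moment bounds in the model of fixed size\<close>

context
  assumes \<Delta>: "\<Delta> > 0" and N: "N > 0" and p: "p > 0"
begin

lemma resolvent_form_moment:
  "(\<integral>\<^sup>+\<omega>. ennreal (((resolvent_form N \<Delta> p (x \<omega>) (obs \<omega>) - \<Delta> * real N) / real p)\<^sup>2) \<partial>M)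
    \<le> ennreal (24 * \<Delta>\<^sup>2 * (real N / real p) * (1 / real p))"
proof -
  let ?h = "\<lambda>A v. (resolvent_form N \<Delta> p A v - \<Delta> * real N)\<^sup>2"
  note [measurable] = x_measurable measurable_obs
  have "(\<integral>\<^sup>+\<omega>. ennreal (?h (x \<omega>) (obs \<omega>)) \<partial>M) \<le> ennreal (24 * \<Delta>\<^sup>2 * real N)"
  proof (rule nn_integral_obs_const_le[where h="\<lambda>A v. ennreal (?h A v)"])
    show "(\<lambda>(A, v). ennreal (?h A v)) \<in> borel_measurable (mat_borel N p \<Otimes>\<^sub>M vec_borel N)"
      unfolding case_prod_unfold by measurable
  qed (rule resolvent_form_variance[OF N p \<Delta>])
  then have "(\<integral>\<^sup>+\<omega>. ennreal (1 / (real p)\<^sup>2 * ?h (x \<omega>) (obs \<omega>)) \<partial>M)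
      \<le> ennreal (1 / (real p)\<^sup>2 * (24 * \<Delta>\<^sup>2 * real N))"
    by (intro nn_integral_scaled_le) auto
  then show ?thesis by (simp add: power_divide power2_eq_square)
qed

lemma ridge_residual_moment:
  "(\<integral>\<^sup>+\<omega>. ennreal (((dot N (ridge_residual N \<Delta> p (x \<omega>) (obs \<omega>)) (ridge_residual N \<Delta> p (x \<omega>) (obs \<omega>))
      - \<Delta> * (real N * norm_trace N \<Delta> p (x \<omega>))) / real p)\<^sup>2) \<partial>M)
    \<le> ennreal (24 * \<Delta>\<^sup>2 * (real N / real p) * (1 / real p))"
proof -
  let ?h = "\<lambda>A v. (dot N (ridge_residual N \<Delta> p A v) (ridge_residual N \<Delta> p A v)
      - \<Delta> * (real N * norm_trace N \<Delta> p A))\<^sup>2"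
  note [measurable] = x_measurable measurable_obs
  have t: "real N * norm_trace N \<Delta> p A = mat_trace N (resolvent N \<Delta> A (rev [0..<p]))" for A
    using N by (simp add: norm_trace_def)
  have "(\<integral>\<^sup>+\<omega>. ennreal (?h (x \<omega>) (obs \<omega>)) \<partial>M) \<le> ennreal (24 * \<Delta>\<^sup>2 * real N)"
  proof (rule nn_integral_obs_const_le[where h="\<lambda>A v. ennreal (?h A v)"])
    show "(\<lambda>(A, v). ennreal (?h A v)) \<in> borel_measurable (mat_borel N p \<Otimes>\<^sub>M vec_borel N)"
      unfolding case_prod_unfold by measurable
  qed (unfold t, rule ridge_residual_variance[OF N p \<Delta>])
  then have "(\<integral>\<^sup>+\<omega>. ennreal (1 / (real p)\<^sup>2 * ?h (x \<omega>) (obs \<omega>)) \<partial>M)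
      \<le> ennreal (1 / (real p)\<^sup>2 * (24 * \<Delta>\<^sup>2 * real N))"
    by (intro nn_integral_scaled_le) auto
  then show ?thesis by (simp add: power_divide power2_eq_square)
qed

lemma norm_trace_moment:
  "(\<integral>\<^sup>+\<omega>. ennreal \<bar>norm_trace N \<Delta> p (x \<omega>) - mp_root \<Delta> (real p / real N)\<bar> \<partial>M)
    \<le> ennreal (3 * real p / (real N * \<Delta> * sqrt (real N)))"
proof -
  have [measurable]: "norm_trace N \<Delta> p \<in> borel_measurable (mat_borel N p)"
    by (rule measurable_norm_trace_raw) simp
  have "(\<lambda>A. ennreal \<bar>norm_trace N \<Delta> p A - mp_root \<Delta> (real p / real N)\<bar>) \<in> borel_measurable (mat_borel N p)"
    by measurable
  from nn_integral_design[OF this] norm_trace_l1[OF \<Delta> N, of p p] show ?thesis by simp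
qed

lemma log_pivot_moment:
  "(\<integral>\<^sup>+\<omega>. ennreal \<bar>(\<Sum>k<p. ln (1 + pivot N \<Delta> (x \<omega>) k / \<Delta>)) - (\<Sum>k<p. ln (1 + mp_root \<Delta> (real k / real N) / \<Delta>))\<bar> \<partial>M)
    \<le> ennreal (real p / \<Delta> * (2 / sqrt (real N) + 3 * real p / (real N * \<Delta> * sqrt (real N))))"
proof -
  have [measurable]: "(\<lambda>A. \<Sum>k<p. ln (1 + pivot N \<Delta> A k / \<Delta>)) \<in> borel_measurable (mat_borel N p)"
    by (rule measurable_log_pivots) simp
  have "(\<lambda>A. ennreal \<bar>(\<Sum>k<p. ln (1 + pivot N \<Delta> A k / \<Delta>)) - (\<Sum>k<p. ln (1 + mp_root \<Delta> (real k / real N) / \<Delta>))\<bar>)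
      \<in> borel_measurable (mat_borel N p)"
    by measurable
  from nn_integral_design[OF this] log_pivot_l1[OF \<Delta> N, of p] show ?thesis by simp
qed

lemma obs_norm_moment:
  "(\<integral>\<^sup>+\<omega>. ennreal (dot N (obs \<omega>) (obs \<omega>)) \<partial>M) \<le> ennreal (2 * (real p + \<Delta> * real N))"
proof -
  interpret X: prob_space "design N p" by (rule prob_space_design)
  have m: "(\<lambda>(A, v). ennreal (dot N v v)) \<in> borel_measurable (mat_borel N p \<Otimes>\<^sub>M vec_borel N)"
    unfolding case_prod_unfold by measurable
  have mk: "(\<lambda>A. ennreal (\<Sum>k<p. dot N (col A k) (col A k))) \<in> borel_measurable (design N p)"
    by (intro measurable_compose[OF _ measurable_ennreal] borel_measurable_sum measurable_dot
        measurable_col[OF measurable_id_design[OF \<Delta> N]]) auto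
  have "(\<integral>\<^sup>+\<omega>. ennreal (dot N (obs \<omega>) (obs \<omega>)) \<partial>M) \<le>
    (\<integral>\<^sup>+A. 2 * (ennreal (\<Sum>k<p. dot N (col A k) (col A k)) + ennreal (\<Delta> * real N)) \<partial>design N p)"
    by (rule nn_integral_obs_le[OF m]) (rule observation_sq_norm[OF N p \<Delta>])
  also have "\<dots> = 2 * ((\<integral>\<^sup>+A. ennreal (\<Sum>k<p. dot N (col A k) (col A k)) \<partial>design N p) + ennreal (\<Delta> * real N))"
    using mk by (subst nn_integral_cmult, measurable, subst nn_integral_add) (auto simp: X.emeasure_space_1)
  also have "\<dots> = 2 * (ennreal (real p) + ennreal (\<Delta> * real N))"
    unfolding design_sq_norm[OF \<Delta> N] ..
  also have "\<dots> = ennreal (2 * (real p + \<Delta> * real N))"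
    using \<Delta> by (subst ennreal_mult) auto
  finally show ?thesis .
qed

lemma partition_ratio_moment:
  "(\<integral>\<^sup>+\<omega>. ennreal (exp (log_gauss_partition N \<Delta> p (x \<omega>) (obs \<omega>)) / partition_function \<Delta> N p (x \<omega>) (obs \<omega>)) \<partial>M) \<le> 1"
proof (rule nn_integral_obs_const_le[where h="\<lambda>A v. ennreal (exp (log_gauss_partition N \<Delta> p A v) / partition_function \<Delta> N p A v)"])
  show "(\<lambda>(A, v). ennreal (exp (log_gauss_partition N \<Delta> p A v) / partition_function \<Delta> N p A v)) \<in> borel_measurable (mat_borel N p \<Otimes>\<^sub>M vec_borel N)"
    unfolding case_prod_unfold by measurable
  fix A assume "A \<in> space (mat_borel N p)"
  then show "(\<integral>\<^sup>+b. (\<integral>\<^sup>+e. ennreal (exp (log_gauss_partition N \<Delta> p A (observation N p \<Delta> A b e))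
      / partition_function \<Delta> N p A (observation N p \<Delta> A b e)) \<partial>gauss 1 {..<N}) \<partial>sphere_uniform p) \<le> 1"
    by (simp add: nn_integral_partition_ratio[OF \<Delta>])
qed

end

end

section \<open>Limits in probability along the sequence of models\<close>

context
  fixes \<alpha> \<Delta> :: real and N :: "nat \<Rightarrow> nat"
    and M :: "nat \<Rightarrow> 'a measure"
    and x :: "nat \<Rightarrow> 'a \<Rightarrow> nat \<times> nat \<Rightarrow> real"
    and \<beta> \<epsilon> y :: "nat \<Rightarrow> 'a \<Rightarrow> nat \<Rightarrow> real"
  assumes \<alpha>: "\<alpha> > 0" and \<Delta>: "\<Delta> > 0"
    and ratio: "(\<lambda>p. real (N p) / real p) \<longlonglongrightarrow> \<alpha>"
    and model: "\<And>p. linear_regression (M p) (N p) p \<Delta> (x p) (\<beta> p) (\<epsilon> p) (y p)"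
begin

lemma prob_M: "prob_space (M p)"
  using model[of p] by (simp add: linear_regression_def)

private abbreviation "v p \<omega> \<equiv> observation (N p) p \<Delta> (x p \<omega>) (\<beta> p \<omega>) (\<epsilon> p \<omega>)"

lemma measurable_x: "x p \<in> M p \<rightarrow>\<^sub>M mat_borel (N p) p"
  by (rule linear_regression.x_measurable[OF model])

lemma measurable_v: "v p \<in> M p \<rightarrow>\<^sub>M vec_borel (N p)"
  by (rule linear_regression.measurable_obs[OF model])

lemma eventually_pos: "\<forall>\<^sub>F p in sequentially. p > 0 \<and> N p > 0"
proof -
  have "\<forall>\<^sub>F p in sequentially. 0 < real (N p) / real p"
    using ratio \<alpha> by (rule order_tendstoD)
  then show ?thesis by eventually_elim (auto simp: zero_less_divide_iff)
qed

lemma inverse_ratio: "(\<lambda>p. real p / real (N p)) \<longlonglongrightarrow> 1 / \<alpha>"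
  using tendsto_inverse[OF ratio] \<alpha> by (simp add: inverse_eq_divide)

lemma lim_inverse_p: "(\<lambda>p. 1 / real p) \<longlonglongrightarrow> 0"
  by real_asymp

lemma lim_inverse_sqrt_p: "(\<lambda>p. 1 / sqrt (real p)) \<longlonglongrightarrow> 0"
  by real_asymp

lemma lim_inverse_sqrt_N: "(\<lambda>p. 1 / sqrt (real (N p))) \<longlonglongrightarrow> 0"
proof -
  have "(\<lambda>p. sqrt (real p / real (N p) * (1 / real p))) \<longlonglongrightarrow> sqrt (1 / \<alpha> * 0)"
    by (intro tendsto_intros inverse_ratio lim_inverse_p)
  then have "(\<lambda>p. sqrt (real p / real (N p) * (1 / real p))) \<longlonglongrightarrow> 0" by simp
  then show ?thesis
  proof (rule Lim_transform_eventually)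
    show "\<forall>\<^sub>F p in sequentially. sqrt (real p / real (N p) * (1 / real p)) = 1 / sqrt (real (N p))"
      using eventually_pos by eventually_elim (simp add: real_sqrt_divide)
  qed
qed

lemma resolvent_form_whp:
  "((\<lambda>(p, \<omega>). resolvent_form (N p) \<Delta> p (x p \<omega>) (v p \<omega>) / real p) \<longlongrightarrow> \<Delta> * \<alpha>) (whp M)"
proof -
  let ?X = "\<lambda>p \<omega>. (resolvent_form (N p) \<Delta> p (x p \<omega>) (v p \<omega>) - \<Delta> * real (N p)) / real p"
  have "((\<lambda>z. ?X (fst z) (snd z)) \<longlongrightarrow> 0) (whp M)"
  proof (rule whp_second_moment[OF prob_M])
    fix p
    note [measurable] = measurable_resolvent_form[OF measurable_x measurable_v]
    show "?X p \<in> borel_measurable (M p)" by measurable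
  next
    show "\<forall>\<^sub>F p in sequentially. (\<integral>\<^sup>+\<omega>. ennreal ((?X p \<omega>)\<^sup>2) \<partial>M p) \<le>
      ennreal (24 * \<Delta>\<^sup>2 * (real (N p) / real p) * (1 / real p))"
      using eventually_pos
      by eventually_elim (rule linear_regression.resolvent_form_moment[OF model \<Delta>], auto)
    show "(\<lambda>p. 24 * \<Delta>\<^sup>2 * (real (N p) / real p) * (1 / real p)) \<longlonglongrightarrow> 0"
      using tendsto_mult[OF tendsto_mult[OF tendsto_const[of "24 * \<Delta>\<^sup>2"] ratio] lim_inverse_p] by simp
  qed
  then have "((\<lambda>z. ?X (fst z) (snd z) + \<Delta> * (real (N (fst z)) / real (fst z))) \<longlongrightarrow> 0 + \<Delta> * \<alpha>) (whp M)"
    by (intro tendsto_add tendsto_mult tendsto_const tendsto_seq_whp[OF prob_M ratio])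
  then show ?thesis
    by (simp add: case_prod_unfold diff_divide_distrib)
qed

lemma norm_trace_whp:
  "((\<lambda>(p, \<omega>). norm_trace (N p) \<Delta> p (x p \<omega>)) \<longlongrightarrow> mp_root \<Delta> (1 / \<alpha>)) (whp M)"
proof -
  let ?X = "\<lambda>p \<omega>. norm_trace (N p) \<Delta> p (x p \<omega>) - mp_root \<Delta> (real p / real (N p))"
  have "((\<lambda>z. \<bar>?X (fst z) (snd z)\<bar>) \<longlongrightarrow> 0) (whp M)"
  proof (rule whp_markov[OF prob_M])
    fix p
    note [measurable] = measurable_norm_trace_raw[OF measurable_x]
    show "(\<lambda>\<omega>. \<bar>?X p \<omega>\<bar>) \<in> borel_measurable (M p)" by measurable
  next
    show "\<forall>\<^sub>F p in sequentially. (\<integral>\<^sup>+\<omega>. ennreal \<bar>?X p \<omega>\<bar> \<partial>M p) \<le>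
      ennreal (3 * real p / (real (N p) * \<Delta> * sqrt (real (N p))))"
      using eventually_pos
      by eventually_elim (rule linear_regression.norm_trace_moment[OF model \<Delta>], auto)
    have "(\<lambda>p. 3 / \<Delta> * (real p / real (N p)) * (1 / sqrt (real (N p)))) \<longlonglongrightarrow> 0"
      using tendsto_mult[OF tendsto_mult[OF tendsto_const[of "3 / \<Delta>"] inverse_ratio] lim_inverse_sqrt_N] by simp
    then show "(\<lambda>p. 3 * real p / (real (N p) * \<Delta> * sqrt (real (N p)))) \<longlonglongrightarrow> 0"
      by (simp add: mult_ac)
  qed simp
  then have "((\<lambda>z. ?X (fst z) (snd z)) \<longlongrightarrow> 0) (whp M)"
    by (rule tendsto_rabs_zero_cancel)
  then have "((\<lambda>z. ?X (fst z) (snd z) + mp_root \<Delta> (real (fst z) / real (N (fst z)))) \<longlongrightarrow> 0 + mp_root \<Delta> (1 / \<alpha>)) (whp M)"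
    by (intro tendsto_add tendsto_mp_root[OF \<Delta>] tendsto_seq_whp[OF prob_M inverse_ratio])
  then show ?thesis by (simp add: case_prod_unfold)
qed

lemma ridge_residual_whp:
  "((\<lambda>(p, \<omega>). dot (N p) (ridge_residual (N p) \<Delta> p (x p \<omega>) (v p \<omega>)) (ridge_residual (N p) \<Delta> p (x p \<omega>) (v p \<omega>)) / real p)
     \<longlongrightarrow> \<Delta> * (\<alpha> * mp_root \<Delta> (1 / \<alpha>))) (whp M)"
proof -
  let ?t = "\<lambda>p \<omega>. norm_trace (N p) \<Delta> p (x p \<omega>)"
  let ?X = "\<lambda>p \<omega>. (dot (N p) (ridge_residual (N p) \<Delta> p (x p \<omega>) (v p \<omega>)) (ridge_residual (N p) \<Delta> p (x p \<omega>) (v p \<omega>))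
      - \<Delta> * (real (N p) * ?t p \<omega>)) / real p"
  have "((\<lambda>z. ?X (fst z) (snd z)) \<longlongrightarrow> 0) (whp M)"
  proof (rule whp_second_moment[OF prob_M])
    fix p
    note [measurable] = measurable_ridge_sq[OF measurable_x measurable_v] measurable_norm_trace_raw[OF measurable_x]
    show "?X p \<in> borel_measurable (M p)" by measurable
  next
    show "\<forall>\<^sub>F p in sequentially. (\<integral>\<^sup>+\<omega>. ennreal ((?X p \<omega>)\<^sup>2) \<partial>M p) \<le>
      ennreal (24 * \<Delta>\<^sup>2 * (real (N p) / real p) * (1 / real p))"
      using eventually_pos
      by eventually_elim (rule linear_regression.ridge_residual_moment[OF model \<Delta>], auto)
    show "(\<lambda>p. 24 * \<Delta>\<^sup>2 * (real (N p) / real p) * (1 / real p)) \<longlonglongrightarrow> 0"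
      using tendsto_mult[OF tendsto_mult[OF tendsto_const[of "24 * \<Delta>\<^sup>2"] ratio] lim_inverse_p] by simp
  qed
  then have "((\<lambda>z. ?X (fst z) (snd z) + \<Delta> * (real (N (fst z)) / real (fst z) * ?t (fst z) (snd z)))
      \<longlongrightarrow> 0 + \<Delta> * (\<alpha> * mp_root \<Delta> (1 / \<alpha>))) (whp M)"
    using norm_trace_whp unfolding case_prod_unfold
    by (intro tendsto_add tendsto_mult tendsto_const tendsto_seq_whp[OF prob_M ratio])
  then show ?thesis
    by (simp add: case_prod_unfold diff_divide_distrib)
qed

text \<open>Two replacements: the random log pivots by their deterministic counterparts, and their
  sum by N times the limiting log determinant. The form y^T G y supplies the remaining
  constant.\<close>

lemma log_gauss_partition_whp:
  "((\<lambda>(p, \<omega>). log_gauss_partition (N p) \<Delta> p (x p \<omega>) (v p \<omega>) / real p) \<longlongrightarrow> limit_free_energy \<Delta> \<alpha>) (whp M)"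
proof -
  let ?S = "\<lambda>p \<omega>. \<Sum>k<p. ln (1 + pivot (N p) \<Delta> (x p \<omega>) k / \<Delta>)"
  let ?R = "\<lambda>p. \<Sum>k<p. ln (1 + mp_root \<Delta> (real k / real (N p)) / \<Delta>)"
  let ?c = "\<lambda>p. real p / \<Delta> * (2 / sqrt (real (N p)) + 3 * real p / (real (N p) * \<Delta> * sqrt (real (N p))))"
  \<comment> \<open>The mean error of the sum is of order p / sqrt N and vanishes after division by
    p.\<close>
  have "((\<lambda>z. 1 / real (fst z) * \<bar>?S (fst z) (snd z) - ?R (fst z)\<bar>) \<longlongrightarrow> 0) (whp M)"
  proof (rule whp_markov[OF prob_M])
    fix p
    note [measurable] = measurable_log_pivots[OF measurable_x]
    show "(\<lambda>\<omega>. 1 / real p * \<bar>?S p \<omega> - ?R p\<bar>) \<in> borel_measurable (M p)" by measurable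
  next
    show "\<forall>\<^sub>F p in sequentially. (\<integral>\<^sup>+\<omega>. ennreal (1 / real p * \<bar>?S p \<omega> - ?R p\<bar>) \<partial>M p) \<le> ennreal (1 / real p * ?c p)"
      using eventually_pos
    proof eventually_elim
      case (elim p)
      note [measurable] = measurable_log_pivots[OF measurable_x]
      show ?case
      proof (rule nn_integral_scaled_le)
        show "(\<lambda>\<omega>. \<bar>?S p \<omega> - ?R p\<bar>) \<in> borel_measurable (M p)" by measurable
        show "(\<integral>\<^sup>+\<omega>. ennreal \<bar>?S p \<omega> - ?R p\<bar> \<partial>M p) \<le> ennreal (?c p)"
          using elim by (intro linear_regression.log_pivot_moment[OF model \<Delta>]) auto
      qed (use \<Delta> in auto)
    qed
    have "(\<lambda>p. 1 / \<Delta> * (2 * (1 / sqrt (real (N p))) + 3 / \<Delta> * (real p / real (N p)) * (1 / sqrt (real (N p)))))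
        \<longlonglongrightarrow> 1 / \<Delta> * (2 * 0 + 3 / \<Delta> * (1 / \<alpha>) * 0)"
      by (intro tendsto_intros inverse_ratio lim_inverse_sqrt_N)
    then have "(\<lambda>p. 1 / \<Delta> * (2 * (1 / sqrt (real (N p))) + 3 / \<Delta> * (real p / real (N p)) * (1 / sqrt (real (N p))))) \<longlonglongrightarrow> 0"
      by simp
    then show "(\<lambda>p. 1 / real p * ?c p) \<longlonglongrightarrow> 0"
    proof (rule Lim_transform_eventually)
      show "\<forall>\<^sub>F p in sequentially. 1 / \<Delta> * (2 * (1 / sqrt (real (N p))) + 3 / \<Delta> * (real p / real (N p)) * (1 / sqrt (real (N p))))
          = 1 / real p * ?c p"
        using eventually_pos by eventually_elim (simp add: mult_ac)
    qed
  qed simp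
  then have "((\<lambda>z. \<bar>(?S (fst z) (snd z) - ?R (fst z)) / real (fst z)\<bar>) \<longlongrightarrow> 0) (whp M)"
    by (simp add: abs_divide)
  then have 1: "((\<lambda>z. (?S (fst z) (snd z) - ?R (fst z)) / real (fst z)) \<longlongrightarrow> 0) (whp M)"
    by (rule tendsto_rabs_zero_cancel)
  let ?\<psi> = "\<lambda>p. real (N p) / real p * mp_log_det \<Delta> (real p / real (N p))"
  have \<psi>: "?\<psi> \<longlonglongrightarrow> \<alpha> * mp_log_det \<Delta> (1 / \<alpha>)"
    using \<alpha> by (intro tendsto_mult ratio tendsto_mp_log_det[OF \<Delta>] inverse_ratio) auto
  have "(\<lambda>p. ?R p / real p - ?\<psi> p) \<longlonglongrightarrow> 0"
  proof (rule Lim_null_comparison)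
    show "(\<lambda>p. ln (1 + 1 / \<Delta>) * (1 / real p)) \<longlonglongrightarrow> 0"
      using tendsto_mult[OF tendsto_const lim_inverse_p] by simp
    show "\<forall>\<^sub>F p in sequentially. norm (?R p / real p - ?\<psi> p) \<le> ln (1 + 1 / \<Delta>) * (1 / real p)"
      using eventually_pos
    proof eventually_elim
      case (elim p)
      have "?R p / real p - ?\<psi> p = (?R p - real (N p) * mp_log_det \<Delta> (real p / real (N p))) / real p"
        by (simp add: diff_divide_distrib)
      also have "norm \<dots> = \<bar>?R p - real (N p) * mp_log_det \<Delta> (real p / real (N p))\<bar> / real p"
        by simp
      also have "\<dots> \<le> ln (1 + 1 / \<Delta>) / real p"
        using elim by (intro divide_right_mono mp_log_det_riemann_sum[OF \<Delta>]) auto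
      finally show ?case by simp
    qed
  qed
  from tendsto_add[OF this \<psi>] have "(\<lambda>p. ?R p / real p) \<longlonglongrightarrow> \<alpha> * mp_log_det \<Delta> (1 / \<alpha>)"
    by simp
  from tendsto_add[OF 1 tendsto_seq_whp[OF prob_M this]]
  have S: "((\<lambda>z. ?S (fst z) (snd z) / real (fst z)) \<longlongrightarrow> \<alpha> * mp_log_det \<Delta> (1 / \<alpha>)) (whp M)"
    by (simp add: diff_divide_distrib)
  have "((\<lambda>z. - (1 / 2) * (?S (fst z) (snd z) / real (fst z)) -
      resolvent_form (N (fst z)) \<Delta> (fst z) (x (fst z) (snd z)) (v (fst z) (snd z)) / real (fst z) / (2 * \<Delta>))
      \<longlongrightarrow> - (1 / 2) * (\<alpha> * mp_log_det \<Delta> (1 / \<alpha>)) - \<Delta> * \<alpha> / (2 * \<Delta>)) (whp M)"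
    using resolvent_form_whp \<Delta> unfolding case_prod_unfold
    by (intro tendsto_diff tendsto_mult tendsto_const tendsto_divide S) auto
  moreover have "- (1 / 2) * (\<alpha> * mp_log_det \<Delta> (1 / \<alpha>)) - \<Delta> * \<alpha> / (2 * \<Delta>) = limit_free_energy \<Delta> \<alpha>"
    using \<Delta> by (simp add: limit_free_energy_def)
  moreover have "- (1 / 2) * (s / q) - r / q / (2 * \<Delta>) = (- (1 / 2) * s - r / (2 * \<Delta>)) / q" for s r q :: real
    by (simp add: diff_divide_distrib mult_ac)
  ultimately show ?thesis
    unfolding case_prod_unfold log_gauss_partition_def by (simp only:)
qed

text \<open>Markov's inequality for the likelihood ratio, whose mean is at most 1, at the level
  exp(sqrt p). This level tends to infinity, while its logarithm divided by p tends to 0.\<close>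

lemma free_energy_lower_whp:
  "\<forall>\<^sub>F z in whp M. log_gauss_partition (N (fst z)) \<Delta> (fst z) (x (fst z) (snd z)) (v (fst z) (snd z)) / real (fst z)
      - 1 / sqrt (real (fst z)) \<le> free_energy \<Delta> (N (fst z)) (fst z) (x (fst z) (snd z)) (v (fst z) (snd z))"
proof -
  let ?L = "\<lambda>p \<omega>. log_gauss_partition (N p) \<Delta> p (x p \<omega>) (v p \<omega>)"
  let ?Z = "\<lambda>p \<omega>. partition_function \<Delta> (N p) p (x p \<omega>) (v p \<omega>)"
  have Z: "?Z p \<omega> > 0" for p \<omega> by (rule partition_function_nn_integral(2)[OF \<Delta>])
  note [measurable] = measurable_log_gauss_partition[OF measurable_x measurable_v]
    measurable_partition_function[OF measurable_x measurable_v]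
  have "((\<lambda>z. exp (- sqrt (real (fst z))) * (exp (?L (fst z) (snd z)) / ?Z (fst z) (snd z))) \<longlongrightarrow> 0) (whp M)"
  proof (rule whp_markov[OF prob_M])
    show "(\<lambda>\<omega>. exp (- sqrt (real p)) * (exp (?L p \<omega>) / ?Z p \<omega>)) \<in> borel_measurable (M p)" for p by measurable
    show "0 \<le> exp (- sqrt (real p)) * (exp (?L p \<omega>) / ?Z p \<omega>)" for p \<omega>
      using Z[of p \<omega>] by simp
    show "\<forall>\<^sub>F p in sequentially. (\<integral>\<^sup>+\<omega>. ennreal (exp (- sqrt (real p)) * (exp (?L p \<omega>) / ?Z p \<omega>)) \<partial>M p) \<le> ennreal (exp (- sqrt (real p)) * 1)"
      using eventually_pos
    proof eventually_elim
      case (elim p)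
      show ?case
      proof (rule nn_integral_scaled_le)
        show "(\<lambda>\<omega>. exp (?L p \<omega>) / ?Z p \<omega>) \<in> borel_measurable (M p)" by measurable
        show "(\<integral>\<^sup>+\<omega>. ennreal (exp (?L p \<omega>) / ?Z p \<omega>) \<partial>M p) \<le> ennreal 1"
          using elim linear_regression.partition_ratio_moment[OF model \<Delta>, of p] by simp
      qed (use Z in \<open>auto simp: less_imp_le\<close>)
    qed
    show "(\<lambda>p. exp (- sqrt (real p)) * 1) \<longlonglongrightarrow> 0" by real_asymp
  qed
  then have "\<forall>\<^sub>F z in whp M. exp (- sqrt (real (fst z))) * (exp (?L (fst z) (snd z)) / ?Z (fst z) (snd z)) < 1"
    by (rule order_tendstoD) simp
  moreover have "\<forall>\<^sub>F z in whp M. fst z > 0 \<and> N (fst z) > 0"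
    by (rule eventually_seq_whp[OF prob_M eventually_pos])
  ultimately show ?thesis
  proof eventually_elim
    case (elim z)
    obtain p \<omega> where z: "z = (p, \<omega>)" by (cases z)
    have "exp (- sqrt (real p)) * (exp (?L p \<omega>) / ?Z p \<omega>) = exp (- sqrt (real p) + ?L p \<omega> - ln (?Z p \<omega>))"
      using Z[of p \<omega>] by (simp add: exp_add exp_diff exp_minus field_simps)
    then have "- sqrt (real p) + ?L p \<omega> - ln (?Z p \<omega>) < 0"
      using elim(1) by (simp add: z)
    then have "(?L p \<omega> - sqrt (real p)) / real p \<le> ln (?Z p \<omega>) / real p"
      by (intro divide_right_mono) auto
    moreover have "sqrt (real p) / real p = 1 / sqrt (real p)"
      using elim(2) by (simp add: z real_div_sqrt field_simps)
    ultimately show ?case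
      by (simp add: z free_energy_def diff_divide_distrib)
  qed
qed

text \<open>The upper bound uses \<open>log_gauss_partition_ge\<close> with \<eta> = 1 / sqrt p:
  small enough for the factor 1 + \<eta> to disappear, large enough for the error with factor 1 + 1
  / \<eta> to be of order 1 / sqrt p.\<close>

lemma free_energy_whp:
  "((\<lambda>z. free_energy \<Delta> (N (fst z)) (fst z) (x (fst z) (snd z)) (v (fst z) (snd z))) \<longlongrightarrow> limit_free_energy \<Delta> \<alpha>) (whp M)"
proof -
  let ?L = "\<lambda>z. log_gauss_partition (N (fst z)) \<Delta> (fst z) (x (fst z) (snd z)) (v (fst z) (snd z)) / real (fst z)"
  let ?F = "\<lambda>z. free_energy \<Delta> (N (fst z)) (fst z) (x (fst z) (snd z)) (v (fst z) (snd z))"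
  \<comment> \<open>The factor of the squared norm in \<open>log_gauss_partition_ge\<close> at
    \<eta> = 1 / sqrt p, divided once more by p.\<close>
  let ?k = "\<lambda>p. (1 + sqrt (real p)) / (\<Delta> * real p * real p)"
  let ?X = "\<lambda>p \<omega>. ?k p * dot (N p) (v p \<omega>) (v p \<omega>)"
  have L: "(?L \<longlongrightarrow> limit_free_energy \<Delta> \<alpha>) (whp M)"
    using log_gauss_partition_whp by (simp add: case_prod_unfold)
  have X: "((\<lambda>z. ?X (fst z) (snd z)) \<longlongrightarrow> 0) (whp M)"
  proof (rule whp_markov[OF prob_M])
    fix p
    note [measurable] = measurable_dot_self[OF measurable_v]
    show "?X p \<in> borel_measurable (M p)" by measurable
    show "0 \<le> ?X p \<omega>" for \<omega> using \<Delta> by (intro mult_nonneg_nonneg dot_self_nonneg) auto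
  next
    show "\<forall>\<^sub>F p in sequentially. (\<integral>\<^sup>+\<omega>. ennreal (?X p \<omega>) \<partial>M p) \<le> ennreal (?k p * (2 * (real p + \<Delta> * real (N p))))"
      using eventually_pos
    proof eventually_elim
      case (elim p)
      show ?case
      proof (rule nn_integral_scaled_le)
        show "(\<lambda>\<omega>. dot (N p) (v p \<omega>) (v p \<omega>)) \<in> borel_measurable (M p)"
          by (rule measurable_dot_self[OF measurable_v])
        show "(\<integral>\<^sup>+\<omega>. ennreal (dot (N p) (v p \<omega>) (v p \<omega>)) \<partial>M p) \<le> ennreal (2 * (real p + \<Delta> * real (N p)))"
          using elim by (intro linear_regression.obs_norm_moment[OF model \<Delta>]) auto
      qed (use \<Delta> in \<open>auto simp: dot_self_nonneg\<close>)
    qed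
    have "(\<lambda>p. 2 / \<Delta> * (1 / real p + 1 / sqrt (real p)) * (1 + \<Delta> * (real (N p) / real p))) \<longlonglongrightarrow> 2 / \<Delta> * (0 + 0) * (1 + \<Delta> * \<alpha>)"
      by (intro tendsto_intros ratio lim_inverse_p lim_inverse_sqrt_p)
    then have "(\<lambda>p. 2 / \<Delta> * (1 / real p + 1 / sqrt (real p)) * (1 + \<Delta> * (real (N p) / real p))) \<longlonglongrightarrow> 0"
      by simp
    then show "(\<lambda>p. ?k p * (2 * (real p + \<Delta> * real (N p)))) \<longlonglongrightarrow> 0"
    proof (rule Lim_transform_eventually)
      show "\<forall>\<^sub>F p in sequentially. 2 / \<Delta> * (1 / real p + 1 / sqrt (real p)) * (1 + \<Delta> * (real (N p) / real p)) =
        ?k p * (2 * (real p + \<Delta> * real (N p)))"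
        using eventually_pos
      proof eventually_elim
        case (elim p)
        then have p: "real p > 0" by simp
        have "1 / sqrt (real p) = sqrt (real p) / real p"
          using p by (simp add: real_div_sqrt field_simps)
        then have a: "1 / real p + 1 / sqrt (real p) = (1 + sqrt (real p)) / real p"
          by (simp add: add_divide_distrib)
        have b: "1 + \<Delta> * (real (N p) / real p) = (real p + \<Delta> * real (N p)) / real p"
          using p by (simp add: add_divide_distrib)
        have "2 / \<Delta> * (s / q) * (t / q) = s / (\<Delta> * q * q) * (2 * t)" for s t q :: real
          by simp
        then show ?case unfolding a b .
      qed
    qed
  qed
  have up: "\<forall>\<^sub>F z in whp M. ?F z \<le> (?L z + ?X (fst z) (snd z)) / (1 + 1 / sqrt (real (fst z)))"
    using eventually_seq_whp[OF prob_M eventually_pos]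
  proof eventually_elim
    case (elim z)
    obtain p \<omega> where z: "z = (p, \<omega>)" by (cases z)
    have p: "p > 0" using elim by (simp add: z)
    define \<eta> where "\<eta> = 1 / sqrt (real p)"
    have \<eta>: "\<eta> > 0" using p by (simp add: \<eta>_def)
    let ?Z = "partition_function \<Delta> (N p) p (x p \<omega>) (v p \<omega>)"
    have "(1 + \<eta>) * ln ?Z - (1 + 1 / \<eta>) * dot (N p) (v p \<omega>) (v p \<omega>) / (\<Delta> * real p)
        \<le> log_gauss_partition (N p) \<Delta> p (x p \<omega>) (v p \<omega>)"
      by (rule log_gauss_partition_ge[OF \<Delta> p \<eta>])
    then have "((1 + \<eta>) * ln ?Z) / real p \<le> (log_gauss_partition (N p) \<Delta> p (x p \<omega>) (v p \<omega>)
        + (1 + 1 / \<eta>) * dot (N p) (v p \<omega>) (v p \<omega>) / (\<Delta> * real p)) / real p"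
      by (intro divide_right_mono) auto
    also have "\<dots> = ?L z + ?X p \<omega>"
      by (simp add: z add_divide_distrib[of "log_gauss_partition _ _ _ _ _"] \<eta>_def)
    finally have "(1 + \<eta>) * ?F z \<le> ?L z + ?X p \<omega>"
      by (simp add: z free_energy_def)
    then show ?case
      using \<eta> by (simp add: z \<eta>_def[symmetric] pos_le_divide_eq mult.commute)
  qed
  have l1: "((\<lambda>z. ?L z - 1 / sqrt (real (fst z))) \<longlongrightarrow> limit_free_energy \<Delta> \<alpha> - 0) (whp M)"
    by (intro tendsto_diff L tendsto_seq_whp[OF prob_M lim_inverse_sqrt_p])
  have l2: "((\<lambda>z. (?L z + ?X (fst z) (snd z)) / (1 + 1 / sqrt (real (fst z)))) \<longlongrightarrow> (limit_free_energy \<Delta> \<alpha> + 0) / (1 + 0)) (whp M)"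
    by (intro tendsto_divide tendsto_add L X tendsto_const tendsto_seq_whp[OF prob_M lim_inverse_sqrt_p]) simp
  show ?thesis
    by (rule tendsto_sandwich[OF free_energy_lower_whp up]) (use l1 l2 in simp_all)
qed

text \<open>The bounds meet because 1 - E = \<alpha> (1 - g) at the optimal E: the residual term
  -\<alpha> g / 2 of the ridge estimator and the term (1 - E) / 2 of \<open>entropic_optimal\<close>
  combine to the -\<alpha> / 2 of the upper bound.\<close>

lemma max_f_TAP_whp:
  "((\<lambda>z. max_f_TAP \<alpha> \<Delta> (N (fst z)) (fst z) (x (fst z) (snd z)) (v (fst z) (snd z))) \<longlongrightarrow> ereal (limit_free_energy \<Delta> \<alpha>)) (whp M)"
proof -
  let ?q = "\<lambda>z. resolvent_form (N (fst z)) \<Delta> (fst z) (x (fst z) (snd z)) (v (fst z) (snd z)) / real (fst z)"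
  let ?r = "\<lambda>z. ridge_residual (N (fst z)) \<Delta> (fst z) (x (fst z) (snd z)) (v (fst z) (snd z))"
  let ?w = "\<lambda>z. dot (N (fst z)) (?r z) (?r z) / real (fst z)"
  let ?E = "\<lambda>z. 1 - (?q z - ?w z) / \<Delta>"
  let ?g = "mp_root \<Delta> (1 / \<alpha>)"
  have q: "(?q \<longlongrightarrow> \<Delta> * \<alpha>) (whp M)"
    using resolvent_form_whp by (simp add: case_prod_unfold)
  have w: "(?w \<longlongrightarrow> \<Delta> * (\<alpha> * ?g)) (whp M)"
    using ridge_residual_whp by (simp add: case_prod_unfold)
  have "(?E \<longlongrightarrow> 1 - (\<Delta> * \<alpha> - \<Delta> * (\<alpha> * ?g)) / \<Delta>) (whp M)"
    using \<Delta> by (intro tendsto_intros q w) auto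
  moreover have "1 - (\<Delta> * \<alpha> - \<Delta> * (\<alpha> * ?g)) / \<Delta> = optimal_E \<Delta> \<alpha>"
    unfolding optimal_E_def using \<Delta> by (simp add: diff_divide_distrib right_diff_distrib)
  ultimately have E: "(?E \<longlongrightarrow> optimal_E \<Delta> \<alpha>) (whp M)" by simp
  have pos: "\<forall>\<^sub>F z in whp M. fst z > 0 \<and> N (fst z) > 0"
    by (rule eventually_seq_whp[OF prob_M eventually_pos])
  \<comment> \<open>The limit is positive, so the ridge estimator eventually lies inside the ball
    and the lower bound applies.\<close>
  have "\<forall>\<^sub>F z in whp M. ?E z > 0"
    using E optimal_E_bounds(1)[OF \<Delta> \<alpha>] by (rule order_tendstoD)
  with pos have lower: "\<forall>\<^sub>F z in whp M. ereal (- ?w z / (2 * \<Delta>) + entropic \<Delta> \<alpha> (?E z)) \<le>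
      max_f_TAP \<alpha> \<Delta> (N (fst z)) (fst z) (x (fst z) (snd z)) (v (fst z) (snd z))"
    by eventually_elim (rule max_f_TAP_ge[OF \<alpha> \<Delta>], auto)
  have upper: "\<forall>\<^sub>F z in whp M. max_f_TAP \<alpha> \<Delta> (N (fst z)) (fst z) (x (fst z) (snd z)) (v (fst z) (snd z))
      \<le> ereal (- ?q z / (2 * \<Delta>) - \<alpha> / 2 * mp_log_det \<Delta> (1 / \<alpha>))"
    using pos by eventually_elim (rule max_f_TAP_le[OF \<alpha> \<Delta>], auto)
  have "((\<lambda>z. - ?w z / (2 * \<Delta>) + entropic \<Delta> \<alpha> (?E z)) \<longlongrightarrow>
      - (\<Delta> * (\<alpha> * ?g)) / (2 * \<Delta>) + entropic \<Delta> \<alpha> (optimal_E \<Delta> \<alpha>)) (whp M)"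
    using \<Delta> optimal_E_bounds(1)[OF \<Delta> \<alpha>]
    by (intro tendsto_add tendsto_divide tendsto_minus w tendsto_const tendsto_entropic \<alpha> \<Delta> E) auto
  moreover have "- (\<Delta> * (\<alpha> * ?g)) / (2 * \<Delta>) + entropic \<Delta> \<alpha> (optimal_E \<Delta> \<alpha>) = limit_free_energy \<Delta> \<alpha>"
  proof -
    have "(1 - optimal_E \<Delta> \<alpha>) / 2 = \<alpha> / 2 - \<alpha> * ?g / 2"
      unfolding optimal_E_def by (simp add: right_diff_distrib diff_divide_distrib)
    moreover have "- (\<Delta> * (\<alpha> * ?g)) / (2 * \<Delta>) = - (\<alpha> * ?g / 2)"
      using \<Delta> by simp
    ultimately show ?thesis
      using entropic_optimal[OF \<Delta> \<alpha>] unfolding limit_free_energy_def by linarith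
  qed
  ultimately have l: "((\<lambda>z. ereal (- ?w z / (2 * \<Delta>) + entropic \<Delta> \<alpha> (?E z))) \<longlongrightarrow> ereal (limit_free_energy \<Delta> \<alpha>)) (whp M)"
    by simp
  have "((\<lambda>z. - ?q z / (2 * \<Delta>) - \<alpha> / 2 * mp_log_det \<Delta> (1 / \<alpha>)) \<longlongrightarrow>
      - (\<Delta> * \<alpha>) / (2 * \<Delta>) - \<alpha> / 2 * mp_log_det \<Delta> (1 / \<alpha>)) (whp M)"
    using \<Delta> by (intro tendsto_diff tendsto_divide tendsto_minus q tendsto_const) auto
  moreover have "- (\<Delta> * \<alpha>) / (2 * \<Delta>) - \<alpha> / 2 * mp_log_det \<Delta> (1 / \<alpha>) = limit_free_energy \<Delta> \<alpha>"
    using \<Delta> by (simp add: limit_free_energy_def)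
  ultimately have u: "((\<lambda>z. ereal (- ?q z / (2 * \<Delta>) - \<alpha> / 2 * mp_log_det \<Delta> (1 / \<alpha>))) \<longlongrightarrow> ereal (limit_free_energy \<Delta> \<alpha>)) (whp M)"
    by simp
  show ?thesis
    by (rule tendsto_sandwich[OF lower upper l u])
qed

section \<open>Transfer to the observed vector \<open>y\<close>\<close>

lemma y_eq_v: "\<omega> \<in> space (M p) \<Longrightarrow> i < N p \<Longrightarrow> y p \<omega> i = v p \<omega> i"
  by (rule linear_regression.obs_eq[OF model])

text \<open>\<open>y\<close> is tied to the restricted observation only on the sample space and at
  indices below N. The functional reads nothing else, so both measurability and the limit carry
  over.\<close>

lemma converges_max_f_TAP:
  "converges_in_prob M (\<lambda>p \<omega>. max_f_TAP \<alpha> \<Delta> (N p) p (x p \<omega>) (y p \<omega>)) (limit_free_energy \<Delta> \<alpha>)"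
proof (rule converges_in_prob_whp[OF prob_M])
  have eq: "max_f_TAP \<alpha> \<Delta> (N p) p (x p \<omega>) (y p \<omega>) = max_f_TAP \<alpha> \<Delta> (N p) p (x p \<omega>) (v p \<omega>)"
    if "\<omega> \<in> space (M p)" for p \<omega>
    by (rule max_f_TAP_cong) (rule y_eq_v[OF that])
  show "(\<lambda>\<omega>. max_f_TAP \<alpha> \<Delta> (N p) p (x p \<omega>) (y p \<omega>)) \<in> borel_measurable (M p)" for p
    using measurable_max_f_TAP[OF \<alpha> \<Delta> measurable_x measurable_v] by (subst measurable_cong[OF eq])
  show "((\<lambda>z. max_f_TAP \<alpha> \<Delta> (N (fst z)) (fst z) (x (fst z) (snd z)) (y (fst z) (snd z))) \<longlongrightarrow> ereal (limit_free_energy \<Delta> \<alpha>)) (whp M)"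
    by (rule Lim_transform_eventually[OF max_f_TAP_whp])
      (use eventually_space_whp[OF prob_M] in \<open>eventually_elim, simp add: eq\<close>)
qed

lemma converges_free_energy:
  "converges_in_prob M (\<lambda>p \<omega>. ereal (free_energy \<Delta> (N p) p (x p \<omega>) (y p \<omega>))) (limit_free_energy \<Delta> \<alpha>)"
proof (rule converges_in_prob_whp[OF prob_M])
  have eq: "ereal (free_energy \<Delta> (N p) p (x p \<omega>) (y p \<omega>)) = ereal (free_energy \<Delta> (N p) p (x p \<omega>) (v p \<omega>))"
    if "\<omega> \<in> space (M p)" for p \<omega>
    by (rule arg_cong[where f=ereal], rule free_energy_cong) (rule y_eq_v[OF that])
  show "(\<lambda>\<omega>. ereal (free_energy \<Delta> (N p) p (x p \<omega>) (y p \<omega>))) \<in> borel_measurable (M p)" for p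
  proof (subst measurable_cong[OF eq])
    note [measurable] = measurable_partition_function[OF measurable_x measurable_v]
    show "(\<lambda>\<omega>. ereal (free_energy \<Delta> (N p) p (x p \<omega>) (v p \<omega>))) \<in> borel_measurable (M p)"
      unfolding free_energy_def by measurable
  qed
  have "((\<lambda>z. ereal (free_energy \<Delta> (N (fst z)) (fst z) (x (fst z) (snd z)) (v (fst z) (snd z)))) \<longlongrightarrow> ereal (limit_free_energy \<Delta> \<alpha>)) (whp M)"
    using free_energy_whp by simp
  then show "((\<lambda>z. ereal (free_energy \<Delta> (N (fst z)) (fst z) (x (fst z) (snd z)) (y (fst z) (snd z)))) \<longlongrightarrow> ereal (limit_free_energy \<Delta> \<alpha>)) (whp M)"
    by (rule Lim_transform_eventually)
      (use eventually_space_whp[OF prob_M] in \<open>eventually_elim, simp only: eq\<close>)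
qed

end

theorem theorem2:
  fixes \<alpha> \<Delta> :: real and N :: "nat \<Rightarrow> nat"
    and M :: "nat \<Rightarrow> 'a measure"
    and x :: "nat \<Rightarrow> 'a \<Rightarrow> nat \<times> nat \<Rightarrow> real"
    and \<beta> \<epsilon> y :: "nat \<Rightarrow> 'a \<Rightarrow> nat \<Rightarrow> real"
  assumes "\<alpha> > 0" and "\<Delta> > 0"
    and "(\<lambda>p. real (N p) / real p) \<longlonglongrightarrow> \<alpha>"
    and "\<And>p. linear_regression (M p) (N p) p \<Delta> (x p) (\<beta> p) (\<epsilon> p) (y p)"
  shows "\<exists>L :: real.
    converges_in_prob M (\<lambda>p \<omega>. max_f_TAP \<alpha> \<Delta> (N p) p (x p \<omega>) (y p \<omega>)) L \<and>
    converges_in_prob M (\<lambda>p \<omega>. ereal (free_energy \<Delta> (N p) p (x p \<omega>) (y p \<omega>))) L"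
  using converges_max_f_TAP[OF assms] converges_free_energy[OF assms] by blast

end
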